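(* Let $\Gamma$ be a consistent dimer model in the real 2-torus $\mathbb{T}$, let $\theta$ be a generic stability parameter, and let $\sigma_+,\sigma_-\in\Sigma_\theta(3)$ be adjacent cones with $\tau=\sigma_+\cap\sigma_-\in\Sigma_\theta(2)$. Let $M_{\sigma_+}$ be the torus-invariant $\theta$-stable $A$-module associated to $\sigma_+$. By cutting the fundamental hexagon $\operatorname{Hex}(\sigma_+)$ in $\mathbb{R}^2$ along the edges of $\mathfrak{c}_-$ (that is, along the lifts to $\mathbb{R}^2$ of these edges) and rearranging the resulting jigsaw pieces, i.e. translating each piece by a suitably chosen element of the group $\mathbb{Z}^2$ of deck transformations of $\mathbb{R}^2\to\mathbb{T}$, one obtains $\operatorname{Hex}(\sigma_-)$, thereby determining the $\theta$-stable $A$-module $M_{\sigma_-}$ for the adjacent cone $\sigma_-$.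
   Context: Dimer models. A dimer model $\Gamma$ is a polygonal cell decomposition of the real 2-torus $\mathbb{T}=\mathbb{R}^2/\mathbb{Z}^2$ with nodes $\Gamma_0$, edges $\Gamma_1$ and tiles $\Gamma_2$, such that nodes are coloured black or white, every edge joins a black node to a white node, every tile is a simply-connected convex polygon, and there are no bivalent nodes. The dual quiver $Q=(Q_0,Q_1)$ has one vertex in each tile and one arrow $a$ crossing each edge $\mathfrak{e}_a\in\Gamma_1$, with the white endnode of $\mathfrak{e}_a$ to the right of $a$; write $\mathsf{t}(a),\mathsf{h}(a)$ for tail and head. The arrows around the white (resp. black) endnode of $\mathfrak{e}_a$ form a cycle $ap_a^+$ (resp. $ap_a^-$), with $p_a^\pm$ paths from $\mathsf{h}(a)$ to $\mathsf{t}(a)$. The Jacobian algebra is $A=\mathbb{C}Q/\langle p_a^+-p_a^-\mid a\in Q_1\rangle$. A zig-zag path is a path in the graph $(\Gamma_0,\Gamma_1)$ turning maximally right at white nodes and maximally left at black nodes. $\Gamma$ is consistent if there is no homologically trivial zig-zag path, no zig-zag path intersects itself on the universal cover, and no pair of zig-zag paths intersect each other on the universal cover in the same direction more than once. A perfect matching is a set of edges $\Pi$ such that every node is an endnode of a unique edge in $\Pi$. Moduli. $A$-modules are representations of $Q$ satisfying the relations. Let $\mathbf{v}=(1,\dots,1)\in\mathbb{N}^{Q_0}$. For $\theta\in\operatorname{Hom}(\mathbb{Z}^{Q_0},\mathbb{Q})$ with $\theta(\mathbf{v})=0$, an $A$-module of dimension vector $\mathbf{v}$ is $\theta$-semistable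 (resp. $\theta$-stable) if $\theta(\dim M')\geq 0$ (resp. $>0$) for every nonzero proper submodule $M'$; $\theta$ is generic if every $\theta$-semistable $A$-module of dimension vector $\mathbf{v}$ is $\theta$-stable. For generic $\theta$, $\mathcal{M}_\theta$ is the fine moduli space of $\theta$-stable $A$-modules of dimension vector $\mathbf{v}$; it is a smooth toric threefold, a projective crepant resolution of the Gorenstein affine toric threefold $\operatorname{Spec}Z(A)$, with fan $\Sigma_\theta$; $\Sigma_\theta(d)$ is the set of $d$-dimensional cones. Let $T$ be the tautological bundle; its fibre $T_y$ is the $\theta$-stable module parametrised by $y$. Modules $M_\sigma$. For $\rho\in\Sigma_\theta(1)$, let $y$ be any point of the 2-dimensional torus orbit $O_\rho$ and $(v_a)$ a representation giving $T_y$; then $\Pi_\rho=\{\mathfrak{e}_a\mid v_a=0\}$ is a perfect matching independent of choices. For $\sigma\in\Sigma_\theta$, $M_\sigma$ is the representation of dimension vector $\mathbf{v}$ with $v_a=0$ if $\mathfrak{e}_a\in\bigcup_{\rho\subseteq\sigma}\Pi_\rho$ and $v_a=1$ otherwise; it is a $\theta$-stable $A$-module. For $\sigma\in\Sigma_\theta(3)$, $Q^\sigma\subset Q$ is the subquiver with vertex set $Q_0$ and arrows those $a$ with $v_a\neq 0$ in $M_\sigma$. Fundamental hexagons. Let $\pi\colon\mathbb{R}^2\to\mathbb{T}$ be the universal cover, $\widetilde\Gamma$ and $\widetilde Q$ the preimages of $\Gamma$ and $Q$. Given $\sigma\in\Sigma_\theta(3)$, a fixed $i\in Q_0$ and a lift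 $\widetilde{i}\in\pi^{-1}(i)$, there is a unique subquiver $\widetilde{Q^\sigma}\subset\widetilde Q$ containing $\widetilde{i}$ that $\pi$ identifies with $Q^\sigma$. The fundamental hexagon $\operatorname{Hex}(\sigma)\subset\mathbb{R}^2$ is the union of the tiles of $\widetilde\Gamma$ dual to the vertices of $\widetilde{Q^\sigma}$; it is a fundamental domain for $\mathbb{Z}^2$ acting on $\mathbb{R}^2$, is well defined up to translation by $\mathbb{Z}^2$, and encodes the quiver $Q^\sigma$ and hence $M_\sigma$. Jigsaw pieces. Let $\sigma_\pm\in\Sigma_\theta(3)$ be distinct with common facet $\tau=\sigma_+\cap\sigma_-\in\Sigma_\theta(2)$. Let $\rho_0,\rho_1,\rho_2$ be the rays of $\sigma_+$ and $\rho_1,\rho_2,\rho_3$ those of $\sigma_-$, and write $\Pi_k=\Pi_{\rho_k}$. Put $\mathfrak{m}_{j,k}=(\Pi_j\cup\Pi_k)\setminus(\Pi_j\cap\Pi_k)$ and $\mathfrak{c}_-:=\mathfrak{m}_{1,3}\cap\mathfrak{m}_{2,3}$, regarded as a subset of the edges in the boundary of $\operatorname{Hex}(\sigma_-)$. A jigsaw piece for $\tau$ is the closure of a connected component of $\mathbb{T}\setminus\bigcup_{0\le k\le 3}\Pi_k$; it is a union of tiles, and jigsaw pieces are drawn in $\mathbb{R}^2$ via lifts. *)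

theory Defs
  imports "HOL-Analysis.Analysis"
begin

section \<open>The torus and dimer models\<close>

text \<open>
  The plane is \<^typ>\<open>complex\<close> with deck group the Gaussian integers, indexed by \<^typ>\<open>int \<times> int\<close>;
  the torus is realised as the product of two unit circles, which is the quotient of the plane by
  this group.
\<close>

definition shift :: "int \<times> int \<Rightarrow> complex"
  where "shift m = Complex (of_int (fst m)) (of_int (snd m))"

definition translate :: "int \<times> int \<Rightarrow> complex set \<Rightarrow> complex set"
  where "translate m P = (\<lambda>z. shift m + z) ` P"

definition torus_proj :: "complex \<Rightarrow> complex \<times> complex"
  where "torus_proj z = (cis (2 * pi * Re z), cis (2 * pi * Im z))"

text \<open>
  Cells of the torus are indexed by finite types: \<^typ>\<open>'v\<close> for tiles (vertices of the dual quiver)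
  and \<^typ>\<open>'e\<close> for edges (arrows). The record fixes for every tile, and for every edge with its
  black and white endnode, one lift to the plane. All lifts are then indexed by
  \<^typ>\<open>'v \<times> (int \<times> int)\<close> and \<^typ>\<open>'e \<times> (int \<times> int)\<close>, and \<^term>\<open>fst\<close> is the covering map on cells.
\<close>

record ('v, 'e) dimer =
  tile :: "'v \<Rightarrow> complex set"
  black_end :: "'e \<Rightarrow> complex"
  white_end :: "'e \<Rightarrow> complex"

type_synonym 'c lifted = "'c \<times> (int \<times> int)"

definition tile_lift :: "('v, 'e) dimer \<Rightarrow> 'v lifted \<Rightarrow> complex set"
  where "tile_lift \<Gamma> x = translate (snd x) (tile \<Gamma> (fst x))"

definition black_lift :: "('v, 'e) dimer \<Rightarrow> 'e lifted \<Rightarrow> complex"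
  where "black_lift \<Gamma> x = shift (snd x) + black_end \<Gamma> (fst x)"

definition white_lift :: "('v, 'e) dimer \<Rightarrow> 'e lifted \<Rightarrow> complex"
  where "white_lift \<Gamma> x = shift (snd x) + white_end \<Gamma> (fst x)"

definition edge_lift :: "('v, 'e) dimer \<Rightarrow> 'e lifted \<Rightarrow> complex set"
  where "edge_lift \<Gamma> x = closed_segment (black_lift \<Gamma> x) (white_lift \<Gamma> x)"

definition open_edge_lift :: "('v, 'e) dimer \<Rightarrow> 'e lifted \<Rightarrow> complex set"
  where "open_edge_lift \<Gamma> x = open_segment (black_lift \<Gamma> x) (white_lift \<Gamma> x)"

definition nodes :: "('v, 'e) dimer \<Rightarrow> complex set"
  where "nodes \<Gamma> = range (black_lift \<Gamma>) \<union> range (white_lift \<Gamma>)"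

text \<open>
  The lifted cells decompose the plane: it is the disjoint union of the nodes, the open edges and
  the open tiles, and the boundary of each tile is a union of edges.
\<close>

definition dimer_model :: "('v::finite, 'e::finite) dimer \<Rightarrow> bool"
  where "dimer_model \<Gamma> \<longleftrightarrow>
    range (black_lift \<Gamma>) \<inter> range (white_lift \<Gamma>) = {} \<and>
    (\<forall>i. polytope (tile \<Gamma> i) \<and> interior (tile \<Gamma> i) \<noteq> {}) \<and>
    (\<forall>i. frontier (tile \<Gamma> i) = \<Union>{edge_lift \<Gamma> x |x. edge_lift \<Gamma> x \<subseteq> frontier (tile \<Gamma> i)}) \<and>
    disjoint_family (open_edge_lift \<Gamma>) \<and>
    disjoint_family (\<lambda>x. interior (tile_lift \<Gamma> x)) \<and>
    (\<forall>x. open_edge_lift \<Gamma> x \<inter> nodes \<Gamma> = {}) \<and>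
    (\<forall>x. interior (tile_lift \<Gamma> x) \<inter> nodes \<Gamma> = {}) \<and>
    (\<forall>x y. interior (tile_lift \<Gamma> x) \<inter> open_edge_lift \<Gamma> y = {}) \<and>
    nodes \<Gamma> \<union> (\<Union>x. open_edge_lift \<Gamma> x) \<union> (\<Union>x. interior (tile_lift \<Gamma> x)) = UNIV \<and>
    (\<forall>x. card {y. black_lift \<Gamma> y = black_lift \<Gamma> x} \<noteq> 2) \<and>
    (\<forall>x. card {y. white_lift \<Gamma> y = white_lift \<Gamma> x} \<noteq> 2)"


section \<open>Zig-zag paths and consistency\<close>

text \<open>
  Arriving at a node along \<open>x\<close>, the direction straight back has counterclockwise angle 0 from
  \<open>x\<close> (seen from the node), the sharpest right turn has the smallest positive counterclockwise
  angle from it, and the sharpest left turn the smallest positive clockwise angle.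
\<close>

definition right_turn :: "('v, 'e) dimer \<Rightarrow> 'e lifted \<Rightarrow> 'e lifted \<Rightarrow> bool"
  where "right_turn \<Gamma> x y \<longleftrightarrow>
    (let d = (\<lambda>z. black_lift \<Gamma> z - white_lift \<Gamma> z) in
      white_lift \<Gamma> y = white_lift \<Gamma> x \<and> y \<noteq> x \<and>
      (\<forall>z. white_lift \<Gamma> z = white_lift \<Gamma> x \<and> z \<noteq> x \<longrightarrow> Arg2pi (d y / d x) \<le> Arg2pi (d z / d x)))"

definition left_turn :: "('v, 'e) dimer \<Rightarrow> 'e lifted \<Rightarrow> 'e lifted \<Rightarrow> bool"
  where "left_turn \<Gamma> x y \<longleftrightarrow>
    (let d = (\<lambda>z. white_lift \<Gamma> z - black_lift \<Gamma> z) in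
      black_lift \<Gamma> y = black_lift \<Gamma> x \<and> y \<noteq> x \<and>
      (\<forall>z. black_lift \<Gamma> z = black_lift \<Gamma> x \<and> z \<noteq> x \<longrightarrow> Arg2pi (d x / d y) \<le> Arg2pi (d x / d z)))"

text \<open>
  A zig-zag path on the universal cover as a bi-infinite sequence of lifted edges, indexed so that
  the edges with even index are traversed from black to white.
\<close>

definition zigzag :: "('v, 'e) dimer \<Rightarrow> (int \<Rightarrow> 'e lifted) \<Rightarrow> bool"
  where "zigzag \<Gamma> z \<longleftrightarrow>
    (\<forall>k. right_turn \<Gamma> (z (2 * k)) (z (2 * k + 1)) \<and> left_turn \<Gamma> (z (2 * k + 1)) (z (2 * k + 2)))"

text \<open>
  A zig-zag path on the torus is homologically trivial iff its lift closes up. Two paths meet on the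
  universal cover when they share a lifted edge, and they meet twice in the same direction when both
  run through two common edges in the same order. A pair consists of two paths on the universal
  cover that differ by more than a reparametrisation (possibly two lifts of one path on the torus).
\<close>

definition consistent :: "('v, 'e) dimer \<Rightarrow> bool"
  where "consistent \<Gamma> \<longleftrightarrow>
    (\<forall>z. zigzag \<Gamma> z \<longrightarrow> \<not> (\<exists>n>0. \<forall>k. z (k + n) = z k)) \<and>
    (\<forall>z. zigzag \<Gamma> z \<longrightarrow> \<not> (\<exists>i j. i \<noteq> j \<and> z i = z j)) \<and>
    (\<forall>z z'. zigzag \<Gamma> z \<and> zigzag \<Gamma> z' \<and> \<not> (\<exists>n. \<forall>k. z' k = z (k + n)) \<longrightarrow>
      \<not> (\<exists>i j i' j'. i < j \<and> i' < j' \<and> z i = z' i' \<and> z j = z' j'))"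


section \<open>The dual quiver and modules of dimension vector \<open>(1,\<dots>,1)\<close>\<close>

text \<open>
  The white endnode lies to the right of an arrow, so its head is the tile on the left of the edge
  when the edge is traversed from black to white. The sign of the imaginary part below is that of
  the determinant of (white - black, p - black).
\<close>

definition left_of :: "('v, 'e) dimer \<Rightarrow> 'e lifted \<Rightarrow> complex set"
  where "left_of \<Gamma> x = {p. Im (cnj (white_lift \<Gamma> x - black_lift \<Gamma> x) * (p - black_lift \<Gamma> x)) > 0}"

definition right_of :: "('v, 'e) dimer \<Rightarrow> 'e lifted \<Rightarrow> complex set"
  where "right_of \<Gamma> x = {p. Im (cnj (white_lift \<Gamma> x - black_lift \<Gamma> x) * (p - black_lift \<Gamma> x)) < 0}"

definition head_lift :: "('v, 'e) dimer \<Rightarrow> 'e lifted \<Rightarrow> 'v lifted"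
  where "head_lift \<Gamma> x =
    (THE y. edge_lift \<Gamma> x \<subseteq> tile_lift \<Gamma> y \<and> interior (tile_lift \<Gamma> y) \<subseteq> left_of \<Gamma> x)"

definition tail_lift :: "('v, 'e) dimer \<Rightarrow> 'e lifted \<Rightarrow> 'v lifted"
  where "tail_lift \<Gamma> x =
    (THE y. edge_lift \<Gamma> x \<subseteq> tile_lift \<Gamma> y \<and> interior (tile_lift \<Gamma> y) \<subseteq> right_of \<Gamma> x)"

definition head :: "('v, 'e) dimer \<Rightarrow> 'e \<Rightarrow> 'v"
  where "head \<Gamma> a = fst (head_lift \<Gamma> (a, 0))"

definition tail :: "('v, 'e) dimer \<Rightarrow> 'e \<Rightarrow> 'v"
  where "tail \<Gamma> a = fst (tail_lift \<Gamma> (a, 0))"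

text \<open>
  The arrows of the paths $p_a^+$ and $p_a^-$. Every arrow has just one white and one black
  endnode, so each occurs exactly once in the cycle around such a node.
\<close>

definition plus_path :: "('v, 'e) dimer \<Rightarrow> 'e \<Rightarrow> 'e set"
  where "plus_path \<Gamma> a = {b. \<exists>m. white_lift \<Gamma> (b, m) = white_lift \<Gamma> (a, 0)} - {a}"

definition minus_path :: "('v, 'e) dimer \<Rightarrow> 'e \<Rightarrow> 'e set"
  where "minus_path \<Gamma> a = {b. \<exists>m. black_lift \<Gamma> (b, m) = black_lift \<Gamma> (a, 0)} - {a}"

text \<open>
  In dimension vector \<open>(1,\<dots>,1)\<close> each arrow acts by a scalar, and a path acts by the product
  of the scalars of its arrows. The following are the relations of the Jacobian algebra.
\<close>

definition is_module :: "('v, 'e::finite) dimer \<Rightarrow> complex ^ 'e \<Rightarrow> bool"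
  where "is_module \<Gamma> v \<longleftrightarrow> (\<forall>a. (\<Prod>b\<in>plus_path \<Gamma> a. v $ b) = (\<Prod>b\<in>minus_path \<Gamma> a. v $ b))"

definition submodule :: "('v, 'e::finite) dimer \<Rightarrow> complex ^ 'e \<Rightarrow> ('v \<Rightarrow> complex set) \<Rightarrow> bool"
  where "submodule \<Gamma> v W \<longleftrightarrow>
    (\<forall>i. vector_space_over_itself.subspace (W i)) \<and>
    (\<forall>a. \<forall>z \<in> W (tail \<Gamma> a). v $ a * z \<in> W (head \<Gamma> a))"

definition nonzero_proper :: "('v \<Rightarrow> complex set) \<Rightarrow> bool"
  where "nonzero_proper W \<longleftrightarrow> (\<exists>i. W i \<noteq> {0}) \<and> (\<exists>i. W i \<noteq> UNIV)"

text \<open>The dimensions here are over the complex numbers.\<close>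

definition theta_dim :: "('v::finite \<Rightarrow> rat) \<Rightarrow> ('v \<Rightarrow> complex set) \<Rightarrow> rat"
  where "theta_dim \<theta> W = (\<Sum>i\<in>UNIV. \<theta> i * of_nat (vector_space_over_itself.dim (W i)))"

definition theta_semistable :: "('v::finite, 'e::finite) dimer \<Rightarrow> ('v \<Rightarrow> rat) \<Rightarrow> complex ^ 'e \<Rightarrow> bool"
  where "theta_semistable \<Gamma> \<theta> v \<longleftrightarrow> is_module \<Gamma> v \<and>
    (\<forall>W. submodule \<Gamma> v W \<and> nonzero_proper W \<longrightarrow> theta_dim \<theta> W \<ge> 0)"

definition theta_stable :: "('v::finite, 'e::finite) dimer \<Rightarrow> ('v \<Rightarrow> rat) \<Rightarrow> complex ^ 'e \<Rightarrow> bool"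
  where "theta_stable \<Gamma> \<theta> v \<longleftrightarrow> is_module \<Gamma> v \<and>
    (\<forall>W. submodule \<Gamma> v W \<and> nonzero_proper W \<longrightarrow> theta_dim \<theta> W > 0)"

definition stability_parameter :: "('v::finite \<Rightarrow> rat) \<Rightarrow> bool"
  where "stability_parameter \<theta> \<longleftrightarrow> (\<Sum>i\<in>UNIV. \<theta> i) = 0"

definition generic :: "('v::finite, 'e::finite) dimer \<Rightarrow> ('v \<Rightarrow> rat) \<Rightarrow> bool"
  where "generic \<Gamma> \<theta> \<longleftrightarrow> (\<forall>v. theta_semistable \<Gamma> \<theta> v \<longrightarrow> theta_stable \<Gamma> \<theta> v)"


section \<open>The moduli space and its fan\<close>

definition iso_class :: "('v, 'e::finite) dimer \<Rightarrow> complex ^ 'e \<Rightarrow> (complex ^ 'e) set"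
  where "iso_class \<Gamma> v =
    {(\<chi> a. g (head \<Gamma> a) * v $ a / g (tail \<Gamma> a)) |g. \<forall>i. g i \<noteq> 0}"

definition quotient_topology :: "'a topology \<Rightarrow> ('a \<Rightarrow> 'b) \<Rightarrow> 'b topology"
  where "quotient_topology X f =
    topology (\<lambda>U. U \<subseteq> f ` topspace X \<and> openin X {x \<in> topspace X. f x \<in> U})"

lemma openin_quotient_topology:
  "openin (quotient_topology X f) U \<longleftrightarrow>
    U \<subseteq> f ` topspace X \<and> openin X {x \<in> topspace X. f x \<in> U}"
proof -
  have "istopology (\<lambda>U. U \<subseteq> f ` topspace X \<and> openin X {x \<in> topspace X. f x \<in> U})"
    unfolding istopology_def
  proof (intro conjI allI impI)
    fix S T
    assume "S \<subseteq> f ` topspace X \<and> openin X {x \<in> topspace X. f x \<in> S}"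
      and "T \<subseteq> f ` topspace X \<and> openin X {x \<in> topspace X. f x \<in> T}"
    moreover have "{x \<in> topspace X. f x \<in> S \<inter> T} =
        {x \<in> topspace X. f x \<in> S} \<inter> {x \<in> topspace X. f x \<in> T}" by auto
    ultimately show "S \<inter> T \<subseteq> f ` topspace X" "openin X {x \<in> topspace X. f x \<in> S \<inter> T}"
      by auto
  next
    fix \<K> :: "'a set set"
    assume *: "\<forall>K\<in>\<K>. K \<subseteq> f ` topspace X \<and> openin X {x \<in> topspace X. f x \<in> K}"
    then show "\<Union>\<K> \<subseteq> f ` topspace X" by blast
    have "{x \<in> topspace X. f x \<in> \<Union>\<K>} = (\<Union>K\<in>\<K>. {x \<in> topspace X. f x \<in> K})" by auto
    then show "openin X {x \<in> topspace X. f x \<in> \<Union>\<K>}" using * by auto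
  qed
  then show ?thesis by (simp add: quotient_topology_def topology_inverse')
qed

text \<open>The set of closed points of the moduli space, with its analytic topology.\<close>

definition moduli_space ::
  "('v::finite, 'e::finite) dimer \<Rightarrow> ('v \<Rightarrow> rat) \<Rightarrow> (complex ^ 'e) set topology"
  where "moduli_space \<Gamma> \<theta> =
    quotient_topology (top_of_set {v. theta_stable \<Gamma> \<theta> v}) (iso_class \<Gamma>)"

text \<open>
  The torus of the moduli space consists of the classes of the modules on which no arrow acts by
  zero; it acts by componentwise multiplication. Its cocharacters are the integer weights on arrows
  compatible with the relations, modulo those coming from the change of basis at the vertices, the
  integer points of \<open>coboundaries\<close>. Subsets of the real vector space of the fan, which is the
  quotient of the space of compatible real weights by \<open>coboundaries\<close>, are represented by their
  preimages in \<^typ>\<open>real ^ 'e\<close>. This respects inclusions and intersections, but adds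
  \<^term>\<open>dim (coboundaries \<Gamma>)\<close> to every dimension.
\<close>

definition big_torus :: "('v, 'e::finite) dimer \<Rightarrow> (complex ^ 'e) set"
  where "big_torus \<Gamma> = {s. is_module \<Gamma> s \<and> (\<forall>a. s $ a \<noteq> 0)}"

definition cocharacters :: "('v, 'e::finite) dimer \<Rightarrow> (int ^ 'e) set"
  where "cocharacters \<Gamma> =
    {u. \<forall>a. (\<Sum>b\<in>plus_path \<Gamma> a. u $ b) = (\<Sum>b\<in>minus_path \<Gamma> a. u $ b)}"

definition coboundaries :: "('v, 'e::finite) dimer \<Rightarrow> (real ^ 'e) set"
  where "coboundaries \<Gamma> = {(\<chi> a. f (head \<Gamma> a) - f (tail \<Gamma> a)) |f. True}"

definition one_param :: "int ^ 'e \<Rightarrow> complex \<Rightarrow> complex ^ 'e"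
  where "one_param u t = (\<chi> a. t powi (u $ a))"

text \<open>
  The fan of a toric variety is recovered from its one-parameter subgroups: those with a given limit
  (at 0) are the lattice points in the relative interior of one cone of the fan, they generate that
  cone, and the limit lies in the torus orbit corresponding to it.
\<close>

definition limit_weights ::
  "('v::finite, 'e::finite) dimer \<Rightarrow> ('v \<Rightarrow> rat) \<Rightarrow> (complex ^ 'e) set \<Rightarrow> (int ^ 'e) set"
  where "limit_weights \<Gamma> \<theta> y = {u \<in> cocharacters \<Gamma>.
    limitin (moduli_space \<Gamma> \<theta>) (\<lambda>t. iso_class \<Gamma> (one_param u t)) y (at 0)}"

definition distinguished ::
  "('v::finite, 'e::finite) dimer \<Rightarrow> ('v \<Rightarrow> rat) \<Rightarrow> (complex ^ 'e) set set"
  where "distinguished \<Gamma> \<theta> = {y. limit_weights \<Gamma> \<theta> y \<noteq> {}}"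

definition cone_at ::
  "('v::finite, 'e::finite) dimer \<Rightarrow> ('v \<Rightarrow> rat) \<Rightarrow> (complex ^ 'e) set \<Rightarrow> (real ^ 'e) set"
  where "cone_at \<Gamma> \<theta> y =
    closure (convex_cone hull ((\<lambda>u. \<chi> a. of_int (u $ a)) ` limit_weights \<Gamma> \<theta> y))"

definition fan ::
  "('v::finite, 'e::finite) dimer \<Rightarrow> ('v \<Rightarrow> rat) \<Rightarrow> (real ^ 'e) set set"
  where "fan \<Gamma> \<theta> = cone_at \<Gamma> \<theta> ` distinguished \<Gamma> \<theta>"

definition cones ::
  "('v::finite, 'e::finite) dimer \<Rightarrow> ('v \<Rightarrow> rat) \<Rightarrow> nat \<Rightarrow> (real ^ 'e) set set"
  where "cones \<Gamma> \<theta> d = {\<sigma> \<in> fan \<Gamma> \<theta>. dim \<sigma> = d + dim (coboundaries \<Gamma>)}"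

definition rays ::
  "('v::finite, 'e::finite) dimer \<Rightarrow> ('v \<Rightarrow> rat) \<Rightarrow> (real ^ 'e) set \<Rightarrow> (real ^ 'e) set set"
  where "rays \<Gamma> \<theta> \<sigma> = {\<rho> \<in> cones \<Gamma> \<theta> 1. \<rho> \<subseteq> \<sigma>}"

definition torus_orbit ::
  "('v::finite, 'e::finite) dimer \<Rightarrow> ('v \<Rightarrow> rat) \<Rightarrow> (real ^ 'e) set \<Rightarrow> (complex ^ 'e) set set"
  where "torus_orbit \<Gamma> \<theta> \<sigma> =
    {iso_class \<Gamma> (\<chi> a. s $ a * v $ a) |s v. s \<in> big_torus \<Gamma> \<and> theta_stable \<Gamma> \<theta> v \<and>
      iso_class \<Gamma> v \<in> distinguished \<Gamma> \<theta> \<and> cone_at \<Gamma> \<theta> (iso_class \<Gamma> v) = \<sigma>}"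


section \<open>The modules attached to cones, and fundamental hexagons\<close>

text \<open>
  A point of the moduli space is the set of all representations giving the module it parametrises,
  so the chosen \<open>v\<close> is a representation giving a point of the orbit.
\<close>

definition matching ::
  "('v::finite, 'e::finite) dimer \<Rightarrow> ('v \<Rightarrow> rat) \<Rightarrow> (real ^ 'e) set \<Rightarrow> 'e set"
  where "matching \<Gamma> \<theta> \<rho> = {a. (SOME v. v \<in> \<Union>(torus_orbit \<Gamma> \<theta> \<rho>)) $ a = 0}"

definition cone_module ::
  "('v::finite, 'e::finite) dimer \<Rightarrow> ('v \<Rightarrow> rat) \<Rightarrow> (real ^ 'e) set \<Rightarrow> complex ^ 'e"
  where "cone_module \<Gamma> \<theta> \<sigma> =
    (\<chi> a. if a \<in> (\<Union>\<rho>\<in>rays \<Gamma> \<theta> \<sigma>. matching \<Gamma> \<theta> \<rho>) then 0 else 1)"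

definition cone_arrows ::
  "('v::finite, 'e::finite) dimer \<Rightarrow> ('v \<Rightarrow> rat) \<Rightarrow> (real ^ 'e) set \<Rightarrow> 'e set"
  where "cone_arrows \<Gamma> \<theta> \<sigma> = {a. cone_module \<Gamma> \<theta> \<sigma> $ a \<noteq> 0}"

text \<open>
  A subquiver \<open>(V, A)\<close> of the lifted quiver that the covering map identifies with the subquiver
  having all vertices and arrow set \<open>B\<close>.
\<close>

definition lifts_subquiver ::
  "('v, 'e) dimer \<Rightarrow> 'e set \<Rightarrow> 'v lifted set \<times> 'e lifted set \<Rightarrow> bool"
  where "lifts_subquiver \<Gamma> B Q \<longleftrightarrow> (case Q of (V, A) \<Rightarrow>
    (\<forall>x\<in>A. head_lift \<Gamma> x \<in> V \<and> tail_lift \<Gamma> x \<in> V) \<and>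
    bij_betw fst V UNIV \<and> bij_betw fst A B)"

definition lifted_quiver ::
  "('v::finite, 'e::finite) dimer \<Rightarrow> ('v \<Rightarrow> rat) \<Rightarrow> (real ^ 'e) set \<Rightarrow> 'v lifted
    \<Rightarrow> 'v lifted set \<times> 'e lifted set"
  where "lifted_quiver \<Gamma> \<theta> \<sigma> i = (THE Q. i \<in> fst Q \<and> lifts_subquiver \<Gamma> (cone_arrows \<Gamma> \<theta> \<sigma>) Q)"

definition hexagon ::
  "('v::finite, 'e::finite) dimer \<Rightarrow> ('v \<Rightarrow> rat) \<Rightarrow> (real ^ 'e) set \<Rightarrow> 'v lifted \<Rightarrow> complex set"
  where "hexagon \<Gamma> \<theta> \<sigma> i = \<Union>(tile_lift \<Gamma> ` fst (lifted_quiver \<Gamma> \<theta> \<sigma> i))"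


section \<open>Jigsaw pieces\<close>

definition edge_set_lift :: "('v, 'e) dimer \<Rightarrow> 'e set \<Rightarrow> complex set"
  where "edge_set_lift \<Gamma> E = \<Union>(edge_lift \<Gamma> ` (E \<times> UNIV))"

definition jigsaw_pieces :: "('v, 'e) dimer \<Rightarrow> 'e set \<Rightarrow> (complex \<times> complex) set set"
  where "jigsaw_pieces \<Gamma> E =
    closure ` components (range torus_proj - torus_proj ` edge_set_lift \<Gamma> E)"

definition cut_pieces :: "('v, 'e) dimer \<Rightarrow> 'e set \<Rightarrow> complex set \<Rightarrow> complex set set"
  where "cut_pieces \<Gamma> E H = closure ` components (interior H - edge_set_lift \<Gamma> E)"

text \<open>
  \<open>H'\<close> is obtained by translating each of the pieces by a deck transformation, the translated pieces
  overlapping at most along their boundaries.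
\<close>

definition rearranges_to :: "complex set set \<Rightarrow> complex set \<Rightarrow> bool"
  where "rearranges_to \<P> H' \<longleftrightarrow> (\<exists>m :: complex set \<Rightarrow> int \<times> int.
    (\<Union>P\<in>\<P>. translate (m P) P) = H' \<and>
    pairwise (\<lambda>P P'. interior (translate (m P) P) \<inter> interior (translate (m P') P') = {}) \<P>)"

definition sym_diff_edges :: "'e set \<Rightarrow> 'e set \<Rightarrow> 'e set"
  where "sym_diff_edges P P' = (P \<union> P') - (P \<inter> P')"

end

theory Submission
  imports Defs
begin

text \<open>
  A torus-fixed stable module is determined by its set \<open>S\<close> of nonzero arrows, and its cone consists
  of the nonnegative arrow weights that vanish on \<open>S\<close> and have equal sums at all nodes, modulo
  coboundaries. By Hall's theorem these weights are sums of perfect matchings disjoint from \<open>S\<close>, which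
  are therefore the matchings of the rays; so \<open>S\<close> is the complement of the union of these matchings.
  If the cone has dimension 3, Euler's formula shows that the first cohomology of the torus restricts
  to zero on \<open>S\<close>, so the quiver \<open>S\<close> lifts to the plane. For the same reason two perfect matchings
  disjoint from \<open>S\<close> agree on the edges having both adjacent tiles in the fundamental hexagon: apart
  from \<open>S\<close>, its interior only contains slits, which lie in all three matchings of the cone and never
  separate tiles. Thus the pieces of the hexagon of \<open>\<sigma>p\<close> cut along \<open>c_minus\<close> are the connected
  components of the quiver of arrows common to both cones. On each component the two lifts differ by
  a constant deck transformation, and translating by it rearranges the pieces to the other hexagon.
  The hexagon determines \<open>S\<close>, because the difference of two matchings is exact on the common lift and
  stability forces its potential to be constant.
\<close>

section \<open>Lattice translates\<close>

text \<open>The fan is defined by analytic limits, and the obstacle is the change of basis, which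
  may vary with the parameter: weights have a meaning only modulo coboundaries. Stability removes
  this freedom twice. The arrows of a stable module connect all vertices, so walks in
  \<open>S\<close> normalise a weight; and a potential that weakly rises along one stable arrow set
  and weakly falls along another is constant. The passage from dimension 3 to a lift is a count:
  weights with sum zero at every node are the cocycles, at most two dimensions more than the
  coboundaries. Among the weights vanishing on \<open>S\<close> those of sum zero still have
  dimension at least 2 and meet the coboundaries only in 0, so together they exhaust the cocycles;
  subtracting one of them from the displacement leaves a coboundary that agrees with it on
  \<open>S\<close>. For the cut, membership in the fourth matching decides: an edge inside the
  hexagon lying in the first three matchings belongs to \<open>c_minus\<close> unless it also lies
  in the fourth, and one lying in none of the three belongs to it exactly if it lies in the
  fourth.\<close>

lemma shift_add: "shift (m + n) = shift m + shift n"
  by (simp add: shift_def complex_eq_iff)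

lemma shift_0 [simp]: "shift 0 = 0"
  by (simp add: shift_def complex_eq_iff)

lemma shift_eq_iff [simp]: "shift m = shift n \<longleftrightarrow> m = n"
  by (auto simp: shift_def complex_eq_iff prod_eq_iff)

lemma translate_eq_plus: "translate m P = (+) (shift m) ` P"
  by (simp add: translate_def)

lemma mem_translate: "z \<in> translate m P \<longleftrightarrow> z - shift m \<in> P"
  unfolding translate_def image_iff by (metis add_diff_cancel_left' diff_add_cancel add.commute)

lemma translate_add: "translate (m + n) P = translate m (translate n P)"
  by (auto simp: mem_translate shift_add algebra_simps)

lemma interior_translate: "interior (translate m P) = translate m (interior P)"
  by (simp add: translate_eq_plus interior_translation)

lemma frontier_translate: "frontier (translate m P) = translate m (frontier P)"
  by (simp add: translate_eq_plus frontier_translation)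

lemma translate_Union: "translate m (\<Union>A) = \<Union>(translate m ` A)"
  by (auto simp: mem_translate)

lemma translate_mono_iff: "translate m A \<subseteq> translate m B \<longleftrightarrow> A \<subseteq> B"
  unfolding translate_def by (rule inj_image_subset_iff) (simp add: inj_on_def)

text \<open>Discreteness of the lattice, the source of local finiteness for the lifted
  cells.\<close>

lemma finite_norm_shift_le: "finite {k. norm (shift k) \<le> C}"
proof (rule finite_subset)
  show "{k. norm (shift k) \<le> C} \<subseteq> {-\<lceil>C\<rceil>..\<lceil>C\<rceil>} \<times> {-\<lceil>C\<rceil>..\<lceil>C\<rceil>}"
  proof
    fix k assume "k \<in> {k. norm (shift k) \<le> C}"
    then have "\<bar>Re (shift k)\<bar> \<le> C" "\<bar>Im (shift k)\<bar> \<le> C"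
      using abs_Re_le_cmod abs_Im_le_cmod order_trans by blast+
    then have "\<bar>real_of_int (fst k)\<bar> \<le> C" "\<bar>real_of_int (snd k)\<bar> \<le> C"
      by (auto simp: shift_def)
    then have "fst k \<in> {-\<lceil>C\<rceil>..\<lceil>C\<rceil>}" "snd k \<in> {-\<lceil>C\<rceil>..\<lceil>C\<rceil>}"
      by (auto simp: abs_le_iff; linarith)+
    then show "k \<in> {-\<lceil>C\<rceil>..\<lceil>C\<rceil>} \<times> {-\<lceil>C\<rceil>..\<lceil>C\<rceil>}"
      by (cases k) auto
  qed
qed simp

text \<open>A translate that meets \<open>S\<close> is moved by at most the radius of
  \<open>S\<close> plus a common radius of the finitely many sets \<open>A i\<close>.\<close>

lemma finite_translates_meeting:
  fixes A :: "'c::finite \<Rightarrow> complex set"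
  assumes "\<And>i. bounded (A i)" "bounded S"
  shows "finite {x. translate (snd x) (A (fst x)) \<inter> S \<noteq> {}}"
proof -
  obtain M where M: "\<And>z. z \<in> S \<Longrightarrow> norm z \<le> M"
    using assms(2) bounded_iff by metis
  have "bounded (\<Union>i. A i)" using assms(1) by (auto intro: bounded_UN)
  then obtain R where R: "\<And>z i. z \<in> A i \<Longrightarrow> norm z \<le> R"
    unfolding bounded_iff by auto
  have "{x. translate (snd x) (A (fst x)) \<inter> S \<noteq> {}} \<subseteq> UNIV \<times> {k. norm (shift k) \<le> M + R}"
  proof safe
    fix i k z assume "z \<in> translate (snd (i, k)) (A (fst (i, k)))" "z \<in> S"
    then have "norm z \<le> M" "norm (z - shift k) \<le> R" using M R by (auto simp: mem_translate)
    then show "norm (shift k) \<le> M + R"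
      using norm_triangle_ineq4[of z "z - shift k"] by simp
  qed auto
  moreover have "finite (UNIV \<times> {k. norm (shift k) \<le> M + R} :: ('c \<times> int \<times> int) set)"
    using finite_norm_shift_le by (simp add: finite_cartesian_product)
  ultimately show ?thesis by (rule finite_subset)
qed

text \<open>Near a given point only finitely many translates occur. The index set \<open>C\<close>
  is arbitrary so that the cells missing a given point can be removed all at once.\<close>

lemma closed_Union_translates:
  fixes A :: "'c::finite \<Rightarrow> complex set"
  assumes "\<And>i. compact (A i)"
  shows "closed (\<Union>x\<in>C. translate (snd x) (A (fst x)))"
proof -
  let ?B = "\<lambda>x. translate (snd x) (A (fst x))"
  have cl: "closed (?B x)" for x
    using assms by (simp add: translate_eq_plus closed_translation compact_imp_closed)
  have "open (- (\<Union>x\<in>C. ?B x))"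
  proof (subst open_contains_ball, intro ballI)
    fix z assume z: "z \<in> - (\<Union>x\<in>C. ?B x)"
    define F where "F = {x \<in> C. ?B x \<inter> ball z 1 \<noteq> {}}"
    have "finite F" unfolding F_def
      using finite_translates_meeting[of A "ball z 1"] assms compact_imp_bounded
      by (auto intro: rev_finite_subset)
    then have "open (ball z 1 - (\<Union>x\<in>F. ?B x))" using cl by (intro open_Diff closed_UN) auto
    moreover have "z \<in> ball z 1 - (\<Union>x\<in>F. ?B x)" using z by (auto simp: F_def)
    ultimately obtain e where "e > 0" "ball z e \<subseteq> ball z 1 - (\<Union>x\<in>F. ?B x)"
      using open_contains_ball by metis
    then have "ball z e \<subseteq> - (\<Union>x\<in>C. ?B x)"
      unfolding F_def by blast
    then show "\<exists>e>0. ball z e \<subseteq> - (\<Union>x\<in>C. ?B x)" using \<open>e > 0\<close> by blast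
  qed
  then show ?thesis by (simp add: open_closed)
qed

text \<open>The determinant of two plane vectors, in the form in which \<open>left_of\<close> and
  \<open>right_of\<close> are stated.\<close>

definition cross :: "complex \<Rightarrow> complex \<Rightarrow> real"
  where "cross a b = Im (cnj a * b)"

lemma cross_eq: "cross a b = Re a * Im b - Im a * Re b"
  by (simp add: cross_def)

lemma cross_inner: "cross a b = inner (\<i> * a) b"
  by (simp add: cross_eq inner_complex_def)

lemma cross_normal: "cross d (a *\<^sub>R d + c *\<^sub>R (\<i> * d)) = c * (norm d)\<^sup>2"
  unfolding cross_eq cmod_power2 by (simp add: algebra_simps power2_eq_square)

lemma cross_eq_0D: "a \<noteq> 0 \<Longrightarrow> cross a b = 0 \<Longrightarrow> \<exists>s::real. b = s *\<^sub>R a"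
proof -
  assume a: "a \<noteq> 0" and c: "cross a b = 0"
  show ?thesis
  proof (cases "Re a = 0")
    case True
    then have "b = (Im b / Im a) *\<^sub>R a" using a c by (auto simp: complex_eq_iff cross_eq)
    then show ?thesis by blast
  next
    case False
    then have "b = (Re b / Re a) *\<^sub>R a" using c by (auto simp: complex_eq_iff cross_eq field_simps)
    then show ?thesis by blast
  qed
qed

lemma right_left_cross:
  "left_of \<Gamma> x = {p. cross (white_lift \<Gamma> x - black_lift \<Gamma> x) (p - black_lift \<Gamma> x) > 0}"
  "right_of \<Gamma> x = {p. cross (white_lift \<Gamma> x - black_lift \<Gamma> x) (p - black_lift \<Gamma> x) < 0}"
  by (auto simp: left_of_def right_of_def cross_def)

text \<open>The deck group acting on the indices of lifted cells; all incidence data are equivariant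
  for it.\<close>

definition mv :: "int \<times> int \<Rightarrow> 'c lifted \<Rightarrow> 'c lifted"
  where "mv k x = (fst x, snd x + k)"

lemma mv_simps [simp]: "fst (mv k x) = fst x" "snd (mv k x) = snd x + k" "mv 0 x = x"
  by (simp_all add: mv_def)

lemma mv_mv [simp]: "mv k (mv l x) = mv (l + k) x"
  by (simp add: mv_def add.assoc)

lemma mv_Pair: "(a, k) = mv k (a, 0)"
  by (simp add: mv_def)

lemma tile_lift_mv: "tile_lift \<Gamma> (mv k x) = translate k (tile_lift \<Gamma> x)"
  by (simp add: tile_lift_def translate_add[symmetric] add.commute)

lemma black_lift_mv: "black_lift \<Gamma> (mv k x) = shift k + black_lift \<Gamma> x"
  and white_lift_mv: "white_lift \<Gamma> (mv k x) = shift k + white_lift \<Gamma> x"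
  by (simp_all add: black_lift_def white_lift_def shift_add)

lemma edge_lift_mv: "edge_lift \<Gamma> (mv k x) = translate k (edge_lift \<Gamma> x)"
  by (simp add: edge_lift_def black_lift_mv white_lift_mv translate_eq_plus closed_segment_translation)

lemma edge_lift_translate: "edge_lift \<Gamma> x = translate (snd x) (edge_lift \<Gamma> (fst x, 0))"
  using edge_lift_mv[of \<Gamma> "snd x" "(fst x, 0)"] by (simp add: mv_def)

text \<open>A signed form of \<open>left_of\<close> and \<open>right_of\<close>, so that heads and
  tails are handled by one argument with \<open>s\<close> equal to 1 or -1.\<close>

definition side :: "('v, 'e) dimer \<Rightarrow> real \<Rightarrow> 'e lifted \<Rightarrow> complex set"
  where "side \<Gamma> s x = {p. s * cross (white_lift \<Gamma> x - black_lift \<Gamma> x) (p - black_lift \<Gamma> x) > 0}"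

lemma left_of_side: "left_of \<Gamma> x = side \<Gamma> 1 x"
  and right_of_side: "right_of \<Gamma> x = side \<Gamma> (-1) x"
  by (auto simp: right_left_cross side_def)

lemma side_inner:
  "side \<Gamma> s x = {p. inner (s *\<^sub>R \<i> * (white_lift \<Gamma> x - black_lift \<Gamma> x)) p >
     inner (s *\<^sub>R \<i> * (white_lift \<Gamma> x - black_lift \<Gamma> x)) (black_lift \<Gamma> x)}"
  by (auto simp: side_def cross_eq inner_complex_def algebra_simps)

lemma convex_side: "convex (side \<Gamma> s x)"
  unfolding side_inner by (rule convex_halfspace_gt)

lemma side_mv: "p \<in> side \<Gamma> s (mv k x) \<longleftrightarrow> p - shift k \<in> side \<Gamma> s x"
  by (simp add: side_def black_lift_mv white_lift_mv algebra_simps)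

section \<open>Cells of a lifted dimer model\<close>

locale dimer_geometry =
  fixes \<Gamma> :: "('v::finite, 'e::finite) dimer"
  assumes dimer: "dimer_model \<Gamma>"
begin

abbreviation "T \<equiv> tile_lift \<Gamma>"
abbreviation "Ec \<equiv> edge_lift \<Gamma>"
abbreviation "Eo \<equiv> open_edge_lift \<Gamma>"
abbreviation "bl \<equiv> black_lift \<Gamma>"
abbreviation "wl \<equiv> white_lift \<Gamma>"
abbreviation "Hd \<equiv> head_lift \<Gamma>"
abbreviation "Tl \<equiv> tail_lift \<Gamma>"

lemma dimer_axioms:
  "range bl \<inter> range wl = {}"
  "polytope (tile \<Gamma> i)" "interior (tile \<Gamma> i) \<noteq> {}"
  "frontier (tile \<Gamma> i) = \<Union>{Ec x |x. Ec x \<subseteq> frontier (tile \<Gamma> i)}"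
  "disjoint_family Eo" "disjoint_family (\<lambda>x. interior (T x))"
  "Eo x \<inter> nodes \<Gamma> = {}" "interior (T y) \<inter> nodes \<Gamma> = {}" "interior (T y) \<inter> Eo x = {}"
  "nodes \<Gamma> \<union> (\<Union>x. Eo x) \<union> (\<Union>x. interior (T x)) = UNIV"
proof -
  note D = dimer[unfolded dimer_model_def]
  show "range bl \<inter> range wl = {}" by (rule D[THEN conjunct1])
  show "polytope (tile \<Gamma> i)" "interior (tile \<Gamma> i) \<noteq> {}" using D[THEN conjunct2, THEN conjunct1, THEN spec[of _ i]] by simp_all
  show "frontier (tile \<Gamma> i) = \<Union>{Ec x |x. Ec x \<subseteq> frontier (tile \<Gamma> i)}"
    by (rule D[THEN conjunct2, THEN conjunct2, THEN conjunct1, THEN spec])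
  show "disjoint_family Eo" by (rule D[THEN conjunct2, THEN conjunct2, THEN conjunct2, THEN conjunct1])
  show "disjoint_family (\<lambda>x. interior (T x))" by (rule D[THEN conjunct2, THEN conjunct2, THEN conjunct2, THEN conjunct2, THEN conjunct1])
  show "Eo x \<inter> nodes \<Gamma> = {}" by (rule D[THEN conjunct2, THEN conjunct2, THEN conjunct2, THEN conjunct2, THEN conjunct2, THEN conjunct1, THEN spec])
  show "interior (T y) \<inter> nodes \<Gamma> = {}" by (rule D[THEN conjunct2, THEN conjunct2, THEN conjunct2, THEN conjunct2, THEN conjunct2, THEN conjunct2, THEN conjunct1, THEN spec])
  show "interior (T y) \<inter> Eo x = {}" by (rule D[THEN conjunct2, THEN conjunct2, THEN conjunct2, THEN conjunct2, THEN conjunct2, THEN conjunct2, THEN conjunct2, THEN conjunct1, THEN spec, THEN spec])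
  show "nodes \<Gamma> \<union> (\<Union>x. Eo x) \<union> (\<Union>x. interior (T x)) = UNIV" by (rule D[THEN conjunct2, THEN conjunct2, THEN conjunct2, THEN conjunct2, THEN conjunct2, THEN conjunct2, THEN conjunct2, THEN conjunct2, THEN conjunct1])
qed

lemma polytope_T: "polytope (T x)"
  using dimer_axioms(2) unfolding tile_lift_def translate_eq_plus
  by (simp add: polytope_translation_eq)

lemma convex_T: "convex (T x)" and compact_T: "compact (T x)" and closed_T: "closed (T x)"
  using polytope_T[of x] by (auto intro: polytope_imp_convex polytope_imp_compact polytope_imp_closed)

lemma interior_T_nonempty: "interior (T x) \<noteq> {}"
  using dimer_axioms(3) unfolding tile_lift_def interior_translate
  by (simp add: translate_def)

lemma closure_interior_T: "closure (interior (T x)) = T x"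
  using convex_closure_interior[OF convex_T interior_T_nonempty] closed_T by (metis closure_closed)

lemma frontier_T: "frontier (T y) = \<Union>{Ec x |x. Ec x \<subseteq> frontier (T y)}"
proof -
  obtain i k where y: "y = (i, k)" by (cases y)
  have fr: "frontier (T y) = translate k (frontier (T (i, 0)))"
    unfolding y by (subst mv_Pair) (simp only: tile_lift_mv frontier_translate)
  have T0: "T (i, 0) = tile \<Gamma> i" by (simp add: tile_lift_def translate_def)
  have base: "frontier (T (i, 0)) = \<Union>{Ec x |x. Ec x \<subseteq> frontier (T (i, 0))}"
    unfolding T0 by (rule dimer_axioms)
  show ?thesis
  proof (intro equalityI subsetI)
    fix z assume "z \<in> frontier (T y)"
    then have "z - shift k \<in> frontier (T (i, 0))" by (simp add: fr mem_translate)
    then obtain x where x: "z - shift k \<in> Ec x" "Ec x \<subseteq> frontier (T (i, 0))"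
      using base by blast
    have "z \<in> Ec (mv k x)" using x by (simp add: edge_lift_mv mem_translate)
    moreover have "Ec (mv k x) \<subseteq> frontier (T y)"
      unfolding fr edge_lift_mv translate_mono_iff using x by blast
    ultimately show "z \<in> \<Union>{Ec x |x. Ec x \<subseteq> frontier (T y)}" by blast
  qed auto
qed

lemma open_edges_disjoint: "z \<in> Eo x \<Longrightarrow> z \<in> Eo y \<Longrightarrow> x = y"
  using dimer_axioms(5,6) unfolding disjoint_family_on_def by blast

lemma interiors_disjoint: "z \<in> interior (T x) \<Longrightarrow> z \<in> interior (T y) \<Longrightarrow> x = y"
  using dimer_axioms(5,6) unfolding disjoint_family_on_def by blast

lemma open_edge_not_node: "z \<in> Eo x \<Longrightarrow> z \<notin> nodes \<Gamma>"
  using dimer_axioms(7-9) by blast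

lemma interior_not_node: "z \<in> interior (T x) \<Longrightarrow> z \<notin> nodes \<Gamma>"
  using dimer_axioms(7-9) by blast

lemma interior_not_open_edge: "z \<in> interior (T x) \<Longrightarrow> z \<notin> Eo y"
  using dimer_axioms(7-9) by blast

lemma cell_cases:
  obtains "z \<in> nodes \<Gamma>" | x where "z \<in> Eo x" | y where "z \<in> interior (T y)"
proof -
  have "z \<in> nodes \<Gamma> \<union> (\<Union>x. Eo x) \<union> (\<Union>x. interior (T x))"
    by (simp only: dimer_axioms(10) UNIV_I)
  then show ?thesis using that by blast
qed

lemma black_white_distinct: "bl x \<noteq> wl y"
  using dimer_axioms(1) by (metis disjoint_iff rangeI)

lemma edge_lift_eq: "Ec x = insert (bl x) (insert (wl x) (Eo x))"
  unfolding edge_lift_def open_edge_lift_def by (auto simp: open_segment_def)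

lemma nodes_iff: "z \<in> nodes \<Gamma> \<longleftrightarrow> (\<exists>x. z = bl x \<or> z = wl x)"
  by (auto simp: nodes_def)

lemma edge_not_node: "z \<in> Ec x \<Longrightarrow> z \<notin> nodes \<Gamma> \<Longrightarrow> z \<in> Eo x"
  unfolding edge_lift_eq nodes_iff by blast

lemma edge_open_edge: "z \<in> Ec x \<Longrightarrow> z \<in> Eo y \<Longrightarrow> x = y"
  using edge_not_node open_edge_not_node open_edges_disjoint by blast

lemma interior_not_edge: "z \<in> interior (T x) \<Longrightarrow> z \<notin> Ec y"
  using edge_not_node interior_not_node interior_not_open_edge by blast

lemma cell_cases':
  obtains x where "z \<in> Ec x" | y where "z \<in> interior (T y)"
  by (rule cell_cases[of z]) (auto simp: nodes_iff edge_lift_eq)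

text \<open>The complement of all tiles is open by local finiteness and contained in the countably
  many edges, which are null sets; an open null set is empty.\<close>

lemma T_cover: "\<exists>y. z \<in> T y"
proof -
  have "closed (\<Union>y\<in>UNIV. T y)"
    unfolding tile_lift_def
    by (rule closed_Union_translates) (use compact_T[of "(_, 0)"] in \<open>simp add: tile_lift_def translate_def\<close>)
  moreover have "- (\<Union>y\<in>UNIV. T y) = {}"
  proof (rule ccontr)
    assume ne: "- (\<Union>y\<in>UNIV. T y) \<noteq> {}"
    have sub: "- (\<Union>y\<in>UNIV. T y) \<subseteq> (\<Union>x. Ec x)"
    proof
      fix z assume "z \<in> - (\<Union>y\<in>UNIV. T y)"
      then show "z \<in> (\<Union>x. Ec x)"
        by (cases rule: cell_cases'[of z]) (use interior_subset in blast)+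
    qed
    have "negligible (\<Union>x. Ec x)"
    proof (rule negligible_countable_Union, safe)
      show "countable (range Ec)" by blast
      fix x show "negligible (Ec x)"
        by (simp add: edge_lift_def negligible_convex_interior interior_closed_segment_ge2)
    qed
    then have "negligible (- (\<Union>y\<in>UNIV. T y))" using sub negligible_subset by blast
    moreover have "open (- (\<Union>y\<in>UNIV. T y))" by (rule open_Compl[OF \<open>closed _\<close>])
    ultimately show False using ne open_not_negligible by blast
  qed
  ultimately show ?thesis by blast
qed

lemma closed_Union_T: "closed (\<Union>x\<in>C. T x)"
  unfolding tile_lift_def
  by (rule closed_Union_translates) (use compact_T[of "(_, 0)"] in \<open>simp add: tile_lift_def translate_def\<close>)

lemma closed_Union_Ec: "closed (\<Union>x\<in>C. Ec x)"
  by (subst edge_lift_translate, rule closed_Union_translates) (simp add: edge_lift_def)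

lemma finite_Ec_meeting: "bounded S \<Longrightarrow> finite {x. Ec x \<inter> S \<noteq> {}}"
  by (subst edge_lift_translate, rule finite_translates_meeting)
    (simp_all add: edge_lift_def compact_imp_bounded)

lemma closed_nodes_subset: "closed (bl ` C \<union> wl ` C')"
proof -
  have "closed (\<Union>x\<in>C. translate (snd x) {black_end \<Gamma> (fst x)})"
    "closed (\<Union>x\<in>C'. translate (snd x) {white_end \<Gamma> (fst x)})"
    by (rule closed_Union_translates; simp)+
  moreover have "(\<Union>x\<in>C. translate (snd x) {black_end \<Gamma> (fst x)}) = bl ` C"
    "(\<Union>x\<in>C'. translate (snd x) {white_end \<Gamma> (fst x)}) = wl ` C'"
    by (simp_all add: translate_def black_lift_def[symmetric] white_lift_def[symmetric] UNION_singleton_eq_range)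
  ultimately show ?thesis by (metis closed_Un)
qed

text \<open>By local finiteness the tiles and edges missing \<open>z\<close>, and the nodes other
  than \<open>z\<close>, have a closed union; the ball is chosen in its complement.\<close>

lemma local_cells:
  obtains e where "e > 0" "\<And>y p. p \<in> ball z e \<Longrightarrow> p \<in> T y \<Longrightarrow> z \<in> T y"
    "\<And>x p. p \<in> ball z e \<Longrightarrow> p \<in> Ec x \<Longrightarrow> z \<in> Ec x"
    "\<And>p. p \<in> ball z e \<Longrightarrow> p \<in> nodes \<Gamma> \<Longrightarrow> p = z"
proof -
  let ?N = "bl ` {x. bl x \<noteq> z} \<union> wl ` {x. wl x \<noteq> z}"
  let ?O = "- (\<Union>y\<in>{y. z \<notin> T y}. T y) \<inter> (- (\<Union>x\<in>{x. z \<notin> Ec x}. Ec x) \<inter> - ?N)"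
  have "open ?O" using closed_Union_T closed_Union_Ec closed_nodes_subset by (intro open_Int open_Compl)
  moreover have "z \<in> ?O" by auto
  ultimately obtain e where "e > 0" "ball z e \<subseteq> ?O" using open_contains_ball by metis
  show ?thesis
  proof (rule that)
    show "e > 0" by fact
    show "z \<in> T y" if "p \<in> ball z e" "p \<in> T y" for y p using that \<open>ball z e \<subseteq> ?O\<close> by blast
    show "z \<in> Ec x" if "p \<in> ball z e" "p \<in> Ec x" for x p using that \<open>ball z e \<subseteq> ?O\<close> by blast
    show "p = z" if "p \<in> ball z e" "p \<in> nodes \<Gamma>" for p
      using that \<open>ball z e \<subseteq> ?O\<close> unfolding nodes_iff by blast
  qed
qed

text \<open>Leaving an open tile means crossing its frontier, which consists of edges.\<close>

lemma connected_in_tile: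
  assumes "connected X" "X \<inter> interior (T y) \<noteq> {}" "\<And>x. X \<inter> Ec x = {}"
  shows "X \<subseteq> interior (T y)"
proof (rule ccontr)
  assume "\<not> X \<subseteq> interior (T y)"
  then have "X \<inter> frontier (interior (T y)) \<noteq> {}"
    using connected_Int_frontier[of X "interior (T y)"] assms by blast
  moreover have "frontier (interior (T y)) \<subseteq> frontier (T y)"
    by (rule frontier_interior_subset)
  ultimately show False using frontier_T assms(3) by blast
qed

lemma tile_open_edge: "z \<in> T y \<Longrightarrow> z \<in> Eo x \<Longrightarrow> Ec x \<subseteq> frontier (T y)"
proof -
  assume z: "z \<in> T y" "z \<in> Eo x"
  then have "z \<in> frontier (T y)"
    using interior_not_open_edge[of z y x] closed_T[of y] by (auto simp: frontier_def)
  then obtain x' where "z \<in> Ec x'" "Ec x' \<subseteq> frontier (T y)" using frontier_T by blast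
  then show ?thesis using z edge_open_edge by blast
qed

section \<open>The two tiles along an edge\<close>

definition mid :: "'e lifted \<Rightarrow> complex" where "mid x = midpoint (bl x) (wl x)"

lemma mid_open: "mid x \<in> Eo x"
  unfolding mid_def open_edge_lift_def using black_white_distinct by simp

lemma open_edge_line:
  "0 < t \<Longrightarrow> t < 1 \<Longrightarrow> bl x + t *\<^sub>R (wl x - bl x) \<in> Eo x"
  unfolding open_edge_lift_def in_segment using black_white_distinct[of x x]
  by (intro conjI exI[of _ t]) (auto simp: algebra_simps)

text \<open>If an interior point of the tile lay on the line through the edge, moving it towards the
  midpoint would give an interior point on the open edge. So the convex interior misses the line and
  stays on one side.\<close>

lemma edge_tile_side:
  assumes "Ec x \<subseteq> T y"
  shows "interior (T y) \<subseteq> side \<Gamma> 1 x \<or> interior (T y) \<subseteq> side \<Gamma> (-1) x"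
proof -
  define d where "d = wl x - bl x"
  have d: "d \<noteq> 0" using black_white_distinct[of x x] by (auto simp: d_def)
  have no: "cross d (r - bl x) \<noteq> 0" if "r \<in> interior (T y)" for r
  proof
    assume "cross d (r - bl x) = 0"
    then obtain s where s: "r - bl x = s *\<^sub>R d" using cross_eq_0D[OF d] by blast
    \<comment> \<open>Small enough that the moved point, at parameter
      \<open>1/2 - e * (1/2 - s)\<close> on the line, stays strictly between the endnodes.\<close>
    define e where "e = 1 / (2 * (\<bar>s\<bar> + 1))"
    have e: "0 < e" "e \<le> 1" by (auto simp: e_def field_simps)
    have "mid x \<in> T y" using assms mid_open[of x] by (auto simp: edge_lift_eq)
    from mem_interior_convex_shrink[OF convex_T that this e]
    have "mid x - e *\<^sub>R (mid x - r) \<in> interior (T y)" .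
    moreover have "mid x = bl x + (1/2) *\<^sub>R d"
      by (simp add: mid_def midpoint_def d_def complex_eq_iff field_simps)
    then have "mid x - e *\<^sub>R (mid x - r) = bl x + (1/2 - e * (1/2 - s)) *\<^sub>R d"
      using s by (simp add: complex_eq_iff algebra_simps)
    moreover have "\<bar>e * (1/2 - s)\<bar> < 1/2"
    proof -
      have "\<bar>1/2 - s\<bar> < \<bar>s\<bar> + 1" by linarith
      then have "e * \<bar>1/2 - s\<bar> < e * (\<bar>s\<bar> + 1)" using e by simp
      also have "\<dots> = 1/2" unfolding e_def by (simp add: field_simps)
      finally show ?thesis using e by (simp add: abs_mult)
    qed
    then have "0 < 1/2 - e * (1/2 - s)" "1/2 - e * (1/2 - s) < 1" by linarith+
    ultimately show False using open_edge_line interior_not_open_edge unfolding d_def by metis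
  qed
  show ?thesis
  proof (rule ccontr)
    assume "\<not> ?thesis"
    then obtain p q where pq: "p \<in> interior (T y)" "q \<in> interior (T y)"
      and "p \<notin> side \<Gamma> 1 x" "q \<notin> side \<Gamma> (-1) x"
      by blast
    then have "cross d (p - bl x) \<le> 0" "cross d (q - bl x) \<ge> 0"
      unfolding side_def d_def by (auto simp: not_less)
    have "connected (interior (T y))" using convex_T convex_interior convex_connected by blast
    from connected_ivt_hyperplane[OF this pq(1,2), of "\<i> * d" "inner (\<i> * d) (bl x)"] \<open>cross d (p - bl x) \<le> 0\<close> \<open>cross d (q - bl x) \<ge> 0\<close>
    obtain z where "z \<in> interior (T y)" "inner (\<i> * d) z = inner (\<i> * d) (bl x)"
      by (auto simp: cross_inner inner_diff_right)
    then show False using no by (auto simp: cross_inner inner_diff_right)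
  qed
qed

text \<open>A small half disc at the midpoint avoids all edges, hence lies in one open tile; any
  tile on this side that contains the edge has interior points in that half disc. This makes the
  descriptions in \<open>head_lift\<close> and \<open>tail_lift\<close> meaningful.\<close>

lemma side_tile:
  assumes s: "s = 1 \<or> s = -1"
  shows "\<exists>!y. Ec x \<subseteq> T y \<and> interior (T y) \<subseteq> side \<Gamma> s x"
proof -
  obtain e where e: "e > 0" "\<And>y p. p \<in> ball (mid x) e \<Longrightarrow> p \<in> T y \<Longrightarrow> mid x \<in> T y"
    "\<And>x' p. p \<in> ball (mid x) e \<Longrightarrow> p \<in> Ec x' \<Longrightarrow> mid x \<in> Ec x'"
    by (rule local_cells[of "mid x"]) blast
  define d where "d = wl x - bl x"
  have d: "d \<noteq> 0" using black_white_distinct[of x x] by (auto simp: d_def)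
  define HD where "HD = ball (mid x) e \<inter> side \<Gamma> s x"
  have conn: "connected HD" unfolding HD_def
    by (intro convex_connected convex_Int convex_ball convex_side)
  have edges: "HD \<inter> Ec x' = {}" for x'
  proof (rule ccontr)
    assume "HD \<inter> Ec x' \<noteq> {}"
    then obtain p where p: "p \<in> HD" "p \<in> Ec x'" by blast
    then have "x' = x" using e(3) mid_open edge_open_edge unfolding HD_def by blast
    with p have "p \<in> Ec x" "p \<in> side \<Gamma> s x" by (auto simp: HD_def)
    then obtain u where "p = (1 - u) *\<^sub>R bl x + u *\<^sub>R wl x" by (auto simp: edge_lift_def in_segment)
    then have "p - bl x = u *\<^sub>R d" by (simp add: d_def algebra_simps)
    then have "cross d (p - bl x) = 0" by (simp add: cross_eq)
    then show False using \<open>p \<in> side \<Gamma> s x\<close> by (simp add: side_def d_def)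
  qed
  \<comment> \<open>The point at distance \<open>e / 2\<close> from the midpoint, perpendicular to
    the edge, on the required side.\<close>
  define p where "p = mid x + (s * (e / (2 * norm d))) *\<^sub>R (\<i> * d)"
  have "p - bl x = (1/2) *\<^sub>R d + (s * (e / (2 * norm d))) *\<^sub>R (\<i> * d)"
    by (simp add: p_def mid_def midpoint_def d_def complex_eq_iff field_simps)
  then have "cross d (p - bl x) = s * (e / (2 * norm d)) * (norm d)\<^sup>2"
    by (simp only: cross_normal)
  then have "s * cross d (p - bl x) = e / (2 * norm d) * (norm d)\<^sup>2" using s by auto
  then have "p \<in> side \<Gamma> s x" using d e(1) unfolding side_def d_def[symmetric] by simp
  moreover have "norm (p - mid x) < e"
    using s d e(1) by (auto simp: p_def norm_mult)
  ultimately have p: "p \<in> HD" by (simp add: HD_def dist_norm norm_minus_commute)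
  obtain y where y: "p \<in> interior (T y)" using p edges by (meson cell_cases' disjoint_iff)
  have half: "HD \<subseteq> interior (T y)" using connected_in_tile[OF conn] edges y p by blast
  show ?thesis
  proof (rule ex1I[of _ y])
    have "mid x \<in> T y" using e(2)[of p y] p y interior_subset by (auto simp: HD_def)
    then have "Ec x \<subseteq> frontier (T y)" using tile_open_edge mid_open by blast
    then have sub: "Ec x \<subseteq> T y" using closed_T frontier_subset_closed by blast
    have "interior (T y) \<subseteq> side \<Gamma> s x"
    proof -
      have "p \<in> side \<Gamma> s x" using p by (simp add: HD_def)
      then have "\<not> interior (T y) \<subseteq> side \<Gamma> (-s) x" using y by (auto simp: side_def)
      then show ?thesis using edge_tile_side[OF sub] s by auto
    qed
    then show "Ec x \<subseteq> T y \<and> interior (T y) \<subseteq> side \<Gamma> s x" using sub by blast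
  next
    fix y' assume y': "Ec x \<subseteq> T y' \<and> interior (T y') \<subseteq> side \<Gamma> s x"
    have "mid x \<in> closure (interior (T y'))"
      using y' mid_open[of x] by (auto simp: closure_interior_T edge_lift_eq)
    then obtain q where "q \<in> interior (T y')" "dist q (mid x) < e"
      using e(1) closure_approachable by blast
    then have "q \<in> HD" using y' by (auto simp: HD_def dist_commute)
    then show "y' = y" using half interiors_disjoint \<open>q \<in> interior (T y')\<close> by blast
  qed
qed

lemma head_lift: "Ec x \<subseteq> T (Hd x)" "interior (T (Hd x)) \<subseteq> side \<Gamma> 1 x"
  and head_liftI: "Ec x \<subseteq> T y \<Longrightarrow> interior (T y) \<subseteq> side \<Gamma> 1 x \<Longrightarrow> Hd x = y"
  unfolding head_lift_def left_of_side
  using theI'[OF side_tile[of 1 x]] the1_equality[OF side_tile[of 1 x], of y] by auto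

lemma tail_lift: "Ec x \<subseteq> T (Tl x)" "interior (T (Tl x)) \<subseteq> side \<Gamma> (-1) x"
  and tail_liftI: "Ec x \<subseteq> T y \<Longrightarrow> interior (T y) \<subseteq> side \<Gamma> (-1) x \<Longrightarrow> Tl x = y"
  unfolding tail_lift_def right_of_side
  using theI'[OF side_tile[of "-1" x]] the1_equality[OF side_tile[of "-1" x], of y] by auto

lemma head_lift_mv: "Hd (mv k x) = mv k (Hd x)"
proof (rule head_liftI)
  show "Ec (mv k x) \<subseteq> T (mv k (Hd x))"
    unfolding edge_lift_mv tile_lift_mv translate_mono_iff by (rule head_lift)
  show "interior (T (mv k (Hd x))) \<subseteq> side \<Gamma> 1 (mv k x)"
    unfolding tile_lift_mv interior_translate using head_lift(2)[of x] by (auto simp: side_mv mem_translate)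
qed

lemma tail_lift_mv: "Tl (mv k x) = mv k (Tl x)"
proof (rule tail_liftI)
  show "Ec (mv k x) \<subseteq> T (mv k (Tl x))"
    unfolding edge_lift_mv tile_lift_mv translate_mono_iff by (rule tail_lift)
  show "interior (T (mv k (Tl x))) \<subseteq> side \<Gamma> (-1) (mv k x)"
    unfolding tile_lift_mv interior_translate using tail_lift(2)[of x] by (auto simp: side_mv mem_translate)
qed

lemma edge_in_tile: "Ec x \<subseteq> T y \<longleftrightarrow> y = Hd x \<or> y = Tl x"
proof
  assume "Ec x \<subseteq> T y"
  then show "y = Hd x \<or> y = Tl x" using edge_tile_side[of x y] head_liftI[of x y] tail_liftI[of x y] by auto
qed (use head_lift(1)[of x] tail_lift(1)[of x] in auto)

lemma open_edge_in_tile: "z \<in> Eo x \<Longrightarrow> z \<in> T y \<longleftrightarrow> y = Hd x \<or> y = Tl x"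
  using edge_in_tile[of x y] tile_open_edge[of z y x] closed_T[of y] frontier_subset_closed[of "T y"]
  by (auto simp: edge_lift_eq)

lemma interior_in_tile: "z \<in> interior (T x) \<Longrightarrow> z \<in> T y \<longleftrightarrow> y = x"
proof
  assume z: "z \<in> interior (T x)" "z \<in> T y"
  then have "z \<in> closure (interior (T y))" by (simp add: closure_interior_T)
  then have "interior (T x) \<inter> interior (T y) \<noteq> {}"
    using z(1) open_Int_closure_eq_empty[of "interior (T x)" "interior (T y)"] by auto
  then show "y = x" using interiors_disjoint by blast
qed (use interior_subset in auto)

end

section \<open>Tiles around a node\<close>

text \<open>Polar coordinates around \<open>n\<close>, with angles measured from \<open>d\<close>,
  present the slit disc as the image of a convex rectangle.\<close>

lemma connected_slit_ball:
  fixes n d :: complex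
  assumes "d \<noteq> 0"
  shows "connected (ball n e - {n + s *\<^sub>R d |s. s \<ge> 0})"
proof -
  define F where "F = (\<lambda>(r, \<phi>). n + complex_of_real r * cis \<phi> * sgn d)"
  have "F ` ({0<..<e} \<times> {0<..<2 * pi}) = ball n e - {n + s *\<^sub>R d |s. s \<ge> 0}"
  proof (intro equalityI subsetI)
    fix z assume "z \<in> F ` ({0<..<e} \<times> {0<..<2 * pi})"
    then obtain r \<phi> where r: "0 < r" "r < e" and p: "0 < \<phi>" "\<phi> < 2 * pi"
      and z: "z = n + complex_of_real r * cis \<phi> * sgn d" by (auto simp: F_def)
    have "dist n z = r" using assms r by (simp add: z dist_norm norm_mult norm_sgn)
    moreover have "z \<noteq> n + s *\<^sub>R d" if "s \<ge> 0" for s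
    proof
      assume "z = n + s *\<^sub>R d"
      then have "complex_of_real r * cis \<phi> * sgn d = complex_of_real s * d" by (simp add: z scaleR_conv_of_real)
      also have "\<dots> = complex_of_real (s * norm d) * sgn d"
        using assms by (simp add: sgn_div_norm scaleR_conv_of_real)
      finally have eq: "complex_of_real r * cis \<phi> = complex_of_real (s * norm d)"
        using assms unfolding mult_cancel_right by (simp add: sgn_zero_iff)
      then have "norm (complex_of_real r * cis \<phi>) = norm (complex_of_real (s * norm d))" by simp
      then have "r = s * norm d" using r that by (simp add: norm_mult)
      moreover have "s \<noteq> 0" using r \<open>r = s * norm d\<close> by auto
      ultimately have "cis \<phi> = 1" using eq assms by simp
      then have "Arg2pi (cis \<phi>) = 0" using Arg2pi_of_real[of 1] by simp
      moreover have "Arg2pi (cis \<phi>) = \<phi>"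
        by (rule Arg2pi_unique[of 1]) (use p in \<open>auto simp: cis_conv_exp mult.commute\<close>)
      ultimately show False using p by simp
    qed
    ultimately show "z \<in> ball n e - {n + s *\<^sub>R d |s. s \<ge> 0}" using r by auto
  next
    fix z assume z: "z \<in> ball n e - {n + s *\<^sub>R d |s. s \<ge> 0}"
    define q where "q = (z - n) / sgn d"
    have sg: "sgn d \<noteq> 0" "norm (sgn d) = 1" using assms by (auto simp: sgn_zero_iff norm_sgn)
    have q: "z = n + q * sgn d" using sg by (simp add: q_def)
    have nq: "norm q = dist n z" using sg by (simp add: q_def norm_divide dist_norm norm_minus_commute)
    have pol: "q = complex_of_real (norm q) * cis (Arg2pi q)"
      using Arg2pi[of q] by (simp add: cis_conv_exp is_Arg_def)
    have "q \<noteq> 0"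
    proof
      assume "q = 0"
      then have "z = n + 0 *\<^sub>R d" by (simp add: q)
      then show False using z by blast
    qed
    have "Arg2pi q \<noteq> 0"
    proof
      assume "Arg2pi q = 0"
      then have "q = complex_of_real (norm q)" using pol by simp
      then have "z = n + (norm q / norm d) *\<^sub>R d"
        using q assms by (simp add: sgn_div_norm scaleR_conv_of_real divide_inverse mult.assoc)
      then show False using z by (force simp: divide_nonneg_nonneg)
    qed
    then have "Arg2pi q \<in> {0<..<2 * pi}" using Arg2pi_ge_0[of q] Arg2pi_lt_2pi[of q] by simp
    moreover have "norm q \<in> {0<..<e}" using \<open>q \<noteq> 0\<close> nq z by auto
    moreover have "z = F (norm q, Arg2pi q)" unfolding F_def using q pol by simp
    ultimately show "z \<in> F ` ({0<..<e} \<times> {0<..<2 * pi})" by blast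
  qed
  moreover have "connected (F ` ({0<..<e} \<times> {0<..<2 * pi}))"
    unfolding F_def case_prod_unfold
    by (intro connected_continuous_image convex_connected convex_Times continuous_intros) auto
  ultimately show ?thesis by simp
qed

text \<open>The slit lies in a line, a null set, which contains no nonempty open set.\<close>

lemma open_meets_slit_ball:
  fixes n d :: complex
  assumes "open U" "U \<noteq> {}" "U \<subseteq> ball n e" "d \<noteq> 0"
  shows "U \<inter> (ball n e - {n + s *\<^sub>R d |s. s \<ge> 0}) \<noteq> {}"
proof
  assume "U \<inter> (ball n e - {n + s *\<^sub>R d |s. s \<ge> 0}) = {}"
  then have "U \<subseteq> {z. inner (\<i> * d) z = inner (\<i> * d) n}"
    using assms(3) by (auto simp: inner_complex_def algebra_simps)
  moreover have "negligible {z. inner (\<i> * d) z = inner (\<i> * d) n}"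
    using assms(4) by (intro negligible_hyperplane) simp
  ultimately show False using assms open_not_negligible negligible_subset by blast
qed

context dimer_geometry
begin

text \<open>
  A colour \<open>c\<close> is \<open>True\<close> for white and \<open>False\<close> for black; \<open>dr c x\<close> points from the endnode of
  colour \<open>c\<close> to the other one, and \<open>st True c x\<close>, \<open>st False c x\<close> are the tiles to the left
  and to the right of this direction.
\<close>

definition nd :: "bool \<Rightarrow> 'e lifted \<Rightarrow> complex" where "nd c x = (if c then wl x else bl x)"
definition dr :: "bool \<Rightarrow> 'e lifted \<Rightarrow> complex" where "dr c x = nd (\<not> c) x - nd c x"
definition st :: "bool \<Rightarrow> bool \<Rightarrow> 'e lifted \<Rightarrow> 'v lifted"
  where "st b c x = (if b = c then Tl x else Hd x)"

lemma nodes_nd: "n \<in> nodes \<Gamma> \<longleftrightarrow> (\<exists>c x. nd c x = n)"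
  unfolding nodes_iff nd_def by (metis (full_types))

lemma nd_colour: "nd c x = nd c' y \<Longrightarrow> c = c'"
  using black_white_distinct[of x y] black_white_distinct[of y x] by (cases c; cases c') (simp_all add: nd_def)

lemma nd_in_edge: "nd c x \<in> Ec x"
  by (simp add: nd_def edge_lift_eq)

lemma node_in_edge: "n \<in> nodes \<Gamma> \<Longrightarrow> n \<in> Ec x \<Longrightarrow> \<exists>c. nd c x = n"
  using open_edge_not_node unfolding edge_lift_eq nd_def by (metis insert_iff)

lemma dr_nonzero: "dr c x \<noteq> 0"
  unfolding dr_def using nd_colour[of "\<not> c" x c x] by auto

lemma open_edge_dr: "0 < t \<Longrightarrow> t < 1 \<Longrightarrow> nd c x + t *\<^sub>R dr c x \<in> Eo x"
  using open_edge_line[of t x] open_edge_line[of "1 - t" x]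
  by (cases c) (auto simp: nd_def dr_def algebra_simps)

lemma edge_dr: assumes "z \<in> Ec x" obtains t where "0 \<le> t" "t \<le> 1" "z = nd c x + t *\<^sub>R dr c x"
proof -
  obtain u where u: "0 \<le> u" "u \<le> 1" "z = (1 - u) *\<^sub>R bl x + u *\<^sub>R wl x"
    using assms by (auto simp: edge_lift_def in_segment)
  show ?thesis
    by (rule that[of "if c then 1 - u else u"]) (use u in \<open>auto simp: nd_def dr_def algebra_simps\<close>)
qed

lemma st_tile: "Ec x \<subseteq> T (st b c x)"
  by (simp add: st_def head_lift tail_lift)

lemma st_cases: "Ec x \<subseteq> T y \<longleftrightarrow> y = st True c x \<or> y = st False c x"
  by (auto simp: edge_in_tile st_def)

lemma st_side:
  "p \<in> interior (T (st b c x)) \<Longrightarrow> (if b then 1 else -1) * cross (dr c x) (p - nd c x) > 0"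
  using head_lift(2)[of x] tail_lift(2)[of x]
  by (cases b; cases c) (auto simp: st_def side_def dr_def nd_def cross_eq algebra_simps dest!: subsetD)

lemma st_side_closed:
  assumes "p \<in> T (st b c x)"
  shows "(if b then 1 else -1) * cross (dr c x) (p - nd c x) \<ge> 0"
proof -
  let ?s = "if b then 1 else -1 :: real"
  have "closed {p. ?s * cross (dr c x) (p - nd c x) \<ge> 0}"
    unfolding cross_eq by (intro closed_Collect_le continuous_intros)
  moreover have "interior (T (st b c x)) \<subseteq> {p. ?s * cross (dr c x) (p - nd c x) \<ge> 0}"
  proof
    fix q assume "q \<in> interior (T (st b c x))"
    from st_side[OF this] show "q \<in> {p. ?s * cross (dr c x) (p - nd c x) \<ge> 0}" by (simp only: mem_Collect_eq less_imp_le)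
  qed
  ultimately have "closure (interior (T (st b c x))) \<subseteq> {p. ?s * cross (dr c x) (p - nd c x) \<ge> 0}"
    by (rule closure_minimal[rotated])
  then show ?thesis using assms by (auto simp only: closure_interior_T)
qed

text \<open>Edges leaving a node in the same direction would overlap near it; \<open>t\<close> is
  chosen so that the common point is in the open segment of both.\<close>

lemma same_direction:
  assumes "nd c x = nd c y" "dr c y = s *\<^sub>R dr c x" "s > 0"
  shows "x = y"
proof -
  define t where "t = min 1 (1 / s) / 2"
  have t: "0 < t" "t < 1" "0 < t * s" "t * s < 1"
    using assms(3) by (auto simp: t_def min_def field_simps)
  have "nd c y + t *\<^sub>R dr c y = nd c x + (t * s) *\<^sub>R dr c x" using assms by simp
  then show ?thesis using open_edge_dr[OF t(1,2), of c y] open_edge_dr[OF t(3,4), of c x] open_edges_disjoint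
    by metis
qed

text \<open>Each edge lies in the closed half-plane that the other assigns to the common tile, so
  their determinant has both signs and vanishes. An interior point of the tile then excludes
  opposite directions.\<close>

lemma st_inj:
  assumes "nd c x = nd c y" "st b c x = st b c y"
  shows "x = y"
proof -
  let ?s = "if b then 1 else -1 :: real"
  have "nd (\<not> c) y \<in> T (st b c x)" "nd (\<not> c) x \<in> T (st b c y)"
    using st_tile[of y b c] st_tile[of x b c] nd_in_edge[of "\<not> c" x] nd_in_edge[of "\<not> c" y] assms by auto
  then have "?s * cross (dr c x) (dr c y) \<ge> 0" "?s * cross (dr c y) (dr c x) \<ge> 0"
    using st_side_closed assms(1) unfolding dr_def by metis+
  moreover have "cross (dr c y) (dr c x) = - cross (dr c x) (dr c y)" by (simp add: cross_eq)
  ultimately have "cross (dr c x) (dr c y) = 0" by (auto split: if_splits)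
  then obtain s where s: "dr c y = s *\<^sub>R dr c x" using cross_eq_0D dr_nonzero by blast
  obtain p where p: "p \<in> interior (T (st b c x))" using interior_T_nonempty by blast
  then have "?s * cross (dr c x) (p - nd c x) > 0" "?s * cross (dr c y) (p - nd c x) > 0"
    using st_side assms by metis+
  moreover have "cross (dr c y) (p - nd c x) = s * cross (dr c x) (p - nd c x)"
    by (simp add: s cross_eq algebra_simps)
  ultimately have "s * (?s * cross (dr c x) (p - nd c x)) > 0" "?s * cross (dr c x) (p - nd c x) > 0"
    by (simp_all add: mult.left_commute)
  then have "s > 0" using zero_less_mult_pos2 by blast
  then show ?thesis using same_direction assms s by blast
qed

section \<open>Tiles and edges meeting at a node\<close>

lemma edge_frontier: "Ec x \<subseteq> frontier (T y) \<longleftrightarrow> Ec x \<subseteq> T y"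
  proof
  assume "Ec x \<subseteq> T y"
  moreover have "Ec x \<inter> interior (T y) = {}" using interior_not_edge[of _ y x] by blast
  ultimately show "Ec x \<subseteq> frontier (T y)"
    unfolding frontier_def closure_closed[OF closed_T] by blast
qed (use frontier_subset_closed[OF closed_T[of y]] in blast)

lemma frontier_edge: "z \<in> frontier (T y) \<Longrightarrow> \<exists>x. z \<in> Ec x \<and> Ec x \<subseteq> T y"
  proof -
  assume "z \<in> frontier (T y)"
  then have "z \<in> \<Union>{Ec x |x. Ec x \<subseteq> frontier (T y)}" by (subst (asm) frontier_T)
  then show ?thesis unfolding edge_frontier by auto
qed

text \<open>If \<open>x0\<close> were the only possible edge of the tile at the node, a small disc
  slit along \<open>x0\<close> would be connected and meet both the tile and its complement without
  meeting the frontier of the tile.\<close>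

lemma two_edges_at_node:
  assumes n: "n \<in> nodes \<Gamma>" "n \<in> T y"
  shows "\<exists>x. x \<noteq> x0 \<and> n \<in> Ec x \<and> Ec x \<subseteq> T y"
proof (rule ccontr)
  assume contra: "\<not> ?thesis"
  obtain e where e: "e > 0" "\<And>x p. p \<in> ball n e \<Longrightarrow> p \<in> Ec x \<Longrightarrow> n \<in> Ec x"
    by (rule local_cells[of n]) blast
  obtain c where c: "n \<in> Ec x0 \<Longrightarrow> nd c x0 = n" using node_in_edge n by blast
  define X where "X = ball n e - {n + s *\<^sub>R dr c x0 |s. s \<ge> 0}"
  have "connected X" unfolding X_def by (rule connected_slit_ball[OF dr_nonzero])
  moreover have "X \<inter> T y \<noteq> {}"
  proof -
    have "n \<in> closure (interior (T y))" using n by (simp add: closure_interior_T)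
    then have "ball n e \<inter> interior (T y) \<noteq> {}"
      using e(1) by (metis centre_in_ball disjoint_iff open_Int_closure_eq_empty open_ball)
    then have "(ball n e \<inter> interior (T y)) \<inter> X \<noteq> {}"
      unfolding X_def by (intro open_meets_slit_ball dr_nonzero) auto
    then show ?thesis using interior_subset by blast
  qed
  moreover have "X - T y \<noteq> {}"
  proof -
    have "n \<notin> interior (T y)" using n interior_not_node by blast
    then have "\<not> ball n e \<subseteq> T y" using e(1) mem_interior by blast
    then have "(ball n e - T y) \<inter> X \<noteq> {}"
      unfolding X_def by (intro open_meets_slit_ball dr_nonzero open_Diff closed_T) auto
    then show ?thesis by blast
  qed
  ultimately have "X \<inter> frontier (T y) \<noteq> {}" by (rule connected_Int_frontier)
  then obtain z x where z: "z \<in> X" "z \<in> Ec x" "Ec x \<subseteq> T y" using frontier_edge by blast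
  then have "n \<in> Ec x" using e(2)[of z x] by (auto simp: X_def)
  then have "x = x0" using contra z(3) by blast
  then have "nd c x = n" using c \<open>n \<in> Ec x\<close> by simp
  obtain t where "0 \<le> t" "z = nd c x + t *\<^sub>R dr c x" using edge_dr[OF z(2)] by metis
  then have "z \<in> {n + s *\<^sub>R dr c x0 |s. s \<ge> 0}" using \<open>nd c x = n\<close> \<open>x = x0\<close> by blast
  then show False using z(1) by (simp add: X_def)
qed

text \<open>The tile has two edges at the node, and by injectivity it cannot be on the opposite side
  of both.\<close>

lemma st_surj:
  assumes "nd c x0 \<in> T y"
  shows "\<exists>x. nd c x = nd c x0 \<and> st b c x = y"
proof -
  have n: "nd c x0 \<in> nodes \<Gamma>" using nodes_nd by blast
  have at: "nd c x = nd c x0" if "nd c x0 \<in> Ec x" for x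
    using node_in_edge[OF n that] nd_colour by blast
  obtain x1 where x1: "nd c x0 \<in> Ec x1" "Ec x1 \<subseteq> T y" using two_edges_at_node[OF n assms, of x0] by blast
  obtain x2 where x2: "x2 \<noteq> x1" "nd c x0 \<in> Ec x2" "Ec x2 \<subseteq> T y" using two_edges_at_node[OF n assms, of x1] by blast
  have "st b c x1 = y \<or> st b c x2 = y"
  proof (rule ccontr)
    assume "\<not> ?thesis"
    then have "st (\<not> b) c x1 = y" "st (\<not> b) c x2 = y"
      using st_cases[of x1 y c] st_cases[of x2 y c] x1 x2 by (cases b; auto)+
    then show False using st_inj[of c x1 x2 "\<not> b"] at x1 x2 by metis
  qed
  then show ?thesis using at x1 x2 by blast
qed

text \<open>The tiles related to \<open>y\<close> and the remaining ones form two closed sets that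
  cover the connected set \<open>X\<close> and are disjoint on it.\<close>

lemma connected_tiles:
  assumes "connected X" "equivp R"
    and R: "\<And>z y y'. z \<in> X \<Longrightarrow> z \<in> T y \<Longrightarrow> z \<in> T y' \<Longrightarrow> R y y'"
    and "z \<in> X" "z \<in> T y" "z' \<in> X" "z' \<in> T y'"
  shows "R y y'"
proof (rule ccontr)
  assume n: "\<not> R y y'"
  let ?A = "\<Union>w\<in>{w. R y w}. T w" and ?B = "\<Union>w\<in>{w. \<not> R y w}. T w"
  have "X \<subseteq> ?A \<union> ?B" using T_cover by blast
  moreover have "?A \<inter> ?B \<inter> X = {}" using R assms(2) by (blast dest: equivp_transp)
  moreover have "z \<in> ?A" "z' \<in> ?B" using assms n equivp_reflp by fast+
  ultimately show False
    using assms connected_closedD[OF \<open>connected X\<close>, of ?A ?B] closed_Union_T by blast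
qed

text \<open>The tiles are compared inside a disc slit along \<open>x0\<close>: going round the node
  the other way, the edge \<open>x0\<close> is never crossed. This is why slits do not
  separate.\<close>

lemma tiles_around_node:
  assumes "equivp R" "\<And>x. nd c x = n \<Longrightarrow> x \<noteq> x0 \<Longrightarrow> R (Hd x) (Tl x)"
    and n: "nd c x1 = n" "n \<in> T y" "n \<in> T y'"
  shows "R y y'"
proof -
  have n': "n \<in> nodes \<Gamma>" using n nodes_nd by blast
  obtain e where e: "e > 0" "\<And>y p. p \<in> ball n e \<Longrightarrow> p \<in> T y \<Longrightarrow> n \<in> T y"
    "\<And>x p. p \<in> ball n e \<Longrightarrow> p \<in> Ec x \<Longrightarrow> n \<in> Ec x" "\<And>p. p \<in> ball n e \<Longrightarrow> p \<in> nodes \<Gamma> \<Longrightarrow> p = n"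
    by (rule local_cells[of n]) blast
  define X where "X = ball n e - {n + s *\<^sub>R dr c x0 |s. s \<ge> 0}"
  have conn: "connected X" unfolding X_def by (rule connected_slit_ball[OF dr_nonzero])
  have meets: "\<exists>z. z \<in> X \<and> z \<in> T w" if "n \<in> T w" for w
  proof -
    have "n \<in> closure (interior (T w))" using that by (simp add: closure_interior_T)
    then have "ball n e \<inter> interior (T w) \<noteq> {}"
      using e(1) by (metis centre_in_ball disjoint_iff open_Int_closure_eq_empty open_ball)
    then have "(ball n e \<inter> interior (T w)) \<inter> X \<noteq> {}"
      unfolding X_def by (intro open_meets_slit_ball dr_nonzero) auto
    then show ?thesis using interior_subset by blast
  qed
  have rel: "R w w'" if z: "z \<in> X" "z \<in> T w" "z \<in> T w'" for z w w'
  proof (cases rule: cell_cases[of z])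
    case 1
    then have "z = n" using e(4)[of z] z by (simp add: X_def)
    moreover have "n + 0 *\<^sub>R dr c x0 \<notin> X" unfolding X_def by blast
    ultimately show ?thesis using z by simp
  next
    case (2 x)
    then have "z \<in> Ec x" by (simp add: edge_lift_eq)
    then have "n \<in> Ec x" using e(3)[of z x] z by (auto simp: X_def)
    then obtain c' where "nd c' x = n" using node_in_edge[OF n'] by blast
    then have nx: "nd c x = n" using nd_colour[of c' x c x1] n(1) by simp
    obtain t where t: "0 \<le> t" "z = nd c x + t *\<^sub>R dr c x" using edge_dr[OF \<open>z \<in> Ec x\<close>] by metis
    have "x \<noteq> x0"
    proof
      assume "x = x0"
      then have "z \<in> {n + s *\<^sub>R dr c x0 |s. s \<ge> 0}" using t nx by blast
      then show False using z(1) by (simp add: X_def)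
    qed
    then have "R (Hd x) (Tl x)" using assms(2) nx by blast
    then show ?thesis using open_edge_in_tile[OF 2] z assms(1)
      by (metis equivp_reflp equivp_symp)
  next
    case (3 v)
    then have "w = w'" using interior_in_tile[OF 3, of w] interior_in_tile[OF 3, of w'] z by simp
    then show ?thesis using assms(1) equivp_reflp by metis
  qed
  obtain z z' where z: "z \<in> X" "z \<in> T y" "z' \<in> X" "z' \<in> T y'" using meets n by blast
  show ?thesis by (rule connected_tiles[OF conn assms(1) _ z]) (rule rel)
qed

text \<open>The plane stays connected when the countably many nodes are removed, and away from nodes
  distinct tiles meet only across edges.\<close>

lemma dual_connected:
  assumes "equivp R" "\<And>x. R (Hd x) (Tl x)"
  shows "R y y'"
proof -
  have "countable (nodes \<Gamma>)" unfolding nodes_def by simp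
  then have conn: "connected (- nodes \<Gamma>)"
    by (intro path_connected_imp_connected path_connected_complement_countable) auto
  have rel: "R w w'" if z: "z \<in> - nodes \<Gamma>" "z \<in> T w" "z \<in> T w'" for z w w'
  proof (cases rule: cell_cases[of z])
    case 1
    then show ?thesis using z by simp
  next
    case (2 x)
    then show ?thesis using open_edge_in_tile[OF 2] z assms
      by (metis equivp_reflp equivp_symp)
  next
    case (3 v)
    then have "w = w'" using interior_in_tile[OF 3, of w] interior_in_tile[OF 3, of w'] z by simp
    then show ?thesis using assms(1) equivp_reflp by metis
  qed
  have "\<exists>z. z \<in> - nodes \<Gamma> \<and> z \<in> T w" for w
    using interior_T_nonempty[of w] interior_not_node interior_subset by blast
  then obtain z z' where z: "z \<in> - nodes \<Gamma>" "z \<in> T y" "z' \<in> - nodes \<Gamma>" "z' \<in> T y'" by metis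
  show ?thesis by (rule connected_tiles[OF conn assms(1) _ z]) (rule rel)
qed

lemma connected_frontier_T: "connected (frontier (T y))"
proof (rule connected_frontier_simple)
  show "connected (T y)" using convex_T convex_connected by blast
  show "connected (- T y)"
    by (rule connected_complement_bounded_convex) (auto simp: convex_T compact_T compact_imp_bounded)
qed

lemma tile_has_edge: "\<exists>x. Ec x \<subseteq> T y"
proof -
  have "T y \<noteq> UNIV" using compact_imp_bounded[OF compact_T[of y]] not_bounded_UNIV by metis
  moreover have "T y \<noteq> {}" using interior_T_nonempty[of y] by auto
  ultimately have "frontier (T y) \<noteq> {}" by (simp add: frontier_eq_empty)
  then show ?thesis using frontier_edge by blast
qed

text \<open>Connectedness of the graph of nodes and edges: the frontier of a tile is connected, so
  \<open>F\<close> is constant on its edges, and neighbouring tiles share an edge.\<close>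

lemma edges_connected:
  assumes F: "\<And>x y c. nd c x = nd c y \<Longrightarrow> F x = F y"
  shows "F x = F y"
proof -
  have bdry: "F x = F x'" if xs: "Ec x \<subseteq> T y" "Ec x' \<subseteq> T y" for x x' y
  proof (rule ccontr)
    assume ne: "F x \<noteq> F x'"
    let ?A = "\<Union>w\<in>{w. Ec w \<subseteq> T y \<and> F w = F x}. Ec w" and ?B = "\<Union>w\<in>{w. Ec w \<subseteq> T y \<and> F w \<noteq> F x}. Ec w"
    have "frontier (T y) \<subseteq> ?A \<union> ?B" using frontier_edge by blast
    moreover have "?A \<inter> ?B \<inter> frontier (T y) = {}"
    proof (rule ccontr)
      assume "?A \<inter> ?B \<inter> frontier (T y) \<noteq> {}"
      then obtain z where z': "z \<in> ?A" "z \<in> ?B" by blast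
      from z'(1) obtain w where w: "z \<in> Ec w" "F w = F x" by blast
      from z'(2) obtain w' where w': "z \<in> Ec w'" "F w' \<noteq> F x" by blast
      have z: "z \<in> Ec w" "z \<in> Ec w'" "F w \<noteq> F w'" using w w' by simp_all
      show False
      proof (cases "z \<in> nodes \<Gamma>")
        case True
        then obtain c c' where "nd c w = z" "nd c' w' = z" using z node_in_edge by metis
        then have "F w = F w'" using nd_colour[of c w c' w'] F[of c w w'] by simp
        then show ?thesis using z by simp
      next
        case False
        then show ?thesis using z edge_not_node edge_open_edge by blast
      qed
    qed
    moreover have m: "mid w \<in> Ec w" for w using mid_open[of w] by (simp add: edge_lift_eq)
    have "mid x \<in> ?A" by (rule UN_I[of x]) (use xs m in simp_all)
    moreover have "mid x' \<in> ?B" by (rule UN_I[of x']) (use xs m ne in simp_all)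
    moreover have "mid x \<in> frontier (T y)" "mid x' \<in> frontier (T y)"
      using xs m edge_frontier by (meson subsetD)+
    ultimately show False
      using connected_closedD[OF connected_frontier_T[of y], of ?A ?B] closed_Union_Ec by blast
  qed
  define R where "R = (\<lambda>y y'. \<forall>x x'. Ec x \<subseteq> T y \<longrightarrow> Ec x' \<subseteq> T y' \<longrightarrow> F x = F x')"
  have RI: "R u w" if "\<And>x x'. Ec x \<subseteq> T u \<Longrightarrow> Ec x' \<subseteq> T w \<Longrightarrow> F x = F x'" for u w
    unfolding R_def by (intro allI impI) (rule that)
  have RD: "F x = F x'" if "R u w" "Ec x \<subseteq> T u" "Ec x' \<subseteq> T w" for u w x x'
    using that unfolding R_def by metis
  have "equivp R"
  proof (intro equivpI reflpI sympI transpI)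
    show "R u u" for u by (rule RI) (rule bdry)
    show "R w u" if "R u w" for u w by (rule RI) (rule RD[OF that, symmetric])
    fix u v w assume uv: "R u v" and vw: "R v w"
    obtain e where e: "Ec e \<subseteq> T v" using tile_has_edge by blast
    show "R u w" by (rule RI) (rule trans[OF RD[OF uv _ e] RD[OF vw e]])
  qed
  moreover have "R (Hd x) (Tl x)" for x
    by (rule RI) (rule trans[OF bdry[OF _ head_lift(1)[of x]] bdry[OF tail_lift(1)]])
  ultimately have "R (Hd x) (Hd y)" by (rule dual_connected)
  then show ?thesis by (rule RD) (rule head_lift(1))+
qed

end

section \<open>Node classes and Euler's formula\<close>

declare split_paired_Ex [simp del] split_paired_All [simp del]

lemma equivp_vimage: "equivp R \<Longrightarrow> equivp (\<lambda>x y. R (f x) (f y))"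
  by (intro equivpI reflpI sympI transpI)
    (erule equivp_reflp, erule equivp_symp, assumption, erule equivp_transp)

context dimer_geometry
begin

text \<open>A node of the torus is encoded as the set of arrows at it, so the nodes of colour
  \<open>c\<close> are the members of \<open>range (cls c)\<close>.\<close>

definition cls :: "bool \<Rightarrow> 'e \<Rightarrow> 'e set"
  where "cls c a = {b. \<exists>m. nd c (b, m) = nd c (a, 0)}"

text \<open>The deck transformation picked up by crossing an arrow, relative to the chosen lifts of the tiles.\<close>

definition dsp :: "'e \<Rightarrow> int \<times> int"
  where "dsp a = snd (Hd (a, 0)) - snd (Tl (a, 0))"

lemma nd_mv: "nd c (mv k x) = shift k + nd c x"
  by (simp add: nd_def black_lift_mv white_lift_mv)

lemma dr_mv: "dr c (mv k x) = dr c x"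
  by (simp add: dr_def nd_mv)

lemma st_mv: "st b c (mv k x) = mv k (st b c x)"
  by (simp add: st_def head_lift_mv tail_lift_mv)

lemma Hd_eq: "Hd x = (head \<Gamma> (fst x), snd (Hd (fst x, 0)) + snd x)"
  and Tl_eq: "Tl x = (tail \<Gamma> (fst x), snd (Tl (fst x, 0)) + snd x)"
  using head_lift_mv[of "snd x" "(fst x, 0)"] tail_lift_mv[of "snd x" "(fst x, 0)"]
  by (auto simp: mv_def head_def tail_def)

lemma fst_Hd [simp]: "fst (Hd x) = head \<Gamma> (fst x)" and fst_Tl [simp]: "fst (Tl x) = tail \<Gamma> (fst x)"
  by (subst Hd_eq, simp) (subst Tl_eq, simp)

lemma dsp_lift: "snd (Hd x) - snd (Tl x) = dsp (fst x)"
  by (subst Hd_eq, subst Tl_eq) (simp add: dsp_def)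

lemma cls_refl [simp]: "a \<in> cls c a"
  by (auto simp: cls_def)

lemma nd_cls: "nd c x = nd c y \<Longrightarrow> fst x \<in> cls c (fst y)"
proof -
  assume "nd c x = nd c y"
  then have "nd c (mv (- snd y) x) = nd c (mv (- snd y) y)" by (simp add: nd_mv)
  then have "nd c (fst x, snd x - snd y) = nd c (fst y, 0)" by (simp add: mv_def)
  then show ?thesis unfolding cls_def by blast
qed

lemma cls_nd: "b \<in> cls c (fst x) \<Longrightarrow> \<exists>y. fst y = b \<and> nd c y = nd c x"
proof -
  assume "b \<in> cls c (fst x)"
  then obtain m where "nd c (b, m) = nd c (fst x, 0)" by (auto simp: cls_def)
  then have "nd c (mv (snd x) (b, m)) = nd c (mv (snd x) (fst x, 0))" by (simp add: nd_mv)
  then show ?thesis by (intro exI[of _ "mv (snd x) (b, m)"]) (simp add: mv_def)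
qed

lemma cls_eq: "b \<in> cls c a \<Longrightarrow> cls c b = cls c a"
proof -
  assume "b \<in> cls c a"
  then obtain y where y: "fst y = b" "nd c y = nd c (a, 0)" using cls_nd[of b c "(a, 0)"] by auto
  show ?thesis
  proof (intro equalityI subsetI)
    fix d assume "d \<in> cls c b"
    then obtain z where "fst z = d" "nd c z = nd c y" using cls_nd[of d c y] y by auto
    then show "d \<in> cls c a" using nd_cls[of c z "(a, 0)"] y by simp
  next
    fix d assume "d \<in> cls c a"
    then obtain z where "fst z = d" "nd c z = nd c (a, 0)" using cls_nd[of d c "(a, 0)"] by auto
    then show "d \<in> cls c b" using nd_cls[of c z y] y by simp
  qed
qed

lemma plus_path_cls: "plus_path \<Gamma> a = cls True a - {a}"
  and minus_path_cls: "minus_path \<Gamma> a = cls False a - {a}"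
  by (auto simp: plus_path_def minus_path_def cls_def nd_def)

text \<open>The covering map is injective on the lifted edges at one node, because a nontrivial deck
  transformation moves the node.\<close>

lemma sum_cls: "(\<Sum>b\<in>cls c a. g b) = (\<Sum>x | nd c x = nd c (a, 0). g (fst x))"
proof (rule sum.reindex_cong[of fst])
  show "inj_on fst {x. nd c x = nd c (a, 0)}"
  proof (rule inj_onI)
    fix x y :: "'e lifted"
    assume xy: "x \<in> {x. nd c x = nd c (a, 0)}" "y \<in> {x. nd c x = nd c (a, 0)}" "fst x = fst y"
    then have "x = mv (snd x - snd y) y" by (simp add: mv_def prod_eq_iff)
    then have "shift (snd x - snd y) + nd c y = nd c x" by (metis nd_mv)
    then have "shift (snd x - snd y) = shift 0" using xy by simp
    then have "snd x = snd y" unfolding shift_eq_iff by simp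
    then show "x = y" using xy by (cases x; cases y) simp
  qed
  show "cls c a = fst ` {x. nd c x = nd c (a, 0)}"
    using cls_nd[of _ c "(a, 0)"] nd_cls[of c _ "(a, 0)"] by (force simp: image_iff)
qed simp

text \<open>Heads and tails of the edges at a node both run exactly once through the tiles
  containing it, by \<open>st_inj\<close> and \<open>st_surj\<close>.\<close>

lemma sum_around_node:
  fixes \<phi> :: "'v lifted \<Rightarrow> 'a::comm_monoid_add"
  shows "(\<Sum>x | nd c x = nd c x0. \<phi> (Hd x)) = (\<Sum>x | nd c x = nd c x0. \<phi> (Tl x))"
proof -
  have "(\<Sum>x | nd c x = nd c x0. \<phi> (st b c x)) = (\<Sum>y | nd c x0 \<in> T y. \<phi> y)" for b
  proof (rule sum.reindex_cong[symmetric, of "st b c"])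
    show "inj_on (st b c) {x. nd c x = nd c x0}" by (rule inj_onI) (rule st_inj[of c _ _ b], simp_all)
    show "{y. nd c x0 \<in> T y} = st b c ` {x. nd c x = nd c x0}"
    proof (intro equalityI subsetI)
      fix y assume "y \<in> {y. nd c x0 \<in> T y}"
      then show "y \<in> st b c ` {x. nd c x = nd c x0}" using st_surj[of c x0 y b] by blast
    next
      fix y assume "y \<in> st b c ` {x. nd c x = nd c x0}"
      then obtain x where "nd c x = nd c x0" "y = st b c x" by blast
      then show "y \<in> {y. nd c x0 \<in> T y}" using st_tile[of x b c] nd_in_edge[of c x] by auto
    qed
  qed simp
  from this[of c] this[of "\<not> c"] show ?thesis by (simp add: st_def)
qed

text \<open>A small loop around a node closes up in the plane.\<close>

lemma cls_sum_dsp: "(\<Sum>b\<in>cls c a. dsp b) = 0"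
proof -
  have "(\<Sum>b\<in>cls c a. dsp b) = (\<Sum>x | nd c x = nd c (a, 0). snd (Hd x) - snd (Tl x))"
    by (simp add: sum_cls dsp_lift)
  also have "\<dots> = 0" using sum_around_node[of snd c "(a, 0)"] by (simp add: sum_subtractf)
  finally show ?thesis .
qed

lemma cls_sum_coboundary:
  fixes f :: "'v \<Rightarrow> 'a::ab_group_add"
  shows "(\<Sum>b\<in>cls c a. f (head \<Gamma> b) - f (tail \<Gamma> b)) = 0"
proof -
  have "(\<Sum>b\<in>cls c a. f (head \<Gamma> b) - f (tail \<Gamma> b)) = (\<Sum>x | nd c x = nd c (a, 0). f (fst (Hd x)) - f (fst (Tl x)))"
    by (simp add: sum_cls)
  also have "\<dots> = 0" using sum_around_node[of "\<lambda>y. f (fst y)" c "(a, 0)"] by (simp add: sum_subtractf)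
  finally show ?thesis .
qed

lemma cls_connected:
  assumes "\<And>a b c. b \<in> cls c a \<Longrightarrow> F b = F a"
  shows "F a = F b"
  using edges_connected[of "\<lambda>x. F (fst x)" "(a, 0)" "(b, 0)", OF assms[OF nd_cls]] by simp

lemma quiver_connected:
  assumes "equivp R" "\<And>a. R (head \<Gamma> a) (tail \<Gamma> a)"
  shows "R i j"
using dual_connected[OF equivp_vimage[OF assms(1), of fst], of "(i, 0)" "(j, 0)"] assms(2) by simp

text \<open>
  Half of Euler's formula, by sweeping: for a generic linear functional, send every edge except the
  leftmost one hanging from its upper endnode to the tile on its left, whose unique highest point is
  that node.
\<close>

lemma euler_inequality:
  "CARD('e) \<le> card (range (cls True)) + card (range (cls False)) + CARD('v)"
proof -
  \<comment> \<open>By periodicity only finitely many slopes occur; avoiding them makes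
    \<open>L\<close> nonconstant along every edge.\<close>
  have "finite ((\<lambda>a. - Im (dr True (a, 0)) / Re (dr True (a, 0))) ` (UNIV :: 'e set))" by simp
  then obtain t :: real where t: "t \<notin> (\<lambda>a. - Im (dr True (a, 0)) / Re (dr True (a, 0))) ` (UNIV :: 'e set)"
    using ex_new_if_finite[OF infinite_UNIV_char_0] by blast
  define L where "L = (\<lambda>z. Im z + t * Re z)"
  have L_lin: "L (z + w) = L z + L w" "L (z - w) = L z - L w" "L (s *\<^sub>R z) = s * L z" for z w s
    by (simp_all add: L_def algebra_simps)
  have L_dr: "L (dr c x) \<noteq> 0" for c x
  proof
    assume "L (dr c x) = 0"
    then have "L (dr True x) = 0" by (cases c) (auto simp: dr_def nd_def L_lin)
    then have "L (dr True (fst x, 0)) = 0"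
      using dr_mv[of True "snd x" "(fst x, 0)"] by (simp add: mv_def)
    moreover have "dr True (fst x, 0) \<noteq> 0" by (rule dr_nonzero)
    ultimately have "Re (dr True (fst x, 0)) \<noteq> 0" "t * Re (dr True (fst x, 0)) = - Im (dr True (fst x, 0))"
      by (auto simp: L_def complex_eq_iff)
    then have "t = - Im (dr True (fst x, 0)) / Re (dr True (fst x, 0))" by (simp add: field_simps)
    then show False using t by blast
  qed
  \<comment> \<open>The colour of the higher endnode; hence \<open>dr (top x) x\<close> points
    downwards.\<close>
  define top where "top = (\<lambda>x. L (dr True x) < 0)"
  have L_top: "L (dr (top x) x) < 0" for x
    using L_dr[of True x] by (auto simp: top_def dr_def nd_def L_lin)
  have top_unique: "top x = c" if "L (dr c x) < 0" for c x
    using that L_top[of x] by (cases c; cases "top x") (auto simp: dr_def nd_def L_lin)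
  have top_mv: "top (mv k x) = top x" for k x by (simp add: top_def dr_mv)
  \<comment> \<open>Another edge hangs from the same upper node, counterclockwise from
    \<open>x\<close>. All hanging edges point into one open half-plane, so \<open>cross\<close>
    orders them linearly and each node has at most one extreme edge.\<close>
  define nonext where "nonext = (\<lambda>x. \<exists>z. top z = top x \<and> nd (top x) z = nd (top x) x \<and>
    cross (dr (top x) x) (dr (top x) z) > 0)"
  have nonext_mv: "nonext (mv k x) \<longleftrightarrow> nonext x" for k x
  proof -
    have "nonext (mv k x)" if nx: "nonext x" for k x
    proof -
      obtain z where "top z = top x" "nd (top x) z = nd (top x) x" "cross (dr (top x) x) (dr (top x) z) > 0"
        using nx unfolding nonext_def by blast
      then show ?thesis unfolding nonext_def by (intro exI[of _ "mv k z"]) (simp add: top_mv nd_mv dr_mv)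
    qed
    from this[of x k] this[of "mv k x" "- k"] show ?thesis by auto
  qed
  have extreme_unique: "x = y" if "\<not> nonext x" "\<not> nonext y" "top x = top y" "nd (top x) x = nd (top x) y" for x y
  proof -
    let ?c = "top x"
    have "\<not> cross (dr ?c x) (dr ?c y) > 0" using that(1,3,4) unfolding nonext_def by auto
    moreover have "\<not> cross (dr ?c y) (dr ?c x) > 0" using that(2,3,4) unfolding nonext_def by auto
    moreover have "cross (dr ?c y) (dr ?c x) = - cross (dr ?c x) (dr ?c y)" by (simp add: cross_eq)
    ultimately have "cross (dr ?c x) (dr ?c y) = 0" by simp
    then obtain s where s: "dr ?c y = s *\<^sub>R dr ?c x" using cross_eq_0D dr_nonzero by blast
    then have "s * L (dr ?c x) < 0" using L_top[of y] that(3) by (simp add: L_lin[symmetric])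
    then have "s > 0" using L_top[of x] by (auto simp: mult_less_0_iff)
    then show ?thesis using same_direction s that by metis
  qed
  define Q where "Q = (\<lambda>x. st True (top x) x)"
  have Q_mv: "Q (mv k x) = mv k (Q x)" for k x by (simp add: Q_def top_mv st_mv)
  have Q_max: "L p \<le> L (nd (top x) x)" if nx: "nonext x" and p: "p \<in> T (Q x)" for x p
  proof (rule ccontr)
    let ?c = "top x"
    let ?n = "nd ?c x"
    assume "\<not> ?thesis"
    then have "p \<in> {q. L q > L ?n}" by simp
    moreover have "open {q. L q > L ?n}" unfolding L_def by (intro open_Collect_less continuous_intros)
    moreover have "p \<in> closure (interior (T (Q x)))" using p by (simp add: closure_interior_T)
    ultimately have "{q. L q > L ?n} \<inter> interior (T (Q x)) \<noteq> {}"
      using open_Int_closure_eq_empty[of "{q. L q > L ?n}" "interior (T (Q x))"] by blast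
    then obtain q where q: "q \<in> interior (T (Q x))" "L q > L ?n" by blast
    obtain z where z: "top z = ?c" "nd ?c z = ?n" "cross (dr ?c x) (dr ?c z) > 0"
      using nx unfolding nonext_def by blast
    \<comment> \<open>The direction of \<open>z\<close> is a combination of those of
      \<open>x\<close> and of \<open>q - ?n\<close> with positive coefficients \<open>a\<close> and
      \<open>b\<close>: the edge \<open>z\<close> would start into the interior of the convex
      tile.\<close>
    define D where "D = cross (dr ?c x) (q - ?n)"
    have D: "D > 0" using st_side[of q True ?c x] q(1) by (simp add: D_def Q_def)
    define b where "b = cross (dr ?c x) (dr ?c z) / D"
    have b: "b > 0" using z D by (simp add: b_def)
    have "cross (dr ?c x) (dr ?c z - b *\<^sub>R (q - ?n)) = cross (dr ?c x) (dr ?c z) - b * D"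
      by (simp add: cross_eq D_def algebra_simps)
    then have "cross (dr ?c x) (dr ?c z - b *\<^sub>R (q - ?n)) = 0" using D by (simp add: b_def)
    then obtain a where a: "dr ?c z - b *\<^sub>R (q - ?n) = a *\<^sub>R dr ?c x" using cross_eq_0D dr_nonzero by blast
    then have "L (dr ?c z) - b * (L q - L ?n) = a * L (dr ?c x)" using L_lin by metis
    moreover have "L (dr ?c z) < 0" using L_top[of z] z(1) by simp
    moreover have "b * (L q - L ?n) > 0" using b q(2) by simp
    ultimately have "a * L (dr ?c x) < 0" by linarith
    then have a_pos: "a > 0" using L_top[of x] by (auto simp: mult_less_0_iff)
    \<comment> \<open>With this \<open>e\<close> the point \<open>?n + e *\<^sub>R dr ?c z\<close>
      is a convex combination of the node, the other end of \<open>x\<close> and the interior point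
      \<open>q\<close>.\<close>
    define e where "e = 1 / (a + b + 1)"
    have "e * (a + b + 1) = 1" "e > 0" "e * a > 0" "e * b > 0"
      using a_pos b by (simp_all add: e_def)
    then have e: "0 < e" "e < 1" "e * b \<le> 1" "0 < e * b" "e * a + e * b \<le> 1" "e * b < 1" "0 < e * a"
      by (simp_all add: algebra_simps)
    have Tx: "?n \<in> T (Q x)" "nd (\<not> ?c) x \<in> T (Q x)"
      using st_tile[of x True ?c] nd_in_edge[of _ x] by (auto simp: Q_def)
    \<comment> \<open>The point \<open>r\<close> on \<open>x\<close> is chosen such that moving it
      by the fraction \<open>e * b\<close> towards \<open>q\<close> reaches the point on
      \<open>z\<close>; this is \<open>(1 - e * b) * s = e * a\<close>.\<close>
    define s where "s = e * a / (1 - e * b)"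
    have eb1: "e * b < 1" by (rule e(6))
    have s: "0 \<le> s" "s \<le> 1" using e by (simp_all add: s_def le_divide_eq divide_le_eq)
    define r where "r = ?n + s *\<^sub>R dr ?c x"
    have "r = (1 - s) *\<^sub>R ?n + s *\<^sub>R nd (\<not> ?c) x" by (simp add: r_def dr_def algebra_simps)
    then have "r \<in> T (Q x)" using convexD_alt[OF convex_T Tx s] by simp
    then have "r - (e * b) *\<^sub>R (r - q) \<in> interior (T (Q x))"
      using mem_interior_convex_shrink[OF convex_T q(1) _ e(4,3)] by blast
    moreover have "r - (e * b) *\<^sub>R (r - q) = ?n + e *\<^sub>R dr ?c z"
    proof -
      have "(1 - e * b) * s = e * a" using eb1 by (simp add: s_def)
      then have eq: "(1 - e * b) *\<^sub>R (s *\<^sub>R dr ?c x) = (e * a) *\<^sub>R dr ?c x" by simp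
      have dz: "dr ?c z = b *\<^sub>R (q - ?n) + a *\<^sub>R dr ?c x" using a by (simp add: algebra_simps)
      have "r - (e * b) *\<^sub>R (r - q) = ?n + (1 - e * b) *\<^sub>R (s *\<^sub>R dr ?c x) + (e * b) *\<^sub>R (q - ?n)"
        by (simp add: r_def algebra_simps)
      also have "\<dots> = ?n + e *\<^sub>R dr ?c z" unfolding eq dz scaleR_right_distrib by simp
      finally show ?thesis .
    qed
    ultimately show False
      using open_edge_dr[OF e(1,2), of ?c z] interior_not_open_edge z(2) by metis
  qed
  \<comment> \<open>Two maxima would span a level segment in the frontier. It is infinite and
    covered by finitely many edges, so some edge contains two of its points and \<open>L\<close> is
    constant along that edge.\<close>
  have unique_max: "n = n'" if y: "n \<in> T y" "n' \<in> T y" "\<And>p. p \<in> T y \<Longrightarrow> L p \<le> L n" "L n' = L n" for n n' y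
  proof (rule ccontr)
    assume "n \<noteq> n'"
    then have "infinite (open_segment n n')" by simp
    have seg: "L p = L n" if p: "p \<in> open_segment n n'" for p
    proof -
      obtain u where u: "p = (1 - u) *\<^sub>R n + u *\<^sub>R n'" using p by (auto simp: in_segment)
      show ?thesis using y(4) by (simp add: u L_lin algebra_simps)
    qed
    have "bounded (T y)" by (simp add: compact_T compact_imp_bounded)
    have "open_segment n n' \<subseteq> (\<Union>x\<in>{x. Ec x \<inter> T y \<noteq> {} \<and> Ec x \<subseteq> T y}. Ec x)"
    proof
      fix p assume p: "p \<in> open_segment n n'"
      have pT: "p \<in> T y" using p y(1,2) convex_T by (meson convex_contains_open_segment subsetD)
      have Lp: "L p = L n" using p by (rule seg)
      have "p \<notin> interior (T y)"
      proof
        assume "p \<in> interior (T y)"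
        then obtain e where e: "e > 0" "ball p e \<subseteq> T y" using mem_interior by blast
        have "p + (e / 2) *\<^sub>R \<i> \<in> ball p e" using e(1) by (simp add: dist_norm)
        then have "L (p + (e / 2) *\<^sub>R \<i>) \<le> L n" using e y(3) by blast
        then show False using Lp e(1) by (simp add: L_lin) (simp add: L_def)
      qed
      then have "p \<in> frontier (T y)" using pT closed_T[of y] by (simp add: frontier_def)
      then show "p \<in> (\<Union>x\<in>{x. Ec x \<inter> T y \<noteq> {} \<and> Ec x \<subseteq> T y}. Ec x)"
        using frontier_edge pT by blast
    qed
    moreover have "finite {x. Ec x \<inter> T y \<noteq> {} \<and> Ec x \<subseteq> T y}"
      by (rule finite_subset[OF _ finite_Ec_meeting[OF \<open>bounded (T y)\<close>]]) blast
    moreover have "open_segment n n' \<subseteq> (\<Union>x\<in>X. Ec x \<inter> open_segment n n')"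
      if "open_segment n n' \<subseteq> (\<Union>x\<in>X. Ec x)" for X using that by blast
    ultimately obtain x where inf: "infinite (Ec x \<inter> open_segment n n')"
      using \<open>infinite (open_segment n n')\<close> by (meson finite_UN finite_subset)
    then obtain p where p: "p \<in> Ec x \<inter> open_segment n n'" by (metis equals0I finite.emptyI)
    have "infinite (Ec x \<inter> open_segment n n' - {p})" using inf by simp
    then obtain p' where "p' \<in> Ec x \<inter> open_segment n n' - {p}" by (metis equals0I finite.emptyI)
    with p have pp: "p \<in> Ec x" "p' \<in> Ec x" "p \<noteq> p'" "p \<in> open_segment n n'" "p' \<in> open_segment n n'"
      by auto
    obtain v v' where v: "p = nd True x + v *\<^sub>R dr True x" "p' = nd True x + v' *\<^sub>R dr True x"
      using edge_dr[OF pp(1)] edge_dr[OF pp(2)] by metis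
    have "L p = L n" "L p' = L n" using pp(4,5) seg by blast+
    then have "L (nd True x) + v * L (dr True x) = L n" "L (nd True x) + v' * L (dr True x) = L n"
      by (simp_all only: v L_lin)
    then have "(v - v') * L (dr True x) = 0" unfolding left_diff_distrib by linarith
    moreover have "v \<noteq> v'" using pp(3) v by auto
    ultimately show False using L_dr[of True x] by simp
  qed
  have Q_inj: "x = y" if "nonext x" "nonext y" "Q x = Q y" for x y
  proof -
    have n: "nd (top x) x \<in> T (Q x)" "nd (top y) y \<in> T (Q x)"
      using st_tile[of x True "top x"] st_tile[of y True "top y"] nd_in_edge[of _ x] nd_in_edge[of _ y] that(3)
      by (auto simp: Q_def)
    have "L (nd (top y) y) = L (nd (top x) x)"
      using Q_max[OF that(1) n(2)] Q_max[OF that(2)] n(1) that(3) by fastforce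
    then have eq: "nd (top x) x = nd (top y) y" using unique_max[OF n] Q_max[OF that(1)] by blast
    then have "top x = top y" by (rule nd_colour)
    then show ?thesis using st_inj[of "top x" x y True] eq that(3) by (simp add: Q_def)
  qed
  let ?N = "{a. nonext (a, 0)}"
  have "card ?N \<le> CARD('v)"
  proof (rule card_inj_on_le[of "\<lambda>a. fst (Q (a, 0))"])
    show "inj_on (\<lambda>a. fst (Q (a, 0))) ?N"
    proof (rule inj_onI)
      fix a b assume ab: "a \<in> ?N" "b \<in> ?N" "fst (Q (a, 0)) = fst (Q (b, 0))"
      define k where "k = snd (Q (a, 0)) - snd (Q (b, 0))"
      have "Q (a, 0) = mv k (Q (b, 0))" using ab(3) by (intro prod_eqI) (simp_all add: k_def)
      then have "Q (a, 0) = Q (mv k (b, 0))" by (simp only: Q_mv)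
      then have "(a, 0) = mv k (b, 0)" using Q_inj ab nonext_mv by simp
      then show "a = b" by (simp add: mv_def)
    qed
  qed auto
  moreover have "card (- ?N) \<le> card (range (cls True)) + card (range (cls False))"
  proof -
    have "card (- ?N) \<le> card (range (cls True) <+> range (cls False))"
    proof (rule card_inj_on_le[of "\<lambda>a. if top (a, 0) then Inl (cls True a) else Inr (cls False a)"])
      show "inj_on (\<lambda>a. if top (a, 0) then Inl (cls True a) else Inr (cls False a)) (- ?N)"
      proof (rule inj_onI)
        fix a b assume ab: "a \<in> - ?N" "b \<in> - ?N"
          "(if top (a, 0) then Inl (cls True a) else Inr (cls False a)) =
           (if top (b, 0) then Inl (cls True b) else Inr (cls False b))"
        then have tp: "top (a, 0) = top (b, 0)" "cls (top (a, 0)) a = cls (top (a, 0)) b"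
          by (auto split: if_splits)
        then have "b \<in> cls (top (a, 0)) a" by auto
        then obtain m where m: "nd (top (a, 0)) (b, m) = nd (top (a, 0)) (a, 0)" by (auto simp: cls_def)
        have "(b, m) = mv m (b, 0)" by (simp add: mv_def)
        then have "\<not> nonext (b, m)" "top (b, m) = top (a, 0)" using ab(2) tp nonext_mv top_mv by auto
        then have "(a, 0) = (b, m)" using extreme_unique[of "(a, 0)" "(b, m)"] ab(1) m by simp
        then show "a = b" by simp
      qed
    qed auto
    then show ?thesis by (simp add: card_Plus)
  qed
  moreover have "CARD('e) = card ?N + card (- ?N)"
    by (subst card_Un_disjoint[symmetric]) (auto intro: arg_cong[of _ _ card])
  ultimately show ?thesis by linarith
qed

end

section \<open>Pieces cut out by a set of edges\<close>

lemma torus_proj_shift [simp]: "torus_proj (shift k + z) = torus_proj z"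
proof -
  have "cis (2 * pi * (of_int n + x)) = cis (2 * pi * x)" for n :: int and x :: real
    using cis_multiple_2pi[of "of_int n"] by (simp add: distrib_left flip: cis_mult)
  then show ?thesis by (simp add: torus_proj_def shift_def)
qed

lemma torus_proj_eq_iff: "torus_proj z = torus_proj w \<longleftrightarrow> (\<exists>k. w = shift k + z)"
proof
  have *: "\<exists>n::int. y = of_int n + x" if "cis (2 * pi * x) = cis (2 * pi * y)" for x y :: real
  proof -
    have "exp (\<i> * complex_of_real (2 * pi * y)) = exp (\<i> * complex_of_real (2 * pi * x))"
      using that by (simp add: cis_conv_exp)
    then obtain n :: int where
      "\<i> * complex_of_real (2 * pi * y) = \<i> * complex_of_real (2 * pi * x) + (of_int (2 * n) * pi) * \<i>"
      unfolding exp_eq by blast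
    then have "Im (\<i> * complex_of_real (2 * pi * y)) = Im (\<i> * complex_of_real (2 * pi * x) + (of_int (2 * n) * pi) * \<i>)"
      by simp
    then have "2 * pi * y = 2 * pi * (x + of_int n)" by (simp add: algebra_simps)
    then have "y = of_int n + x" by simp
    then show ?thesis by blast
  qed
  assume "torus_proj z = torus_proj w"
  then obtain m n :: int where "Re w = of_int m + Re z" "Im w = of_int n + Im z"
    using *[of "Re z" "Re w"] *[of "Im z" "Im w"] by (auto simp: torus_proj_def)
  then have "w = shift (m, n) + z" by (simp add: shift_def complex_eq_iff)
  then show "\<exists>k. w = shift k + z" by blast
qed auto

lemma torus_proj_translate: "torus_proj ` translate k P = torus_proj ` P"
  by (auto simp: translate_def image_image)

lemma continuous_torus_proj: "continuous_on S torus_proj"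
  unfolding torus_proj_def by (intro continuous_intros)

text \<open>The common core of the two computations of pieces, on the torus and in the hexagon.
  Unions of the \<open>K i\<close> over different \<open>G\<close>-classes are closed and disjoint
  within \<open>U\<close>, so no component crosses from one to another; chains of the connected sets
  in \<open>adj\<close> join each class. Density of \<open>I i\<close> in \<open>K i\<close> gives
  the closures.\<close>

lemma components_by_pieces:
  fixes K I :: "'i::finite \<Rightarrow> 'a::t2_space set"
  assumes cl: "\<And>i. closed (K i)" and I: "\<And>i. I i \<noteq> {}" "\<And>i. I i \<subseteq> U" "\<And>i. I i \<subseteq> K i" "\<And>i. K i \<subseteq> closure (I i)"
    and U: "U \<subseteq> (\<Union>i. K i)"
    and sep: "\<And>z i j. z \<in> U \<Longrightarrow> z \<in> K i \<Longrightarrow> z \<in> K j \<Longrightarrow> equivclp G i j"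
    and conn: "\<And>z i. z \<in> U \<Longrightarrow> z \<in> K i \<Longrightarrow> connected (insert z (I i))"
    and adj: "\<And>i j. G i j \<Longrightarrow> \<exists>X. connected X \<and> X \<subseteq> U \<and> I i \<subseteq> X \<and> I j \<subseteq> X"
  shows "closure ` components U = range (\<lambda>i. \<Union>j\<in>{j. equivclp G i j}. K j)"
proof -
  define p where "p = (\<lambda>i. SOME z. z \<in> I i)"
  have p: "p i \<in> I i" for i using I(1) unfolding p_def by (simp add: some_in_eq)
  have pU: "p i \<in> U" for i using p I(2) by blast
  have reach: "connected_component U (p i) (p j)" if "equivclp G i j" for i j
    using that
  proof (induction rule: equivclp_induct)
    case base
    then show ?case using pU by (simp add: connected_component_refl_eq)
  next
    case (step j k)
    from step.hyps(2) obtain X where X: "connected X" "X \<subseteq> U" "I j \<subseteq> X" "I k \<subseteq> X"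
      using adj[of j k] adj[of k j] by auto
    then have "p j \<in> X" "p k \<in> X" using p[of j] p[of k] by auto
    then have "connected_component U (p j) (p k)"
      unfolding connected_component_def using X by auto
    with step.IH show ?case by (rule connected_component_trans)
  qed
  have near: "connected_component U z (p i)" if z: "z \<in> U" "z \<in> K i" for z i
    unfolding connected_component_def
    by (rule exI[of _ "insert z (I i)"]) (use conn[OF z] p I(2) z in auto)
  have comp: "connected_component_set U (p i) = U \<inter> (\<Union>j\<in>{j. equivclp G i j}. K j)" for i
  proof (intro equalityI subsetI)
    fix z assume "z \<in> U \<inter> (\<Union>j\<in>{j. equivclp G i j}. K j)"
    then obtain j where "z \<in> U" "z \<in> K j" "equivclp G i j" by blast
    then have "connected_component U (p i) z"
      using connected_component_trans[OF reach connected_component_sym[OF near]] by simp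
    then show "z \<in> connected_component_set U (p i)" by simp
  next
    fix z assume z: "z \<in> connected_component_set U (p i)"
    let ?A = "\<Union>j\<in>{j. equivclp G i j}. K j" and ?B = "\<Union>j\<in>{j. \<not> equivclp G i j}. K j"
    let ?C = "connected_component_set U (p i)"
    have CU: "?C \<subseteq> U" by (rule connected_component_subset)
    have "z \<notin> ?B"
    proof
      assume "z \<in> ?B"
      then have B: "?B \<inter> ?C \<noteq> {}" using z by blast
      have disj: "?A \<inter> ?B \<inter> ?C = {}"
      proof (rule ccontr)
        assume "?A \<inter> ?B \<inter> ?C \<noteq> {}"
        then obtain q j k where q: "q \<in> K j" "equivclp G i j" "q \<in> K k" "\<not> equivclp G i k" "q \<in> ?C" by blast
        have "q \<in> U" using q(5) CU by (rule subsetD[rotated])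
        then have "equivclp G j k" using sep q(1,3) by simp
        then show False using q(4) equivclp_trans[OF q(2)] by simp
      qed
      have cover: "?C \<subseteq> ?A \<union> ?B" using CU U by blast
      have "p i \<in> ?A" by (rule UN_I[of i]) (use p[of i] I(3)[of i] in auto)
      moreover have "p i \<in> ?C" using pU by simp
      ultimately have "p i \<in> ?A \<inter> ?C" by (rule IntI)
      then have A: "?A \<inter> ?C \<noteq> {}" by (metis emptyE)
      have "closed ?A" "closed ?B" using cl by auto
      from connected_closedD[OF connected_connected_component disj cover this] A B
      show False by satx
    qed
    then show "z \<in> U \<inter> ?A" using z CU U by blast
  qed
  have "components U = range (\<lambda>i. connected_component_set U (p i))"
  proof (intro equalityI subsetI)
    fix C assume "C \<in> components U"
    then obtain z where z: "z \<in> U" "C = connected_component_set U z" by (auto simp: components_def)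
    then obtain i where "z \<in> K i" using U by blast
    then have "connected_component_set U z = connected_component_set U (p i)"
      using connected_component_eq[of "p i" U z] near[OF z(1)] by simp
    then show "C \<in> range (\<lambda>i. connected_component_set U (p i))" using z by blast
  qed (use pU in \<open>auto simp: components_def\<close>)
  moreover have "closure (connected_component_set U (p i)) = (\<Union>j\<in>{j. equivclp G i j}. K j)" for i
  proof
    have "closed (\<Union>j\<in>{j. equivclp G i j}. K j)" using cl by auto
    then show "closure (connected_component_set U (p i)) \<subseteq> (\<Union>j\<in>{j. equivclp G i j}. K j)"
      unfolding comp by (intro closure_minimal) auto
    have "I j \<subseteq> connected_component_set U (p i)" if "equivclp G i j" for j
      unfolding comp using I that by blast
    then have "K j \<subseteq> closure (connected_component_set U (p i))" if "equivclp G i j" for j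
      using order_trans[OF I(4)[of j] closure_mono] that by blast
    then show "(\<Union>j\<in>{j. equivclp G i j}. K j) \<subseteq> closure (connected_component_set U (p i))" by blast
  qed
  ultimately show ?thesis by (simp add: image_image)
qed

context dimer_geometry
begin

definition adjacent :: "'e set \<Rightarrow> 'v \<Rightarrow> 'v \<Rightarrow> bool"
  where "adjacent S i j \<longleftrightarrow> (\<exists>a\<in>S. i = head \<Gamma> a \<and> j = tail \<Gamma> a)"

lemma insert_interior_connected:
  assumes "z \<in> T y" shows "connected (insert z (interior (T y)))"
proof (rule connected_intermediate_closure)
  show "connected (interior (T y))" using convex_T convex_interior convex_connected by blast
  show "insert z (interior (T y)) \<subseteq> closure (interior (T y))"
    using assms interior_subset by (auto simp: closure_interior_T)
qed auto

lemma across_edge_connected: "connected (interior (T (Hd x)) \<union> Eo x \<union> interior (T (Tl x)))"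
proof -
  have side: "connected (interior (T y) \<union> Eo x)" if "Ec x \<subseteq> T y" for y
  proof (rule connected_intermediate_closure)
    show "connected (interior (T y))" using convex_T convex_interior convex_connected by blast
    show "interior (T y) \<union> Eo x \<subseteq> closure (interior (T y))"
      using that interior_subset by (auto simp: closure_interior_T edge_lift_eq)
  qed auto
  have "connected ((interior (T (Hd x)) \<union> Eo x) \<union> (interior (T (Tl x)) \<union> Eo x))"
    using mid_open[of x] by (intro connected_Un side head_lift(1) tail_lift(1)) auto
  moreover have "(interior (T (Hd x)) \<union> Eo x) \<union> (interior (T (Tl x)) \<union> Eo x) =
    interior (T (Hd x)) \<union> Eo x \<union> interior (T (Tl x))" by blast
  ultimately show ?thesis by simp
qed

lemma T_Pair: "T (j, k) = translate k (tile \<Gamma> j)"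
  by (simp add: tile_lift_def)

lemma T_Pair_0: "T (j, 0) = tile \<Gamma> j"
  by (simp add: T_Pair translate_def)

lemma mem_edge_set_lift: "z \<in> edge_set_lift \<Gamma> E \<longleftrightarrow> (\<exists>x. fst x \<in> E \<and> z \<in> Ec x)"
  unfolding edge_set_lift_def by (force simp: mem_Times_iff)

lemma edge_set_lift_shift: "shift k + z \<in> edge_set_lift \<Gamma> E \<longleftrightarrow> z \<in> edge_set_lift \<Gamma> E"
proof -
  have "shift k + z \<in> edge_set_lift \<Gamma> E" if z: "z \<in> edge_set_lift \<Gamma> E" for k z
  proof -
    obtain x where "fst x \<in> E" "z \<in> Ec x" using z unfolding mem_edge_set_lift by blast
    then have "fst (mv k x) \<in> E" "shift k + z \<in> Ec (mv k x)" by (simp_all add: edge_lift_mv mem_translate)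
    then show ?thesis unfolding mem_edge_set_lift by blast
  qed
  from this[of z k] this[of "shift k + z" "- k"] show ?thesis
    by (metis add.assoc add.left_inverse add_0 shift_0 shift_add)
qed

lemma torus_proj_edge_set_lift:
  "torus_proj z \<in> torus_proj ` edge_set_lift \<Gamma> E \<longleftrightarrow> z \<in> edge_set_lift \<Gamma> E"
  using edge_set_lift_shift by (auto simp: torus_proj_eq_iff)

text \<open>Every node lies on an edge in \<open>E\<close>, so outside \<open>E\<close> tiles touch
  only along open edges, whose arrows are in \<open>- E\<close>.\<close>

lemma jigsaw_pieces_eq:
  assumes cov: "\<And>c a. cls c a \<inter> E \<noteq> {}"
  shows "jigsaw_pieces \<Gamma> E = range (\<lambda>i. \<Union>j\<in>{j. equivclp (adjacent (- E)) i j}. torus_proj ` tile \<Gamma> j)"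
  unfolding jigsaw_pieces_def
proof (rule components_by_pieces[where I = "\<lambda>i. torus_proj ` interior (tile \<Gamma> i)"])
  let ?U = "range torus_proj - torus_proj ` edge_set_lift \<Gamma> E"
  have node: "z \<in> edge_set_lift \<Gamma> E" if z: "z \<in> nodes \<Gamma>" for z
  proof -
    obtain c x where x: "nd c x = z" using z nodes_nd by blast
    obtain b where "b \<in> cls c (fst x)" "b \<in> E" using cov by blast
    then obtain y where "fst y \<in> E" "nd c y = z" using cls_nd[of b c x] x by auto
    then show ?thesis unfolding mem_edge_set_lift using nd_in_edge by blast
  qed
  have int0: "interior (T y) \<inter> edge_set_lift \<Gamma> E = {}" for y
    using interior_not_edge[of _ y] by (auto simp: mem_edge_set_lift)
  have proj_T: "torus_proj ` T y = torus_proj ` tile \<Gamma> (fst y)"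
    "torus_proj ` interior (T y) = torus_proj ` interior (tile \<Gamma> (fst y))" for y
    by (simp_all add: tile_lift_def interior_translate torus_proj_translate)
  fix i
  have i0: "T (i, 0) = tile \<Gamma> i" by (rule T_Pair_0)
  have compact: "compact (torus_proj ` tile \<Gamma> i)"
    using compact_T[of "(i, 0)"] unfolding i0 by (rule compact_continuous_image[OF continuous_torus_proj])
  then show "closed (torus_proj ` tile \<Gamma> i)" by (rule compact_imp_closed)
  show "torus_proj ` interior (tile \<Gamma> i) \<noteq> {}" using interior_T_nonempty[of "(i, 0)"] by (simp add: i0)
  have U_I: "torus_proj z \<in> ?U" if "z \<notin> edge_set_lift \<Gamma> E" for z
    using that by (simp add: torus_proj_edge_set_lift)
  have int_U: "torus_proj ` interior (T y) \<subseteq> ?U" for y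
    by (intro image_subsetI U_I) (use int0[of y] in blast)
  show "torus_proj ` interior (tile \<Gamma> i) \<subseteq> ?U" using int_U[of "(i, 0)"] by (simp add: i0)
  show "torus_proj ` interior (tile \<Gamma> i) \<subseteq> torus_proj ` tile \<Gamma> i" by (intro image_mono interior_subset)
  show "torus_proj ` tile \<Gamma> i \<subseteq> closure (torus_proj ` interior (tile \<Gamma> i))"
    using image_closure_subset[OF continuous_torus_proj closed_closure closure_subset, of "interior (tile \<Gamma> i)"]
      closure_interior_T[of "(i, 0)"] by (simp add: i0)
  show "?U \<subseteq> (\<Union>i. torus_proj ` tile \<Gamma> i)"
  proof
    fix z assume "z \<in> ?U"
    then obtain w y where "z = torus_proj w" "w \<in> T y" using T_cover by blast
    then have "z \<in> torus_proj ` tile \<Gamma> (fst y)" using proj_T(1)[of y] by blast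
    then show "z \<in> (\<Union>i. torus_proj ` tile \<Gamma> i)" by blast
  qed
  show "connected (insert z (torus_proj ` interior (tile \<Gamma> i)))" if zi: "z \<in> torus_proj ` tile \<Gamma> i" for z
  proof -
    obtain w where w: "w \<in> T (i, 0)" "z = torus_proj w" using zi unfolding i0 by blast
    have "connected (torus_proj ` insert w (interior (T (i, 0))))"
      by (intro connected_continuous_image continuous_torus_proj insert_interior_connected w)
    then show ?thesis by (simp add: w i0)
  qed
  fix j
  show "equivclp (adjacent (- E)) i j" if z: "z \<in> ?U" "z \<in> torus_proj ` tile \<Gamma> i" "z \<in> torus_proj ` tile \<Gamma> j" for z
  proof -
    obtain w w' where w: "w \<in> T (i, 0)" "z = torus_proj w" "w' \<in> T (j, 0)" "z = torus_proj w'"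
      using z(2,3) unfolding T_Pair_0 by blast
    then obtain k where "w = shift k + w'" using torus_proj_eq_iff by metis
    then have wj: "w \<in> T (j, k)" using w(3) by (simp add: T_Pair T_Pair_0 mem_translate)
    have wE: "w \<notin> edge_set_lift \<Gamma> E" using z(1) w(2) by blast
    show ?thesis
    proof (cases rule: cell_cases[of w])
      case 1
      then show ?thesis using node wE by blast
    next
      case (2 x)
      then have "fst x \<notin> E" using wE unfolding mem_edge_set_lift edge_lift_eq by blast
      then have a: "adjacent (- E) (head \<Gamma> (fst x)) (tail \<Gamma> (fst x))" by (auto simp: adjacent_def)
      have "(i, 0) = Hd x \<or> (i, 0) = Tl x" "(j, k) = Hd x \<or> (j, k) = Tl x"
        using open_edge_in_tile[OF 2] w(1) wj by blast+
      then have "i = head \<Gamma> (fst x) \<or> i = tail \<Gamma> (fst x)" "j = head \<Gamma> (fst x) \<or> j = tail \<Gamma> (fst x)"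
        by (metis fst_Hd fst_Tl fst_conv)+
      moreover have "equivclp (adjacent (- E)) (head \<Gamma> (fst x)) (tail \<Gamma> (fst x))"
        using a by (rule r_into_equivclp)
      ultimately show ?thesis using equivclp_sym[of "adjacent (- E)"] by auto
    next
      case (3 v)
      then have "(i, 0) = (j, k)" using interior_in_tile w(1) wj by metis
      then show ?thesis by simp
    qed
  qed
  show "\<exists>X. connected X \<and> X \<subseteq> ?U \<and> torus_proj ` interior (tile \<Gamma> i) \<subseteq> X \<and> torus_proj ` interior (tile \<Gamma> j) \<subseteq> X"
    if "adjacent (- E) i j"
  proof -
    obtain a where a: "a \<notin> E" "i = head \<Gamma> a" "j = tail \<Gamma> a" using \<open>adjacent (- E) i j\<close> by (auto simp: adjacent_def)
    let ?x = "(a, 0)"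
    let ?Y = "interior (T (Hd ?x)) \<union> Eo ?x \<union> interior (T (Tl ?x))"
    have "Eo ?x \<inter> edge_set_lift \<Gamma> E = {}"
    proof (rule ccontr)
      assume "Eo ?x \<inter> edge_set_lift \<Gamma> E \<noteq> {}"
      then obtain z y where "z \<in> Eo ?x" "fst y \<in> E" "z \<in> Ec y" by (auto simp: mem_edge_set_lift)
      then have "y = ?x" using edge_open_edge by blast
      then show False using a \<open>fst y \<in> E\<close> by simp
    qed
    then have "?Y \<inter> edge_set_lift \<Gamma> E = {}" using int0 by blast
    then have "torus_proj ` ?Y \<subseteq> ?U" by (intro image_subsetI U_I) blast
    moreover have "connected (torus_proj ` ?Y)"
      by (rule connected_continuous_image[OF continuous_torus_proj across_edge_connected])
    moreover have "torus_proj ` interior (tile \<Gamma> i) \<subseteq> torus_proj ` ?Y" "torus_proj ` interior (tile \<Gamma> j) \<subseteq> torus_proj ` ?Y"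
      using proj_T(2)[of "Hd ?x"] proj_T(2)[of "Tl ?x"] a by auto
    ultimately show ?thesis by blast
  qed
qed

section \<open>Regions built from one lift of each tile\<close>

definition region :: "('v \<Rightarrow> int \<times> int) \<Rightarrow> 'v set \<Rightarrow> complex set"
  where "region l V = (\<Union>j\<in>V. T (j, l j))"

lemma tile_in_region: "interior (T y) \<inter> region l V \<noteq> {} \<longleftrightarrow> fst y \<in> V \<and> snd y = l (fst y)"
proof
  assume "interior (T y) \<inter> region l V \<noteq> {}"
  then obtain z j where z: "z \<in> interior (T y)" "j \<in> V" "z \<in> T (j, l j)" by (auto simp: region_def)
  then have "(j, l j) = y" using interior_in_tile by blast
  then show "fst y \<in> V \<and> snd y = l (fst y)" using z(2) by auto
next
  assume y: "fst y \<in> V \<and> snd y = l (fst y)"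
  have "T (fst y, l (fst y)) \<subseteq> region l V" unfolding region_def using y by blast
  moreover have "(fst y, l (fst y)) = y" using y by (cases y) simp
  ultimately have "T y \<subseteq> region l V" by simp
  then show "interior (T y) \<inter> region l V \<noteq> {}" using interior_T_nonempty[of y] interior_subset by blast
qed

text \<open>A neighbourhood of \<open>z\<close> inside the region contains interior points of every
  tile through \<open>z\<close>.\<close>

lemma tile_meets_interior_region:
  assumes "z \<in> interior (region l V)" "z \<in> T y"
  shows "fst y \<in> V \<and> snd y = l (fst y)"
proof -
  have "z \<in> closure (interior (T y))" using assms(2) by (simp add: closure_interior_T)
  then have "interior (region l V) \<inter> interior (T y) \<noteq> {}"
    using open_Int_closure_eq_empty[of "interior (region l V)" "interior (T y)"] assms(1) by auto
  then have "interior (T y) \<inter> region l V \<noteq> {}" using interior_subset by blast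
  then show ?thesis by (simp add: tile_in_region)
qed

lemma edge_in_interior_region:
  assumes "Hd x = (i, l i)" "Tl x = (j, l j)" "i \<in> V" "j \<in> V"
  shows "Eo x \<subseteq> interior (region l V)"
proof
  fix z assume z: "z \<in> Eo x"
  obtain e where e: "e > 0" "\<And>y p. p \<in> ball z e \<Longrightarrow> p \<in> T y \<Longrightarrow> z \<in> T y"
    by (rule local_cells[of z]) blast
  have "ball z e \<subseteq> region l V"
  proof
    fix p assume "p \<in> ball z e"
    moreover obtain y where "p \<in> T y" using T_cover by blast
    ultimately have "y = Hd x \<or> y = Tl x" using e(2) open_edge_in_tile[OF z] by blast
    then show "p \<in> region l V" using \<open>p \<in> T y\<close> assms by (auto simp: region_def)
  qed
  then show "z \<in> interior (region l V)" using e(1) mem_interior by blast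
qed

text \<open>Two interior points differing by a deck transformation would give two lifts of the same
  tile in the region.\<close>

lemma inj_on_interior_region: "inj_on torus_proj (interior (region l V))"
proof (rule inj_onI)
  fix z w assume zw: "z \<in> interior (region l V)" "w \<in> interior (region l V)" "torus_proj z = torus_proj w"
  then obtain k where k: "w = shift k + z" by (auto simp: torus_proj_eq_iff)
  obtain y where y: "z \<in> T y" using T_cover by blast
  then have "w \<in> T (mv k y)" by (simp add: k tile_lift_mv mem_translate)
  then have "snd (mv k y) = l (fst y)" "snd y = l (fst y)"
    using tile_meets_interior_region zw y by fastforce+
  then show "z = w" using k by simp
qed

text \<open>
  The edges of \<open>X\<close> are slits: all other edges at their endnodes are in \<open>S\<close>, so they
  do not separate the tiles, whether they are cut or not.
\<close>

lemma cut_pieces_eq: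
  assumes S: "\<And>a. a \<in> S \<Longrightarrow> dsp a = l (head \<Gamma> a) - l (tail \<Gamma> a)" "S \<inter> E = {}"
    and inner: "\<And>a. dsp a = l (head \<Gamma> a) - l (tail \<Gamma> a) \<Longrightarrow> a \<in> S \<or> a \<in> E \<or> a \<in> X"
    and slit: "\<And>a b c. a \<in> X \<Longrightarrow> b \<in> cls c a \<Longrightarrow> b \<noteq> a \<Longrightarrow> b \<in> S"
  shows "cut_pieces \<Gamma> E (region l UNIV) = range (\<lambda>i. region l {j. equivclp (adjacent S) i j})"
  unfolding cut_pieces_def region_def[of l "{j. equivclp (adjacent S) _ j}"]
proof (rule components_by_pieces[where I = "\<lambda>i. interior (T (i, l i))"])
  let ?H = "region l UNIV"
  let ?U = "interior ?H - edge_set_lift \<Gamma> E"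
  have int0: "interior (T y) \<inter> edge_set_lift \<Gamma> E = {}" for y
    using interior_not_edge[of _ y] by (auto simp: mem_edge_set_lift)
  have eq: "equivp (\<lambda>y y'. equivclp (adjacent S) (fst y) (fst y'))"
    by (rule equivp_vimage) (rule equivp_evquivclp)
  have S_rel: "equivclp (adjacent S) (fst (Hd x)) (fst (Tl x))" if "fst x \<in> S" for x
    by (rule r_into_equivclp) (use that in \<open>auto simp: adjacent_def\<close>)
  \<comment> \<open>An edge through an interior point has both adjacent tiles in the region, so its
    displacement is the difference of the values of \<open>l\<close>.\<close>
  have inner': "fst x \<in> S \<or> fst x \<in> X" if x: "z \<in> Ec x" "z \<in> ?U" for x z
  proof -
    have "z \<in> T (Hd x)" "z \<in> T (Tl x)" using x(1) head_lift(1) tail_lift(1) by blast+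
    then have "snd (Hd x) = l (head \<Gamma> (fst x))" "snd (Tl x) = l (tail \<Gamma> (fst x))"
      using tile_meets_interior_region[of z l UNIV] x(2) by fastforce+
    then have "dsp (fst x) = l (head \<Gamma> (fst x)) - l (tail \<Gamma> (fst x))" using dsp_lift[of x] by simp
    moreover have "fst x \<notin> E" using x by (auto simp: mem_edge_set_lift)
    ultimately show ?thesis using inner by blast
  qed
  have slit_node: "equivclp (adjacent S) (fst y) (fst y')"
    if "fst x0 \<in> X" "n \<in> T y" "n \<in> T y'" "nd c x0 = n" for x0 n c y y'
  proof (rule tiles_around_node[OF eq, where ?x0.0 = x0 and n = n and c = c])
    show "equivclp (adjacent S) (fst (Hd x)) (fst (Tl x))" if x: "nd c x = n" "x \<noteq> x0" for x
    proof (rule S_rel, rule slit[OF \<open>fst x0 \<in> X\<close>])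
      show "fst x \<in> cls c (fst x0)" using nd_cls[of c x x0] x \<open>nd c x0 = n\<close> by simp
      show "fst x \<noteq> fst x0"
      proof
        assume "fst x = fst x0"
        then have "x = mv (snd x - snd x0) x0" by (cases x; cases x0) (simp add: mv_def)
        then have "shift (snd x - snd x0) + nd c x0 = nd c x" by (metis nd_mv)
        then have "shift (snd x - snd x0) = shift 0" using x \<open>nd c x0 = n\<close> by simp
        then have "snd x = snd x0" unfolding shift_eq_iff by simp
        then show False using \<open>fst x = fst x0\<close> x(2) by (cases x; cases x0) simp
      qed
    qed
  qed (use that in auto)
  fix i
  show "closed (T (i, l i))" by (rule closed_T)
  show "interior (T (i, l i)) \<noteq> {}" by (rule interior_T_nonempty)
  show int_U: "interior (T (i, l i)) \<subseteq> ?U"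
    using int0[of "(i, l i)"] interior_mono[of "T (i, l i)" ?H] by (auto simp: region_def)
  show "interior (T (i, l i)) \<subseteq> T (i, l i)" by (rule interior_subset)
  show "T (i, l i) \<subseteq> closure (interior (T (i, l i)))" by (simp add: closure_interior_T)
  show "?U \<subseteq> (\<Union>i. T (i, l i))" using interior_subset[of ?H] unfolding region_def by blast
  show "connected (insert z (interior (T (i, l i))))" if "z \<in> T (i, l i)" for z
    using that by (rule insert_interior_connected)
  fix j
  show "equivclp (adjacent S) i j" if z: "z \<in> ?U" "z \<in> T (i, l i)" "z \<in> T (j, l j)" for z
  proof (cases rule: cell_cases[of z])
    case 1
    then obtain c x1 where x1: "nd c x1 = z" using nodes_nd by blast
    show ?thesis
    proof (cases "\<exists>x. nd c x = z \<and> fst x \<in> X")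
      case True
      then show ?thesis using slit_node[OF _ z(2,3)] by auto
    next
      case False
      have "equivclp (adjacent S) (fst (i, l i)) (fst (j, l j))"
      proof (rule tiles_around_node[OF eq _ x1 z(2,3)])
        show "equivclp (adjacent S) (fst (Hd x)) (fst (Tl x))" if "nd c x = z" for x
          using inner'[of z x] nd_in_edge[of c x] z(1) that False S_rel by blast
      qed
      then show ?thesis by simp
    qed
  next
    case (2 x)
    have ij: "(i, l i) = Hd x \<or> (i, l i) = Tl x" "(j, l j) = Hd x \<or> (j, l j) = Tl x"
      using open_edge_in_tile[OF 2] z by blast+
    then have ij': "i = fst (Hd x) \<or> i = fst (Tl x)" "j = fst (Hd x) \<or> j = fst (Tl x)"
      by (metis fst_conv)+
    have "z \<in> Ec x" using 2 by (simp add: edge_lift_eq)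
    then consider "fst x \<in> S" | "fst x \<in> X" using inner' z(1) by blast
    then have "equivclp (adjacent S) (fst (Hd x)) (fst (Tl x))"
    proof cases
      case 2
      \<comment> \<open>The two sides of a slit are joined around its white endnode, which itself
        need not lie in \<open>?U\<close>.\<close>
      show ?thesis
        by (rule slit_node[OF 2, of "nd True x"])
          (use nd_in_edge[of True x] head_lift(1)[of x] tail_lift(1)[of x] in auto)
    qed (rule S_rel)
    then show ?thesis using ij' equivclp_sym[of "adjacent S"] by auto
  next
    case (3 v)
    then have "(i, l i) = (j, l j)" using interior_in_tile z by metis
    then show ?thesis by simp
  qed
  show "\<exists>X. connected X \<and> X \<subseteq> ?U \<and> interior (T (i, l i)) \<subseteq> X \<and> interior (T (j, l j)) \<subseteq> X"
    if "adjacent S i j"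
  proof -
    obtain a where a: "a \<in> S" "i = head \<Gamma> a" "j = tail \<Gamma> a" using \<open>adjacent S i j\<close> by (auto simp: adjacent_def)
    define x where "x = (a, l i - snd (Hd (a, 0)))"
    have "Hd x = (i, l i)" by (subst Hd_eq) (simp add: x_def a)
    moreover have "Tl x = (j, l j)"
      using S(1)[OF a(1)] by (subst Tl_eq) (simp add: x_def a dsp_def algebra_simps)
    ultimately have hx: "Hd x = (i, l i)" "Tl x = (j, l j)" .
    have "Eo x \<inter> edge_set_lift \<Gamma> E = {}"
    proof (rule ccontr)
      assume "Eo x \<inter> edge_set_lift \<Gamma> E \<noteq> {}"
      then obtain z y where "z \<in> Eo x" "fst y \<in> E" "z \<in> Ec y" by (auto simp: mem_edge_set_lift)
      then have "y = x" using edge_open_edge by blast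
      then show False using a S(2) \<open>fst y \<in> E\<close> by (auto simp: x_def)
    qed
    then have "Eo x \<subseteq> ?U" using edge_in_interior_region[OF hx] by blast
    moreover have "interior (T (k, l k)) \<subseteq> ?U" for k
      using int0[of "(k, l k)"] interior_mono[of "T (k, l k)" ?H] by (auto simp: region_def)
    ultimately have "interior (T (Hd x)) \<union> Eo x \<union> interior (T (Tl x)) \<subseteq> ?U" by (simp add: hx)
    moreover have "connected (interior (T (Hd x)) \<union> Eo x \<union> interior (T (Tl x)))"
      by (rule across_edge_connected)
    ultimately show ?thesis unfolding hx by blast
  qed
qed


section \<open>Weights modulo coboundaries\<close>

definition delta :: "('v \<Rightarrow> real) \<Rightarrow> real ^ 'e"
  where "delta f = (\<chi> a. f (head \<Gamma> a) - f (tail \<Gamma> a))"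

definition csum :: "bool \<Rightarrow> 'e \<Rightarrow> real ^ 'e \<Rightarrow> real"
  where "csum c a x = (\<Sum>b\<in>cls c a. x $ b)"

text \<open>Adding the weight of \<open>a\<close> to both sides turns the relation at
  \<open>a\<close> into equality of the sums at its two endnodes.\<close>

definition weights :: "(real ^ 'e) set"
  where "weights = {x. \<forall>a. csum True a x = csum False a x}"

text \<open>The arrows at a node form an oriented cycle around its dual face, so these are the real
  1-cocycles of the dual cell structure of the torus.\<close>

definition flat :: "(real ^ 'e) set"
  where "flat = {x. \<forall>c a. csum c a x = 0}"

definition vanishing :: "'e set \<Rightarrow> (real ^ 'e) set"
  where "vanishing S = {x. \<forall>a\<in>S. x $ a = 0}"

text \<open>The cocycle obtained by pairing the displacement with \<open>m\<close>; these represent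
  the first cohomology of the torus.\<close>

definition dsp_weight :: "real \<times> real \<Rightarrow> real ^ 'e"
  where "dsp_weight m = (\<chi> a. fst m * of_int (fst (dsp a)) + snd m * of_int (snd (dsp a)))"

lemma coboundaries_eq: "coboundaries \<Gamma> = range delta"
  by (auto simp: coboundaries_def delta_def)

lemma delta_simps: "delta f $ a = f (head \<Gamma> a) - f (tail \<Gamma> a)" "delta (\<lambda>i. f i + g i) = delta f + delta g"
  "delta (\<lambda>i. f i - g i) = delta f - delta g" "delta (\<lambda>i. c * f i) = c *\<^sub>R delta f" "delta (\<lambda>i. c) = 0"
  by (simp_all add: delta_def vec_eq_iff algebra_simps)

lemma csum_linear: "csum c a (x + y) = csum c a x + csum c a y" "csum c a (r *\<^sub>R x) = r * csum c a x"
  "csum c a (x - y) = csum c a x - csum c a y" "csum c a 0 = 0"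
  by (simp_all add: csum_def sum.distrib sum_distrib_left sum_subtractf)

lemma csum_delta: "csum c a (delta f) = 0"
  using cls_sum_coboundary[of f c a] by (simp add: csum_def delta_def)

lemma csum_dsp_weight: "csum c a (dsp_weight m) = 0"
proof -
  have "csum c a (dsp_weight m) = fst m * of_int (fst (\<Sum>b\<in>cls c a. dsp b)) + snd m * of_int (snd (\<Sum>b\<in>cls c a. dsp b))"
    by (simp add: csum_def dsp_weight_def sum.distrib sum_distrib_left fst_sum snd_sum)
  then show ?thesis by (simp add: cls_sum_dsp)
qed

lemma subspace_coboundaries: "subspace (coboundaries \<Gamma>)"
  unfolding coboundaries_eq subspace_def
  by (auto simp: delta_simps(2,4)[symmetric] intro: range_eqI[of _ _ "\<lambda>i. 0"] simp: delta_simps(5)[of 0])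

lemma subspace_weights: "subspace weights" and subspace_flat: "subspace flat"
  and subspace_vanishing: "subspace (vanishing S)"
  by (auto simp: subspace_def weights_def flat_def vanishing_def csum_linear)

lemma flat_weights: "flat \<subseteq> weights"
  by (auto simp: flat_def weights_def)

lemma coboundaries_flat: "coboundaries \<Gamma> \<subseteq> flat"
  by (auto simp: coboundaries_eq flat_def csum_delta)

lemma csum_cls: "b \<in> cls c a \<Longrightarrow> csum c b x = csum c a x"
  by (simp add: csum_def cls_eq)

text \<open>The sum agrees at the two endnodes of every edge, and the graph of nodes is
  connected.\<close>

lemma weights_degree:
  assumes "x \<in> weights" shows "csum c a x = csum c' b x"
proof -
  have "csum True a x = csum True b x" for a b
  proof (rule cls_connected[where F = "\<lambda>a. csum True a x"])
    fix a b c assume "b \<in> cls c a"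
    then show "csum True b x = csum True a x"
      using assms csum_cls[of b c a x] by (cases c) (auto simp: weights_def)
  qed
  then show ?thesis using assms by (cases c; cases c') (auto simp: weights_def)
qed

lemma quiver_const:
  fixes f :: "'v \<Rightarrow> 'a"
  assumes "\<And>a. f (head \<Gamma> a) = f (tail \<Gamma> a)" shows "f i = f j"
  using assms by (rule quiver_connected[OF equivp_vimage[OF identity_equivp]])

text \<open>Potentials normalised to vanish at \<open>i0\<close> embed into the coboundaries, since
  on a connected quiver only constants have zero coboundary.\<close>

lemma card_tiles_le: "CARD('v) \<le> dim (coboundaries \<Gamma>) + 1"
proof -
  fix i0 :: 'v
  let ?H = "{x :: real ^ 'v. axis i0 1 \<bullet> x = 0}"
  let ?d = "\<lambda>x :: real ^ 'v. delta (($) x)"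
  have lin: "linear ?d"
    by (rule linearI) (simp_all add: delta_def vec_eq_iff algebra_simps)
  have sub: "subspace ?H" by (rule subspace_hyperplane)
  have "inj_on ?d ?H"
  proof (rule inj_onI)
    fix x y assume xy: "x \<in> ?H" "y \<in> ?H" "?d x = ?d y"
    have "x $ i - y $ i = x $ i0 - y $ i0" for i
    proof (rule quiver_const[where f = "\<lambda>i. x $ i - y $ i"])
      fix a
      show "x $ head \<Gamma> a - y $ head \<Gamma> a = x $ tail \<Gamma> a - y $ tail \<Gamma> a"
        using arg_cong[OF xy(3), of "\<lambda>w. w $ a"] by (simp add: delta_def)
    qed
    then show "x = y" using xy(1,2) by (simp add: vec_eq_iff inner_axis')
  qed
  moreover have "span ?H = ?H" using sub by (simp only: span_eq_iff)
  ultimately have "dim (?d ` ?H) = dim ?H"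
    using dim_image_eq[OF lin, of ?H] by (simp only:)
  moreover have "dim ?H = CARD('v) - 1" using dim_hyperplane[of "axis i0 1 :: real ^ 'v"] by simp
  moreover have "dim (?d ` ?H) \<le> dim (coboundaries \<Gamma>)"
    by (rule dim_subset) (auto simp: coboundaries_eq)
  ultimately show ?thesis by linarith
qed

text \<open>Cocycles are orthogonal to the indicator vectors of the nodes, and these are independent
  once one node is omitted. With W, B, E, V the numbers of white and black nodes, edges and tiles,
  this bounds the dimension by E - W - B + 1, hence by V + 1 and by the dimension of the
  coboundaries plus 2.\<close>

lemma dim_flat_le: "dim flat \<le> dim (coboundaries \<Gamma>) + 2"
proof -
  define W where "W = range (cls True)"
  fix a0 :: 'e
  \<comment> \<open>One black node is left out because the white indicators and the black indicators
    have the same sum.\<close>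
  define B where "B = range (cls False) - {cls False a0}"
  define iv where "iv = (\<lambda>X :: 'e set. (\<chi> a. if a \<in> X then 1 else 0) :: real ^ 'e)"
  \<comment> \<open>Nodes are encoded as sets of arrows; a white and a black node with the same
    arrows would be a whole component of the graph and hence contain \<open>a0\<close>.\<close>
  have WB: "W \<inter> B = {}"
  proof (rule ccontr)
    assume "W \<inter> B \<noteq> {}"
    then obtain a b where ab: "cls True a = cls False b" "cls False b \<noteq> cls False a0" by (auto simp: W_def B_def)
    have "(d \<in> cls False b) = (a0 \<in> cls False b)" for d
    proof (rule cls_connected[where F = "\<lambda>d. d \<in> cls False b"])
      fix d d' c assume "d' \<in> cls c d"
      then have "cls c d' = cls c d" by (rule cls_eq)
      moreover have "d \<in> cls c d" "d' \<in> cls c d'" by simp_all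
      ultimately show "(d' \<in> cls False b) = (d \<in> cls False b)"
        using cls_eq[of d True a] cls_eq[of d' True a] cls_eq[of d False b] cls_eq[of d' False b] ab(1)
        by (cases c) (metis (full_types))+
    qed
    then have "a0 \<in> cls False b" using cls_refl by blast
    then show False using cls_eq ab(2) by blast
  qed
  have inj: "inj iv"
  proof (rule injI)
    fix X Y assume eq: "iv X = iv Y"
    have "a \<in> X \<longleftrightarrow> a \<in> Y" for a
      using arg_cong[OF eq, of "\<lambda>x. x $ a"] by (simp add: iv_def split: if_splits)
    then show "X = Y" by blast
  qed
  have "independent (iv ` (W \<union> B))"
  proof (rule independent_if_scalars_zero)
    show "finite (iv ` (W \<union> B))" by simp
    fix f x assume z: "(\<Sum>x\<in>iv ` (W \<union> B). f x *\<^sub>R x) = 0" and x: "x \<in> iv ` (W \<union> B)"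
    define u where "u = (\<lambda>X. f (iv X))"
    have "(\<Sum>x\<in>iv ` (W \<union> B). f x *\<^sub>R x) = (\<Sum>X\<in>W \<union> B. u X *\<^sub>R iv X)"
      by (subst sum.reindex) (auto intro: inj_on_subset[OF inj] simp: u_def)
    then have "(\<Sum>X\<in>W. u X *\<^sub>R iv X) + (\<Sum>X\<in>B. u X *\<^sub>R iv X) = 0"
      using z WB by (simp add: sum.union_disjoint)
    then have "((\<Sum>X\<in>W. u X *\<^sub>R iv X) + (\<Sum>X\<in>B. u X *\<^sub>R iv X)) $ a = 0" for a by simp
    then have z': "(\<Sum>X\<in>W. if a \<in> X then u X else 0) + (\<Sum>X\<in>B. if a \<in> X then u X else 0) = 0" for a
      by (simp add: iv_def if_distrib cong: if_cong)
    have "{X \<in> W. a \<in> X} = {cls True a}" for a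
      unfolding W_def using cls_eq[of a True] by auto
    then have sW: "(\<Sum>X\<in>W. if a \<in> X then u X else 0) = u (cls True a)" for a
      by (simp add: sum.If_cases Int_def conj_commute)
    have "{X \<in> B. a \<in> X} = (if cls False a = cls False a0 then {} else {cls False a})" for a
      unfolding B_def using cls_eq[of a False] by auto
    then have sB: "(\<Sum>X\<in>B. if a \<in> X then u X else 0) = (if cls False a = cls False a0 then 0 else u (cls False a))" for a
      by (simp add: sum.If_cases Int_def conj_commute)
    have eq: "u (cls True a) = - (if cls False a = cls False a0 then 0 else u (cls False a))" for a
      using z'[of a] sW[of a] sB[of a] by linarith
    \<comment> \<open>At each arrow the white and the black coefficient are opposite, so by
      connectedness the white one is the same everywhere; at the omitted node it is 0.\<close>
    have "u (cls True a) = u (cls True a0)" for a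
    proof (rule cls_connected[where F = "\<lambda>a. u (cls True a)"])
      fix d d' c assume "d' \<in> cls c d"
      then have "cls c d' = cls c d" by (rule cls_eq)
      then show "u (cls True d') = u (cls True d)" using eq[of d] eq[of d'] by (cases c) auto
    qed
    then have uW: "u (cls True a) = 0" for a using eq[of a0] by simp
    obtain X where X: "X \<in> W \<union> B" "x = iv X" using x by blast
    have "u X = 0"
    proof (cases "X \<in> W")
      case True
      then show ?thesis using uW by (auto simp: W_def)
    next
      case False
      then obtain a where "X = cls False a" "cls False a \<noteq> cls False a0" using X(1) by (auto simp: B_def)
      then show ?thesis using eq[of a] uW[of a] by simp
    qed
    then show "f x = 0" by (simp add: u_def X(2))
  qed
  then have "dim (span (iv ` (W \<union> B))) = card (iv ` (W \<union> B))" by (simp add: dim_eq_card_independent)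
  also have "\<dots> = card (W \<union> B)" by (rule card_image) (rule inj_on_subset[OF inj], simp)
  also have "\<dots> = card W + card B" using WB by (simp add: card_Un_disjoint)
  also have "card B = card (range (cls False)) - 1" by (simp add: B_def)
  finally have d: "dim (span (iv ` (W \<union> B))) = card (range (cls True)) + (card (range (cls False)) - 1)"
    by (simp add: W_def)
  have "card (range (cls False)) > 0" by (simp add: card_gt_0_iff)
  then have d': "dim (span (iv ` (W \<union> B))) + 1 = card (range (cls True)) + card (range (cls False))"
    using d by linarith
  have "flat \<subseteq> {y \<in> UNIV. \<forall>x\<in>span (iv ` (W \<union> B)). orthogonal x y}"
  proof
    fix y assume y: "y \<in> flat"
    have "orthogonal y x" if "x \<in> iv ` (W \<union> B)" for x
    proof -
      obtain X where X: "x = iv X" "X \<in> W \<union> B" using \<open>x \<in> iv ` (W \<union> B)\<close> by blast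
      then obtain c a where "X = cls c a" by (auto simp: W_def B_def)
      have "y \<bullet> x = (\<Sum>b\<in>UNIV. if b \<in> X then y $ b else 0)"
        by (simp add: X inner_vec_def iv_def if_distrib cong: if_cong)
      also have "\<dots> = csum c a y" by (simp add: csum_def \<open>X = cls c a\<close> sum.If_cases)
      finally show ?thesis using y by (simp add: orthogonal_def flat_def)
    qed
    then have "\<forall>x\<in>span (iv ` (W \<union> B)). orthogonal y x" using orthogonal_to_span by blast
    then show "y \<in> {y \<in> UNIV. \<forall>x\<in>span (iv ` (W \<union> B)). orthogonal x y}"
      by (simp add: orthogonal_commute)
  qed
  then have "dim flat \<le> dim {y \<in> UNIV. \<forall>x\<in>span (iv ` (W \<union> B)). orthogonal x y}" by (rule dim_subset)
  moreover have "dim {y \<in> UNIV. \<forall>x\<in>span (iv ` (W \<union> B)). orthogonal x y} + dim (span (iv ` (W \<union> B))) = CARD('e)"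
    using dim_subspace_orthogonal_to_vectors[OF subspace_span subspace_UNIV, of "iv ` (W \<union> B)"] by simp
  ultimately show ?thesis using euler_inequality card_tiles_le d' by linarith
qed

text \<open>On the plane the displacement has the deck coordinate as potential. Its difference from
  a periodic potential is constant by connectedness, and comparing translates of one tile gives
  \<open>m = 0\<close>.\<close>

lemma dsp_weight_coboundary:
  assumes "dsp_weight m \<in> coboundaries \<Gamma>" shows "m = 0"
proof -
  obtain f where f: "dsp_weight m = delta f" using assms by (auto simp: coboundaries_eq)
  define g where "g = (\<lambda>y :: 'v lifted. fst m * of_int (fst (snd y)) + snd m * of_int (snd (snd y)) - f (fst y))"
  have "g (Hd x) = g (Tl x)" for x
  proof -
    have "dsp_weight m $ fst x = delta f $ fst x" by (simp add: f)
    moreover have "snd (Hd x) = snd (Tl x) + dsp (fst x)" using dsp_lift[of x] by (simp add: algebra_simps)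
    ultimately show ?thesis by (simp add: g_def dsp_weight_def delta_def algebra_simps)
  qed
  then have g: "g y = g y'" for y y'
    by (rule dual_connected[OF equivp_vimage[OF identity_equivp]])
  fix i :: 'v
  have "g (i, (1, 0)) = g (i, (0, 0))" "g (i, (0, 1)) = g (i, (0, 0))" using g by blast+
  then show ?thesis by (simp add: g_def prod_eq_iff)
qed

lemma linear_dsp_weight: "linear dsp_weight"
  by (rule linearI) (simp_all add: dsp_weight_def vec_eq_iff algebra_simps)

text \<open>The first cohomology of the torus; Euler's formula supplies the upper bound for the dimension.\<close>

lemma flat_eq: "flat = {x + y |x y. x \<in> range dsp_weight \<and> y \<in> coboundaries \<Gamma>}"
proof (rule sym, rule subspace_dim_equal)
  let ?U = "range dsp_weight"
  have U: "subspace ?U" by (rule linear_subspace_image[OF linear_dsp_weight subspace_UNIV])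
  show "subspace {x + y |x y. x \<in> ?U \<and> y \<in> coboundaries \<Gamma>}" by (rule subspace_sums[OF U subspace_coboundaries])
  show "subspace flat" by (rule subspace_flat)
  have "?U \<subseteq> flat" by (auto simp: flat_def csum_dsp_weight)
  then show "{x + y |x y. x \<in> ?U \<and> y \<in> coboundaries \<Gamma>} \<subseteq> flat"
    using coboundaries_flat subspace_add[OF subspace_flat] by blast
  have lin0: "dsp_weight 0 = 0" using linear_0[OF linear_dsp_weight] .
  have "?U \<inter> coboundaries \<Gamma> = {0}"
    using dsp_weight_coboundary lin0 subspace_0[OF subspace_coboundaries] by force
  then have "dim {x + y |x y. x \<in> ?U \<and> y \<in> coboundaries \<Gamma>} = dim ?U + dim (coboundaries \<Gamma>)"
    using dim_sums_Int[OF U subspace_coboundaries] by simp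
  moreover have "inj dsp_weight"
    unfolding linear_injective_0[OF linear_dsp_weight]
    using dsp_weight_coboundary subspace_0[OF subspace_coboundaries] by metis
  then have "dim ?U = 2" using dim_image_eq[OF linear_dsp_weight, of UNIV] by simp
  ultimately show "dim flat \<le> dim {x + y |x y. x \<in> ?U \<and> y \<in> coboundaries \<Gamma>}"
    using dim_flat_le by simp
qed

text \<open>On the arrows lying in the region given by \<open>l\<close>, the function
  \<open>l\<close> itself is a potential for the displacement, so every cohomology class becomes
  trivial there.\<close>

lemma flat_exact:
  assumes "x \<in> flat"
  shows "\<exists>g. \<forall>a. dsp a = l (head \<Gamma> a) - l (tail \<Gamma> a) \<longrightarrow> x $ a = g (head \<Gamma> a) - g (tail \<Gamma> a)"
proof -
  obtain m f where x: "x = dsp_weight m + delta f" using assms by (auto simp: flat_eq coboundaries_eq)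
  show ?thesis
    proof (intro exI allI impI)
    fix a assume "dsp a = l (head \<Gamma> a) - l (tail \<Gamma> a)"
    then have "l (head \<Gamma> a) = dsp a + l (tail \<Gamma> a)" by simp
    then show "x $ a = (fst m * of_int (fst (l (head \<Gamma> a))) + snd m * of_int (snd (l (head \<Gamma> a))) + f (head \<Gamma> a))
      - (fst m * of_int (fst (l (tail \<Gamma> a))) + snd m * of_int (snd (l (tail \<Gamma> a))) + f (tail \<Gamma> a))"
      by (simp add: x dsp_weight_def delta_def algebra_simps)
  qed
qed

section \<open>Connecting arrow sets and lifts to the plane\<close>

definition spans :: "'e set \<Rightarrow> bool"
  where "spans S \<longleftrightarrow> (\<forall>I. (\<forall>a\<in>S. head \<Gamma> a \<in> I \<longleftrightarrow> tail \<Gamma> a \<in> I) \<longrightarrow> I = {} \<or> I = UNIV)"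

lemma spans_const:
  assumes "spans S" "\<And>a. a \<in> S \<Longrightarrow> f (head \<Gamma> a) = f (tail \<Gamma> a)" shows "f i = f j"
proof -
  have "{k. f k = f i} = {} \<or> {k. f k = f i} = UNIV"
    using assms unfolding spans_def by (metis (mono_tags, lifting) mem_Collect_eq)
  then show ?thesis by (metis (mono_tags) UNIV_I empty_iff mem_Collect_eq)
qed

lemma spans_induct:
  assumes "spans S" "P i0" "\<And>a. a \<in> S \<Longrightarrow> P (tail \<Gamma> a) \<Longrightarrow> P (head \<Gamma> a)"
    "\<And>a. a \<in> S \<Longrightarrow> P (head \<Gamma> a) \<Longrightarrow> P (tail \<Gamma> a)"
  shows "P i"
proof -
  have "{k. P k} = {} \<or> {k. P k} = UNIV"
    using assms(1,3,4) unfolding spans_def by (metis (mono_tags, lifting) mem_Collect_eq)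
  then show ?thesis using assms(2) by blast
qed

text \<open>The vector \<open>c i\<close> counts, with signs, the arrows of a walk in
  \<open>S\<close> from \<open>i0\<close> to \<open>i\<close>; pairing it with a coboundary
  telescopes.\<close>

lemma path_functional:
  assumes "spans S"
  obtains c :: "'v \<Rightarrow> 'e \<Rightarrow> int" where "\<And>i a. a \<notin> S \<Longrightarrow> c i a = 0"
    "\<And>i f. (\<Sum>a\<in>UNIV. of_int (c i a) * (f (head \<Gamma> a) - f (tail \<Gamma> a))) = (f i - f i0 :: real)"
proof -
  define P where "P = (\<lambda>i (c :: 'e \<Rightarrow> int). (\<forall>a. a \<notin> S \<longrightarrow> c a = 0) \<and>
    (\<forall>f. (\<Sum>a\<in>UNIV. of_int (c a) * (f (head \<Gamma> a) - f (tail \<Gamma> a))) = f i - (f i0 :: real)))"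
  have upd: "(\<Sum>b\<in>UNIV. of_int (c b + (if b = a then s else 0)) * h b) =
      (\<Sum>b\<in>UNIV. of_int (c b) * h b) + of_int s * h a" for c :: "'e \<Rightarrow> int" and s a and h :: "'e \<Rightarrow> real"
    by (simp add: distrib_right sum.distrib if_distrib[of of_int] if_distrib[of "\<lambda>x. x * _"] cong: if_cong)
  have "\<exists>c. P i c" for i
  proof (rule spans_induct[OF assms, of "\<lambda>i. \<exists>c. P i c" i0])
    show "\<exists>c. P i0 c" by (rule exI[of _ "\<lambda>a. 0"]) (simp add: P_def)
    fix a assume a: "a \<in> S"
    show "\<exists>c. P (head \<Gamma> a) c" if "\<exists>c. P (tail \<Gamma> a) c"
    proof -
      obtain c where c: "P (tail \<Gamma> a) c" using \<open>\<exists>c. P (tail \<Gamma> a) c\<close> ..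
      then have "P (head \<Gamma> a) (\<lambda>b. c b + (if b = a then 1 else 0))"
        unfolding P_def upd using a by auto
      then show ?thesis by (rule exI[of "P _"])
    qed
    show "\<exists>c. P (tail \<Gamma> a) c" if "\<exists>c. P (head \<Gamma> a) c"
    proof -
      obtain c where c: "P (head \<Gamma> a) c" using \<open>\<exists>c. P (head \<Gamma> a) c\<close> ..
      then have "P (tail \<Gamma> a) (\<lambda>b. c b + (if b = a then -1 else 0))"
        unfolding P_def upd using a by auto
      then show ?thesis by (rule exI[of "P _"])
    qed
  qed
  then obtain c where "\<And>i. P i (c i)" by metis
  then show ?thesis using that[of c] unfolding P_def by blast
qed

lemma vanishing_coboundary:
  assumes "spans S" "x \<in> vanishing S" "x \<in> coboundaries \<Gamma>" shows "x = 0"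
proof -
  obtain f where f: "x = delta f" using assms(3) by (auto simp: coboundaries_eq)
  have "f i = f j" for i j
    by (rule spans_const[OF assms(1)]) (use assms(2) in \<open>auto simp: f vanishing_def delta_def\<close>)
  then have "f (head \<Gamma> a) = f (tail \<Gamma> a)" for a .
  then have "delta f $ a = 0" for a by (simp add: delta_def)
  then show ?thesis by (simp add: f vec_eq_iff)
qed

text \<open>
  If the weights vanishing on \<open>S\<close> have the maximal dimension 3, every closed walk in \<open>S\<close> is
  homologically trivial, so the quiver with arrows \<open>S\<close> lifts to the plane.
\<close>

lemma lift_exists:
  assumes S: "spans S" and d: "dim (weights \<inter> vanishing S) \<ge> 3"
  obtains l where "\<And>a. a \<in> S \<Longrightarrow> dsp a = l (head \<Gamma> a) - l (tail \<Gamma> a)"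
proof -
  fix a0 :: 'e and i0 :: 'v
  \<comment> \<open>The normal vector whose inner product with a weight is its sum at one white
    node; on \<open>weights\<close> this is the common sum at all nodes.\<close>
  define n :: "real ^ 'e" where "n = (\<chi> a. if a \<in> cls True a0 then 1 else 0)"
  have n: "n \<bullet> x = csum True a0 x" for x
    by (simp add: inner_vec_def n_def csum_def if_distrib[of "\<lambda>c. c * _"] sum.If_cases cong: if_cong)
  have "n $ a0 = 1" by (simp add: n_def)
  then have "n \<noteq> 0" by (metis zero_index zero_neq_one)
  then have dH: "dim {x. n \<bullet> x = 0} + 1 = CARD('e)"
    using dim_hyperplane[of n] by (simp add: Suc_leI)
  have KS: "flat \<inter> vanishing S = (weights \<inter> vanishing S) \<inter> {x. n \<bullet> x = 0}"
  proof -
    have "x \<in> flat \<longleftrightarrow> x \<in> weights \<and> csum True a0 x = 0" for x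
    proof
      assume "x \<in> weights \<and> csum True a0 x = 0"
      then have "csum c a x = 0" for c a using weights_degree[of x c a True a0] by simp
      then show "x \<in> flat" by (simp add: flat_def)
    qed (use flat_weights in \<open>auto simp: flat_def\<close>)
    then show ?thesis by (auto simp: n)
  qed
  have WS: "subspace (weights \<inter> vanishing S)" using subspace_weights subspace_vanishing by (rule subspace_inter)
  have H: "subspace {x. n \<bullet> x = 0}" by (rule subspace_hyperplane)
  have KSs: "subspace (flat \<inter> vanishing S)" unfolding KS using WS H by (rule subspace_inter)
  have "dim {x + y |x y. x \<in> weights \<inter> vanishing S \<and> y \<in> {x. n \<bullet> x = 0}} \<le> CARD('e)"
    using dim_subset_UNIV[of "{x + y |x y. x \<in> weights \<inter> vanishing S \<and> y \<in> {x. n \<bullet> x = 0}}"] by simp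
  then have dKS: "dim (flat \<inter> vanishing S) \<ge> 2"
    using dim_sums_Int[OF WS H] dH d unfolding KS by linarith
  have z: "(flat \<inter> vanishing S) \<inter> coboundaries \<Gamma> = {0}"
    using vanishing_coboundary[OF S] subspace_0[OF KSs] subspace_0[OF subspace_coboundaries] by blast
  have "{x + y |x y. x \<in> flat \<inter> vanishing S \<and> y \<in> coboundaries \<Gamma>} = flat"
  proof (rule subspace_dim_equal)
    show "subspace {x + y |x y. x \<in> flat \<inter> vanishing S \<and> y \<in> coboundaries \<Gamma>}"
      by (rule subspace_sums[OF KSs subspace_coboundaries])
    show "subspace flat" by (rule subspace_flat)
    show "{x + y |x y. x \<in> flat \<inter> vanishing S \<and> y \<in> coboundaries \<Gamma>} \<subseteq> flat"
      using coboundaries_flat subspace_add[OF subspace_flat] by blast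
    show "dim flat \<le> dim {x + y |x y. x \<in> flat \<inter> vanishing S \<and> y \<in> coboundaries \<Gamma>}"
      using dim_sums_Int[OF KSs subspace_coboundaries] z dKS dim_flat_le by simp
  qed
  then have ex: "\<exists>f. \<forall>a\<in>S. dsp_weight m $ a = f (head \<Gamma> a) - f (tail \<Gamma> a)" for m
  proof -
    assume eq: "{x + y |x y. x \<in> flat \<inter> vanishing S \<and> y \<in> coboundaries \<Gamma>} = flat"
    have "dsp_weight m \<in> {x + y |x y. x \<in> flat \<inter> vanishing S \<and> y \<in> coboundaries \<Gamma>}"
      unfolding eq by (simp add: flat_def csum_dsp_weight)
    then obtain x y where "dsp_weight m = x + y" "x \<in> vanishing S" "y \<in> coboundaries \<Gamma>"
      by blast
    then obtain f where "dsp_weight m = x + delta f" "x \<in> vanishing S"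
      unfolding coboundaries_eq by blast
    then show ?thesis by (intro exI[of _ f]) (simp add: vanishing_def delta_def)
  qed
  obtain f1 :: "'v \<Rightarrow> real" where f1: "\<And>a. a \<in> S \<Longrightarrow> of_int (fst (dsp a)) = f1 (head \<Gamma> a) - f1 (tail \<Gamma> a)"
    using ex[of "(1, 0)"] by (auto simp: dsp_weight_def)
  obtain f2 :: "'v \<Rightarrow> real" where f2: "\<And>a. a \<in> S \<Longrightarrow> of_int (snd (dsp a)) = f2 (head \<Gamma> a) - f2 (tail \<Gamma> a)"
    using ex[of "(0, 1)"] by (auto simp: dsp_weight_def)
  \<comment> \<open>The potentials come from linear algebra and are real, but they change by
    integers along \<open>S\<close>, which connects all vertices.\<close>
  have int: "\<exists>k::int. f i - f i0 = of_int k"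
    if f: "\<And>a. a \<in> S \<Longrightarrow> of_int (d a) = f (head \<Gamma> a) - f (tail \<Gamma> a)" for f :: "'v \<Rightarrow> real" and d i
  proof (rule spans_induct[OF S, of "\<lambda>i. \<exists>k::int. f i - f i0 = of_int k" i0])
    show "\<exists>k::int. f i0 - f i0 = of_int k" by (rule exI[of _ 0]) simp
    fix a assume a: "a \<in> S"
    show "\<exists>k::int. f (head \<Gamma> a) - f i0 = of_int k" if "\<exists>k::int. f (tail \<Gamma> a) - f i0 = of_int k"
    proof -
      obtain k :: int where "f (tail \<Gamma> a) - f i0 = of_int k" using \<open>\<exists>k::int. f (tail \<Gamma> a) - f i0 = of_int k\<close> ..
      then show ?thesis using f[OF a] by (intro exI[of _ "k + d a"]) simp
    qed
    show "\<exists>k::int. f (tail \<Gamma> a) - f i0 = of_int k" if "\<exists>k::int. f (head \<Gamma> a) - f i0 = of_int k"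
    proof -
      obtain k :: int where "f (head \<Gamma> a) - f i0 = of_int k" using \<open>\<exists>k::int. f (head \<Gamma> a) - f i0 = of_int k\<close> ..
      then show ?thesis using f[OF a] by (intro exI[of _ "k - d a"]) simp
    qed
  qed
  obtain k1 where k1: "\<And>i. f1 i - f1 i0 = of_int (k1 i)" using int[of "\<lambda>a. fst (dsp a)" f1] f1 by metis
  obtain k2 where k2: "\<And>i. f2 i - f2 i0 = of_int (k2 i)" using int[of "\<lambda>a. snd (dsp a)" f2] f2 by metis
  show ?thesis
  proof (rule that[of "\<lambda>i. (k1 i, k2 i)"])
    fix a assume a: "a \<in> S"
    have "real_of_int (fst (dsp a)) = of_int (k1 (head \<Gamma> a) - k1 (tail \<Gamma> a))"
      using f1[OF a] k1[of "head \<Gamma> a"] k1[of "tail \<Gamma> a"] by simp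
    moreover have "real_of_int (snd (dsp a)) = of_int (k2 (head \<Gamma> a) - k2 (tail \<Gamma> a))"
      using f2[OF a] k2[of "head \<Gamma> a"] k2[of "tail \<Gamma> a"] by simp
    ultimately show "dsp a = (k1 (head \<Gamma> a), k2 (head \<Gamma> a)) - (k1 (tail \<Gamma> a), k2 (tail \<Gamma> a))"
      by (simp only: of_int_eq_iff prod_eq_iff fst_diff snd_diff fst_conv snd_conv)
  qed
qed

end

section \<open>Stability and limits of one-parameter subgroups\<close>

lemma subspace_over_itself:
  fixes W :: "'a::field set"
  assumes "vector_space_over_itself.subspace W"
  shows "W = {0} \<or> W = UNIV"
proof (cases "W = {0}")
  case False
  have "0 \<in> W" using assms by (rule vector_space_over_itself.subspace_0)
  then obtain w where w: "w \<in> W" "w \<noteq> 0" using False by blast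
  have "z \<in> W" for z
    using vector_space_over_itself.subspace_scale[OF assms w(1), of "z / w"] w(2) by simp
  then show ?thesis by blast
qed simp

lemma topspace_quotient_topology: "topspace (quotient_topology X f) = f ` topspace X"
proof
  show "topspace (quotient_topology X f) \<subseteq> f ` topspace X"
    unfolding topspace_def[of "quotient_topology X f"] openin_quotient_topology by blast
  have "{x \<in> topspace X. f x \<in> f ` topspace X} = topspace X" by blast
  then have "openin (quotient_topology X f) (f ` topspace X)"
    unfolding openin_quotient_topology by simp
  then show "f ` topspace X \<subseteq> topspace (quotient_topology X f)" by (rule openin_subset)
qed

lemma power_int_sum:
  fixes t :: "'a::field"
  assumes "t \<noteq> 0" shows "(\<Prod>b\<in>A. t powi w b) = t powi (\<Sum>b\<in>A. w b)"
proof (cases "finite A")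
  case True
  then show ?thesis by (induction A) (use assms in \<open>auto simp: power_int_add\<close>)
qed simp

lemma ln_norm_power_int:
  fixes t :: complex
  assumes "t \<noteq> 0" shows "ln (norm (t powi n)) = of_int n * ln (norm t)"
proof -
  have "norm (t powi n) = norm t powr of_int n"
    using assms by (simp add: norm_power_int powr_real_of_int')
  then show ?thesis using assms by (simp add: ln_powr)
qed

context dimer_geometry
begin

definition supp :: "complex ^ 'e \<Rightarrow> 'e set" where "supp v = {a. v $ a \<noteq> 0}"

definition ind :: "'e set \<Rightarrow> complex ^ 'e" where "ind S = (\<chi> a. if a \<in> S then 1 else 0)"

text \<open>In dimension vector (1,...,1) submodules are vertex sets closed under the nonzero
  arrows, so stability depends on the support only.\<close>

definition stable :: "('v \<Rightarrow> rat) \<Rightarrow> 'e set \<Rightarrow> bool"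
  where "stable \<theta> S \<longleftrightarrow> (\<forall>I. I \<noteq> {} \<longrightarrow> I \<noteq> UNIV \<longrightarrow>
    (\<forall>a\<in>S. tail \<Gamma> a \<in> I \<longrightarrow> head \<Gamma> a \<in> I) \<longrightarrow> (\<Sum>i\<in>I. \<theta> i) > 0)"

definition act :: "('v \<Rightarrow> complex) \<Rightarrow> complex ^ 'e \<Rightarrow> complex ^ 'e"
  where "act g v = (\<chi> a. g (head \<Gamma> a) * v $ a / g (tail \<Gamma> a))"

definition idelta :: "('v \<Rightarrow> int) \<Rightarrow> int ^ 'e"
  where "idelta f = (\<chi> a. f (head \<Gamma> a) - f (tail \<Gamma> a))"

definition rv :: "int ^ 'e \<Rightarrow> real ^ 'e" where "rv u = (\<chi> a. of_int (u $ a))"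

text \<open>The integral weights whose one-parameter subgroup tends to \<open>ind S\<close> without
  any change of basis.\<close>

definition interior_weights :: "'e set \<Rightarrow> (int ^ 'e) set"
  where "interior_weights S = {w \<in> cocharacters \<Gamma>. (\<forall>a. w $ a \<ge> 0) \<and> {a. w $ a = 0} = S}"

lemma supp_ind [simp]: "supp (ind S) = S"
  by (auto simp: supp_def ind_def)

lemma theta_stable_iff: "theta_stable \<Gamma> \<theta> v \<longleftrightarrow> is_module \<Gamma> v \<and> stable \<theta> (supp v)"
proof (intro iffI conjI)
  assume v: "theta_stable \<Gamma> \<theta> v"
  then show "is_module \<Gamma> v" by (simp add: theta_stable_def)
  show "stable \<theta> (supp v)"
    unfolding stable_def
  proof (intro allI impI)
    fix I assume I: "I \<noteq> {}" "I \<noteq> UNIV" "\<forall>a\<in>supp v. tail \<Gamma> a \<in> I \<longrightarrow> head \<Gamma> a \<in> I"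
    define W where "W = (\<lambda>i. if i \<in> I then UNIV else {0 :: complex})"
    have "submodule \<Gamma> v W"
      using I(3) by (auto simp: submodule_def W_def supp_def vector_space_over_itself.subspace_UNIV
          vector_space_over_itself.subspace_single_0)
    moreover have "(UNIV :: complex set) \<noteq> {0}" by (metis UNIV_I singletonD zero_neq_one)
    then have "nonzero_proper W" using I(1,2) unfolding nonzero_proper_def W_def by auto
    ultimately have "theta_dim \<theta> W > 0" using v by (simp add: theta_stable_def)
    moreover have "theta_dim \<theta> W = (\<Sum>i\<in>I. \<theta> i)"
      by (simp add: theta_dim_def W_def if_distrib sum.If_cases cong: if_cong)
    ultimately show "(\<Sum>i\<in>I. \<theta> i) > 0" by simp
  qed
next
  assume v: "is_module \<Gamma> v \<and> stable \<theta> (supp v)"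
  have "theta_dim \<theta> W > 0" if W: "submodule \<Gamma> v W" "nonzero_proper W" for W
  proof -
    have cases: "W i = {0} \<or> W i = UNIV" for i
      using W(1) subspace_over_itself by (auto simp: submodule_def)
    have nz: "(UNIV :: complex set) \<noteq> {0}" by (metis UNIV_I singletonD zero_neq_one)
    define I where "I = {i. W i = UNIV}"
    have "\<exists>i. W i \<noteq> {0}" "\<exists>i. W i \<noteq> UNIV" using W(2) by (simp_all add: nonzero_proper_def)
    then have "I \<noteq> {}" "I \<noteq> UNIV" using cases unfolding I_def by blast+
    moreover have "head \<Gamma> a \<in> I" if a: "a \<in> supp v" "tail \<Gamma> a \<in> I" for a
    proof -
      have "1 \<in> W (tail \<Gamma> a)" using a(2) by (simp add: I_def)
      then have "v $ a * 1 \<in> W (head \<Gamma> a)" using W(1) unfolding submodule_def by blast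
      then show ?thesis using a(1) cases[of "head \<Gamma> a"] by (auto simp: supp_def I_def)
    qed
    ultimately have "(\<Sum>i\<in>I. \<theta> i) > 0" using v by (simp add: stable_def)
    moreover have "\<theta> i * of_nat (vector_space_over_itself.dim (W i)) = (if i \<in> I then \<theta> i else 0)" for i
      using cases[of i] nz by (auto simp: I_def)
    then have "theta_dim \<theta> W = (\<Sum>i\<in>I. \<theta> i)"
      by (simp add: theta_dim_def sum.If_cases)
    ultimately show ?thesis by simp
  qed
  then show "theta_stable \<Gamma> \<theta> v" using v by (simp add: theta_stable_def)
qed

lemma stable_mono: "stable \<theta> S \<Longrightarrow> S \<subseteq> S' \<Longrightarrow> stable \<theta> S'"
  unfolding stable_def by (meson subsetD)

text \<open>
  The superlevel sets of \<open>f\<close> are closed under the arrows \<open>S\<close> and their complements under \<open>S'\<close>, while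
  the values of \<open>\<theta>\<close> on a set and on its complement have sum zero.
\<close>

lemma stable_const:
  fixes f :: "'v \<Rightarrow> 'a::linorder"
  assumes \<theta>: "stability_parameter \<theta>" and S: "stable \<theta> S" "stable \<theta> S'"
    and f: "\<And>a. a \<in> S \<Longrightarrow> f (tail \<Gamma> a) \<le> f (head \<Gamma> a)" "\<And>a. a \<in> S' \<Longrightarrow> f (head \<Gamma> a) \<le> f (tail \<Gamma> a)"
  shows "f i = f j"
proof -
  have False if ij: "f i < f j" for i j
  proof -
    let ?I = "{k. f i < f k}"
    have "(\<Sum>k\<in>?I. \<theta> k) > 0"
      using S(1) ij f(1) unfolding stable_def by (elim allE[of _ ?I]) (force intro: less_le_trans)
    moreover have "(\<Sum>k\<in>-?I. \<theta> k) > 0"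
      using S(2) ij f(2) unfolding stable_def by (elim allE[of _ "-?I"]) (force simp: not_less intro: order_trans)
    moreover have "(\<Sum>k\<in>?I. \<theta> k) + (\<Sum>k\<in>-?I. \<theta> k) = 0"
      using \<theta> sum.union_disjoint[of ?I "-?I" \<theta>] by (simp add: stability_parameter_def)
    ultimately show False by simp
  qed
  then show ?thesis using not_less_iff_gr_or_eq by blast
qed

lemma stable_spans:
  assumes "stability_parameter \<theta>" "stable \<theta> S" shows "spans S"
  unfolding spans_def
proof (intro allI impI)
  fix I assume I: "\<forall>a\<in>S. head \<Gamma> a \<in> I \<longleftrightarrow> tail \<Gamma> a \<in> I"
  \<comment> \<open>Applied to the indicator of \<open>I\<close>, with values in the linear order on
    \<open>bool\<close>.\<close>
  have "(i \<in> I) = (j \<in> I)" for i j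
    by (rule stable_const[OF assms(1,2,2), of "\<lambda>i. i \<in> I"]) (use I in auto)
  then show "I = {} \<or> I = UNIV" by blast
qed

lemma cocharacters_iff: "u \<in> cocharacters \<Gamma> \<longleftrightarrow> (\<forall>a. (\<Sum>b\<in>cls True a. u $ b) = (\<Sum>b\<in>cls False a. u $ b))"
proof -
  have "(\<Sum>b\<in>cls c a. u $ b) = u $ a + (\<Sum>b\<in>cls c a - {a}. u $ b)" for c a
    by (rule sum.remove) auto
  then show ?thesis by (simp add: cocharacters_def plus_path_cls minus_path_cls)
qed

lemma cocharacters_rv: "u \<in> cocharacters \<Gamma> \<longleftrightarrow> rv u \<in> weights"
  unfolding cocharacters_iff weights_def csum_def rv_def by (simp flip: of_int_sum)

lemma rv_simps: "rv (u + w) = rv u + rv w" "rv (u - w) = rv u - rv w" "rv (idelta f) = delta (\<lambda>i. of_int (f i))"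
  "rv u $ a = of_int (u $ a)"
  by (simp_all add: rv_def idelta_def delta_def vec_eq_iff)

lemma delta_weights: "delta f \<in> weights"
  using coboundaries_flat flat_weights by (auto simp: coboundaries_eq)

lemma cocharacters_idelta: "w + idelta f \<in> cocharacters \<Gamma> \<longleftrightarrow> w \<in> cocharacters \<Gamma>"
  unfolding cocharacters_rv rv_simps
  using subspace_add[OF subspace_weights _ delta_weights] subspace_diff[OF subspace_weights _ delta_weights]
  by (metis add_diff_cancel_right')

text \<open>As the weight is nonnegative, a path acts by zero exactly when its total weight is
  positive, and the totals on the two sides of a relation agree.\<close>

lemma is_module_ind:
  assumes "w \<in> interior_weights S" shows "is_module \<Gamma> (ind S)"
proof -
  have w: "w \<in> cocharacters \<Gamma>" "\<And>a. w $ a \<ge> 0" "\<And>a. w $ a = 0 \<longleftrightarrow> a \<in> S"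
    using assms by (auto simp: interior_weights_def)
  have "(\<Prod>b\<in>A. ind S $ b) = (if (\<Sum>b\<in>A. w $ b) = 0 then 1 else 0)" for A :: "'e set"
  proof (cases "A \<subseteq> S")
    case True
    then have "(\<Prod>b\<in>A. ind S $ b) = 1" "(\<Sum>b\<in>A. w $ b) = 0"
      using w(3) by (auto simp: ind_def intro!: prod.neutral sum.neutral)
    then show ?thesis by simp
  next
    case False
    then obtain b where b: "b \<in> A" "b \<notin> S" by blast
    then have "(\<Prod>b\<in>A. ind S $ b) = 0" by (intro prod_zero) (auto simp: ind_def)
    moreover have "(\<Sum>b\<in>A. w $ b) \<noteq> 0"
      using b w by (auto simp: sum_nonneg_eq_0_iff)
    ultimately show ?thesis by simp
  qed
  then show ?thesis using w(1) unfolding is_module_def cocharacters_def by auto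
qed

section \<open>Isomorphism classes and one-parameter limits\<close>

lemma iso_class_act: "iso_class \<Gamma> v = {act g v |g. \<forall>i. g i \<noteq> 0}"
  by (simp add: iso_class_def act_def)

lemma act_act: "act g (act h v) = act (\<lambda>i. g i * h i) v"
  by (simp add: act_def vec_eq_iff mult_ac)

lemma act_one: "act (\<lambda>i. 1) v = v"
  by (simp add: act_def vec_eq_iff)

lemma act_inverse: "\<forall>i. g i \<noteq> 0 \<Longrightarrow> act (\<lambda>i. inverse (g i)) (act g v) = v"
  by (simp add: act_def vec_eq_iff)

lemma iso_class_self: "v \<in> iso_class \<Gamma> v"
  unfolding iso_class_act by (intro CollectI exI[of _ "\<lambda>i. 1"]) (simp add: act_one)

lemma iso_class_eq_act: "\<forall>i. g i \<noteq> 0 \<Longrightarrow> iso_class \<Gamma> (act g v) = iso_class \<Gamma> v"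
proof (intro equalityI subsetI)
  assume g: "\<forall>i. g i \<noteq> 0"
  show "x \<in> iso_class \<Gamma> v" if x: "x \<in> iso_class \<Gamma> (act g v)" for x
  proof -
    obtain h where "\<forall>i. h i \<noteq> 0" "x = act h (act g v)" using x by (auto simp: iso_class_act)
    then show ?thesis unfolding iso_class_act using g by (intro CollectI exI[of _ "\<lambda>i. h i * g i"]) (simp add: act_act)
  qed
  show "x \<in> iso_class \<Gamma> (act g v)" if x: "x \<in> iso_class \<Gamma> v" for x
  proof -
    obtain h where "\<forall>i. h i \<noteq> 0" "x = act h v" using x by (auto simp: iso_class_act)
    moreover have "v = act (\<lambda>i. inverse (g i)) (act g v)" using act_inverse[OF g] by simp
    ultimately have "x = act (\<lambda>i. h i * inverse (g i)) (act g v)" by (metis act_act)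
    then show ?thesis unfolding iso_class_act
      using g \<open>\<forall>i. h i \<noteq> 0\<close> by (intro CollectI exI[of _ "\<lambda>i. h i * inverse (g i)"]) simp
  qed
qed

lemma iso_class_eqD: "iso_class \<Gamma> v = iso_class \<Gamma> v' \<Longrightarrow> \<exists>g. (\<forall>i. g i \<noteq> 0) \<and> v = act g v'"
  using iso_class_self[of v] by (auto simp: iso_class_act)

lemma supp_act: "\<forall>i. g i \<noteq> 0 \<Longrightarrow> supp (act g v) = supp v"
  by (simp add: supp_def act_def)

lemma iso_class_ind_eq: "iso_class \<Gamma> (ind S) = iso_class \<Gamma> (ind S') \<longleftrightarrow> S = S'"
  using iso_class_eqD supp_act supp_ind by metis

lemma topspace_moduli: "topspace (moduli_space \<Gamma> \<theta>) = iso_class \<Gamma> ` {v. theta_stable \<Gamma> \<theta> v}"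
  by (simp add: moduli_space_def topspace_quotient_topology)

lemma one_param_idelta:
  "t \<noteq> 0 \<Longrightarrow> one_param (w + idelta f) t = act (\<lambda>i. t powi f i) (one_param w t)"
  by (simp add: one_param_def act_def idelta_def vec_eq_iff power_int_add power_int_diff)

lemma continuous_act: "continuous_on X (act g)"
  proof -
  have "act g = (\<lambda>v. \<chi> a. (g (head \<Gamma> a) / g (tail \<Gamma> a)) * v $ a)" by (simp add: act_def fun_eq_iff)
  then show ?thesis by (simp only:) (intro continuous_intros)
qed

text \<open>The representations \<open>one_param w t\<close> converge to \<open>ind S\<close>, and
  adding \<open>idelta f\<close> only changes the basis in a way depending on \<open>t\<close>,
  which the classes do not see.\<close>

lemma limit_weightsI:
  assumes w: "w \<in> interior_weights S" and S: "stable \<theta> S"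
  shows "w + idelta f \<in> limit_weights \<Gamma> \<theta> (iso_class \<Gamma> (ind S))"
proof -
  have w': "w \<in> cocharacters \<Gamma>" "\<And>a. w $ a \<ge> 0" "\<And>a. w $ a = 0 \<longleftrightarrow> a \<in> S"
    using w by (auto simp: interior_weights_def)
  have st: "theta_stable \<Gamma> \<theta> (ind S)" using is_module_ind[OF w] S by (simp add: theta_stable_iff)
  have st_t: "theta_stable \<Gamma> \<theta> (one_param w t)" if "t \<noteq> 0" for t
  proof -
    have "is_module \<Gamma> (one_param w t)"
      using w'(1) that by (simp add: is_module_def cocharacters_def one_param_def power_int_sum)
    moreover have "supp (one_param w t) = UNIV" using that by (simp add: supp_def one_param_def)
    ultimately show ?thesis using stable_mono[OF S] by (simp add: theta_stable_iff)
  qed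
  have lim: "((\<lambda>t. one_param w t) \<longlongrightarrow> ind S) (at 0)"
  proof (rule vec_tendstoI)
    fix a
    show "((\<lambda>t. one_param w t $ a) \<longlongrightarrow> ind S $ a) (at 0)"
    proof (cases "a \<in> S")
      case True
      then have "w $ a = 0" using w'(3) by simp
      then show ?thesis using True by (simp add: one_param_def ind_def)
    next
      case False
      then have pos: "nat (w $ a) > 0" using w'(2)[of a] w'(3)[of a] by auto
      have "((\<lambda>t :: complex. t ^ nat (w $ a)) \<longlongrightarrow> 0 ^ nat (w $ a)) (at 0)" by (intro tendsto_intros)
      moreover have "one_param w t $ a = t ^ nat (w $ a)" for t
        using w'(2)[of a] by (simp add: one_param_def power_int_def)
      ultimately show ?thesis using pos False by (simp add: ind_def zero_power)
    qed
  qed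
  have "limitin (moduli_space \<Gamma> \<theta>) (\<lambda>t. iso_class \<Gamma> (one_param (w + idelta f) t)) (iso_class \<Gamma> (ind S)) (at 0)"
    unfolding limitin_def
  proof (intro conjI allI impI)
    show "iso_class \<Gamma> (ind S) \<in> topspace (moduli_space \<Gamma> \<theta>)" using st by (auto simp: topspace_moduli)
    fix U assume U: "openin (moduli_space \<Gamma> \<theta>) U \<and> iso_class \<Gamma> (ind S) \<in> U"
    then have "openin (top_of_set {v. theta_stable \<Gamma> \<theta> v}) {v. theta_stable \<Gamma> \<theta> v \<and> iso_class \<Gamma> v \<in> U}"
      by (simp add: moduli_space_def openin_quotient_topology)
    then obtain V where V: "open V" "{v. theta_stable \<Gamma> \<theta> v \<and> iso_class \<Gamma> v \<in> U} = {v. theta_stable \<Gamma> \<theta> v} \<inter> V"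
      by (auto simp: openin_open)
    then have "ind S \<in> V" using U st by blast
    then have "\<forall>\<^sub>F t in at 0. one_param w t \<in> V" using lim V(1) by (simp add: tendsto_def)
    then show "\<forall>\<^sub>F t in at 0. iso_class \<Gamma> (one_param (w + idelta f) t) \<in> U"
      using eventually_at_ball'[OF zero_less_one, of 0 UNIV]
    proof eventually_elim
      case (elim t)
      then have "one_param w t \<in> {v. theta_stable \<Gamma> \<theta> v \<and> iso_class \<Gamma> v \<in> U}" using st_t V(2) by blast
      then show ?case using elim by (simp add: one_param_idelta iso_class_eq_act)
    qed
  qed
  then show ?thesis using w'(1) by (simp add: limit_weights_def cocharacters_idelta)
qed

text \<open>The stable representations that some change of basis moves within \<open>e\<close> of
  \<open>v\<close> form a saturated relatively open set, so their classes are a neighbourhood of the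
  limit in the quotient topology.\<close>

lemma limit_weights_approx:
  assumes u: "u \<in> limit_weights \<Gamma> \<theta> (iso_class \<Gamma> v)" and v: "theta_stable \<Gamma> \<theta> v" and e: "e > 0"
  shows "\<exists>t g. t \<noteq> 0 \<and> norm t < e \<and> (\<forall>i. g i \<noteq> 0) \<and> dist (act g (one_param u t)) v < e"
proof -
  define U where "U = {x. theta_stable \<Gamma> \<theta> x \<and> (\<exists>g. (\<forall>i. g i \<noteq> 0) \<and> dist (act g x) v < e)}"
  have sat: "x \<in> U" if x: "theta_stable \<Gamma> \<theta> x" "iso_class \<Gamma> x = iso_class \<Gamma> x'" "x' \<in> U" for x x'
  proof -
    obtain g where g: "\<forall>i. g i \<noteq> 0" "dist (act g x') v < e" using x(3) by (auto simp: U_def)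
    obtain h where h: "\<forall>i. h i \<noteq> 0" "x' = act h x" using iso_class_eqD[OF x(2)[symmetric]] by blast
    have "(\<forall>i. g i * h i \<noteq> 0) \<and> dist (act (\<lambda>i. g i * h i) x) v < e" using g h by (simp add: act_act)
    then show ?thesis using x(1) unfolding U_def by (intro CollectI conjI exI[of _ "\<lambda>i. g i * h i"]) simp_all
  qed
  have "openin (moduli_space \<Gamma> \<theta>) (iso_class \<Gamma> ` U)"
    unfolding moduli_space_def openin_quotient_topology
  proof
    show "iso_class \<Gamma> ` U \<subseteq> iso_class \<Gamma> ` topspace (top_of_set {v. theta_stable \<Gamma> \<theta> v})"
      by (auto simp: U_def)
    have "{x \<in> topspace (top_of_set {v. theta_stable \<Gamma> \<theta> v}). iso_class \<Gamma> x \<in> iso_class \<Gamma> ` U} = U"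
      using sat by (auto simp: U_def)
    also have "U = {v. theta_stable \<Gamma> \<theta> v} \<inter> (\<Union>g\<in>{g. \<forall>i. g i \<noteq> 0}. act g -` ball v e)"
      by (auto simp: U_def dist_commute)
    also have "openin (top_of_set {v. theta_stable \<Gamma> \<theta> v}) \<dots>"
      by (intro openin_open_Int open_UN ballI open_vimage continuous_act open_ball)
    finally show "openin (top_of_set {v. theta_stable \<Gamma> \<theta> v})
      {x \<in> topspace (top_of_set {v. theta_stable \<Gamma> \<theta> v}). iso_class \<Gamma> x \<in> iso_class \<Gamma> ` U}" .
  qed
  moreover have "v \<in> U" using v e unfolding U_def by (auto intro: exI[of _ "\<lambda>i. 1"] simp: act_one)
  ultimately have "\<forall>\<^sub>F t in at 0. iso_class \<Gamma> (one_param u t) \<in> iso_class \<Gamma> ` U"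
    using u by (auto simp: limit_weights_def limitin_def)
  moreover have "\<forall>\<^sub>F t :: complex in at 0. t \<noteq> 0 \<and> norm t < e"
    using eventually_at_ball'[OF e, of 0 UNIV] by (rule eventually_mono) auto
  ultimately have "\<forall>\<^sub>F t in at 0. iso_class \<Gamma> (one_param u t) \<in> iso_class \<Gamma> ` U \<and> t \<noteq> 0 \<and> norm t < e"
    by (rule eventually_conj)
  then obtain t where t: "iso_class \<Gamma> (one_param u t) \<in> iso_class \<Gamma> ` U" "t \<noteq> 0" "norm t < e"
    using eventually_happens'[OF trivial_limit_at] by blast
  then obtain x where x: "x \<in> U" "iso_class \<Gamma> (one_param u t) = iso_class \<Gamma> x" by auto
  obtain g where g: "\<forall>i. g i \<noteq> 0" "dist (act g x) v < e" using x(1) by (auto simp: U_def)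
  obtain h where h: "\<forall>i. h i \<noteq> 0" "x = act h (one_param u t)" using iso_class_eqD[OF x(2)[symmetric]] by blast
  have "dist (act (\<lambda>i. g i * h i) (one_param u t)) v < e" "\<forall>i. g i * h i \<noteq> 0" using g h by (simp_all add: act_act)
  then show ?thesis using t by (intro exI[of _ t] exI[of _ "\<lambda>i. g i * h i"]) simp
qed

text \<open>
  Near the limit, \<open>one_param u t\<close> agrees with a representation of the limit up to a change of basis
  depending on \<open>t\<close>. Path functionals in the spanning arrow set \<open>S\<close> eliminate the change of basis, so
  after dividing by \<open>ln (norm t)\<close> only the weight remains.
\<close>

lemma limit_weightsD:
  assumes \<theta>: "stability_parameter \<theta>" and u: "u \<in> limit_weights \<Gamma> \<theta> y"
  obtains S w f where "stable \<theta> S" "y = iso_class \<Gamma> (ind S)" "w \<in> interior_weights S" "u = w + idelta f"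
proof -
  fix i0 :: 'v
  have "y \<in> topspace (moduli_space \<Gamma> \<theta>)" using u by (auto simp: limit_weights_def limitin_def)
  then obtain v where v: "theta_stable \<Gamma> \<theta> v" "y = iso_class \<Gamma> v" by (auto simp: topspace_moduli)
  define S where "S = supp v"
  have S: "stable \<theta> S" "spans S" using v(1) stable_spans[OF \<theta>] by (simp_all add: theta_stable_iff S_def)
  have "\<forall>n. \<exists>t g. t \<noteq> 0 \<and> norm t < 1 / real (Suc n) \<and> (\<forall>i. g i \<noteq> 0) \<and> dist (act g (one_param u t)) v < 1 / real (Suc n)"
    using limit_weights_approx[OF u[unfolded v(2)] v(1)] by simp
  then obtain t g where t: "\<And>n. t n \<noteq> 0" "\<And>n. norm (t n) < 1 / real (Suc n)" "\<And>n i. g n i \<noteq> 0"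
      "\<And>n. dist (act (g n) (one_param u (t n))) v < 1 / real (Suc n)"
    by metis
  define X where "X = (\<lambda>n. act (g n) (one_param u (t n)))"
  have inv: "(\<lambda>n. 1 / real (Suc n)) \<longlonglongrightarrow> 0" using LIMSEQ_inverse_real_of_nat by (simp add: inverse_eq_divide)
  have "X \<longlonglongrightarrow> v"
    unfolding X_def by (rule metric_tendsto_imp_tendsto[OF inv]) (use t(4) in \<open>auto intro!: always_eventually less_imp_le simp: dist_real_def\<close>)
  then have X: "(\<lambda>n. X n $ a) \<longlonglongrightarrow> v $ a" for a by (rule tendsto_vec_nth)
  have X_nz: "X n $ a \<noteq> 0" for n a using t by (simp add: X_def act_def one_param_def)
  have t0: "t \<longlonglongrightarrow> 0"
    by (rule metric_tendsto_imp_tendsto[OF inv])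
      (use t(2) in \<open>auto intro!: always_eventually less_imp_le simp: dist_real_def dist_norm\<close>)
  define L where "L = (\<lambda>n. ln (norm (t n)))"
  have L: "filterlim L at_bot sequentially"
    unfolding L_def
  proof (rule filterlim_compose[OF ln_at_0], unfold filterlim_at, intro conjI)
    show "\<forall>\<^sub>F n in sequentially. norm (t n) \<in> {0<..} \<and> norm (t n) \<noteq> 0" using t(1) by simp
    show "(\<lambda>n. norm (t n)) \<longlonglongrightarrow> 0" using tendsto_norm[OF t0] by simp
  qed
  obtain c :: "'v \<Rightarrow> 'e \<Rightarrow> int" where c: "\<And>i a. a \<notin> S \<Longrightarrow> c i a = 0"
    "\<And>i f. (\<Sum>a\<in>UNIV. of_int (c i a) * (f (head \<Gamma> a) - f (tail \<Gamma> a))) = (f i - f i0 :: real)"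
    using path_functional[OF S(2)] by metis
  \<comment> \<open>The total weight of \<open>u\<close> along the walk from \<open>i0\<close> to
    \<open>i\<close>; subtracting its coboundary is the normalisation that makes the weight vanish
    on \<open>S\<close>.\<close>
  define \<phi> where "\<phi> = (\<lambda>i. \<Sum>b\<in>UNIV. c i b * u $ b)"
  define w where "w = u - idelta \<phi>"
  \<comment> \<open>The walk in \<open>S\<close> from the tail to the head of \<open>a\<close>;
    along it the logarithms of the change of basis telescope and cancel in
    \<open>px\<close>.\<close>
  define k where "k = (\<lambda>a b. c (head \<Gamma> a) b - c (tail \<Gamma> a) b)"
  have k: "(\<Sum>b\<in>UNIV. real_of_int (k a b) * (f (head \<Gamma> b) - f (tail \<Gamma> b))) = f (head \<Gamma> a) - f (tail \<Gamma> a)" for a f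
    using c(2)[of "head \<Gamma> a" f] c(2)[of "tail \<Gamma> a" f] by (simp add: k_def left_diff_distrib sum_subtractf)
  have w_eq: "w $ a = u $ a - (\<Sum>b\<in>UNIV. k a b * u $ b)" for a
    by (simp add: w_def idelta_def \<phi>_def k_def left_diff_distrib sum_subtractf)
  define x where "x = (\<lambda>n a. ln (norm (X n $ a)))"
  have x: "x n a = ln (norm (g n (head \<Gamma> a))) - ln (norm (g n (tail \<Gamma> a))) + L n * of_int (u $ a)" for n a
    using t by (simp add: x_def X_def act_def one_param_def norm_mult norm_divide ln_mult ln_div ln_norm_power_int L_def)
  have px: "L n * of_int (w $ a) = x n a - (\<Sum>b\<in>UNIV. of_int (k a b) * x n b)" for n a
  proof -
    have "(\<Sum>b\<in>UNIV. of_int (k a b) * x n b) =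
      (\<Sum>b\<in>UNIV. of_int (k a b) * (ln (norm (g n (head \<Gamma> b))) - ln (norm (g n (tail \<Gamma> b))))) +
      L n * (\<Sum>b\<in>UNIV. of_int (k a b) * of_int (u $ b))"
      unfolding x by (simp add: distrib_left sum.distrib sum_distrib_left mult.left_commute)
    then show ?thesis
      unfolding k[of a "\<lambda>i. ln (norm (g n i))"] by (simp add: x w_eq algebra_simps)
  qed
  have lim_S: "(\<lambda>n. x n a) \<longlonglongrightarrow> ln (norm (v $ a))" if "a \<in> S" for a
    unfolding x_def by (intro tendsto_ln tendsto_norm X) (use that in \<open>simp add: S_def supp_def\<close>)
  have lim_k: "(\<lambda>n. \<Sum>b\<in>UNIV. of_int (k a b) * x n b) \<longlonglongrightarrow> (\<Sum>b\<in>UNIV. of_int (k a b) * ln (norm (v $ b)))" for a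
  proof (rule tendsto_sum)
    fix b
    show "(\<lambda>n. of_int (k a b) * x n b) \<longlonglongrightarrow> of_int (k a b) * ln (norm (v $ b))"
      by (cases "b \<in> S") (auto simp: k_def c(1) intro!: tendsto_mult_left lim_S)
  qed
  \<comment> \<open>For \<open>a\<close> in \<open>S\<close> the right side of \<open>px\<close>
    converges while \<open>L\<close> tends to minus infinity.\<close>
  have w_S: "w $ a = 0" if a: "a \<in> S" for a
  proof (rule ccontr)
    assume nz: "w $ a \<noteq> 0"
    have "(\<lambda>n. L n * of_int (w $ a)) \<longlonglongrightarrow> ln (norm (v $ a)) - (\<Sum>b\<in>UNIV. of_int (k a b) * ln (norm (v $ b)))"
      unfolding px by (intro tendsto_diff lim_S[OF a] lim_k)
    then have "(\<lambda>n. L n * of_int (w $ a) * inverse (of_int (w $ a))) \<longlonglongrightarrow>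
      (ln (norm (v $ a)) - (\<Sum>b\<in>UNIV. of_int (k a b) * ln (norm (v $ b)))) * inverse (of_int (w $ a))"
      by (rule tendsto_mult_right)
    moreover have "(\<lambda>n. L n * of_int (w $ a) * inverse (of_int (w $ a))) = L" using nz by (simp add: fun_eq_iff)
    ultimately have "L \<longlonglongrightarrow> (ln (norm (v $ a)) - (\<Sum>b\<in>UNIV. of_int (k a b) * ln (norm (v $ b)))) * inverse (of_int (w $ a))"
      by (simp only:)
    then show False using not_tendsto_and_filterlim_at_infinity[OF _ _ filterlim_at_bot_imp_at_infinity[OF L]] by simp
  qed
  \<comment> \<open>Outside \<open>S\<close> the entry of the limit is 0, so the right side of
    \<open>px\<close> tends to minus infinity; as \<open>L\<close> is negative, the weight is
    positive.\<close>
  have w_pos: "w $ a > 0" if a: "a \<notin> S" for a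
  proof (rule ccontr)
    assume np: "\<not> w $ a > 0"
    have "filterlim (\<lambda>n. x n a) at_bot sequentially"
      unfolding x_def
    proof (rule filterlim_compose[OF ln_at_0], unfold filterlim_at, intro conjI)
      show "\<forall>\<^sub>F n in sequentially. norm (X n $ a) \<in> {0<..} \<and> norm (X n $ a) \<noteq> 0" using X_nz by simp
      show "(\<lambda>n. norm (X n $ a)) \<longlonglongrightarrow> 0" using tendsto_norm[OF X[of a]] a by (simp add: S_def supp_def)
    qed
    then have "filterlim (\<lambda>n. - (\<Sum>b\<in>UNIV. of_int (k a b) * x n b) + x n a) at_bot sequentially"
      by (simp only: filterlim_tendsto_add_at_bot_iff[OF tendsto_minus[OF lim_k]])
    then have "filterlim (\<lambda>n. L n * of_int (w $ a)) at_bot sequentially" unfolding px by simp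
    then have "\<forall>\<^sub>F n in sequentially. L n * of_int (w $ a) < 0"
      by (simp add: filterlim_at_bot_dense)
    moreover have "\<forall>\<^sub>F n in sequentially. L n < 0" using L by (simp add: filterlim_at_bot_dense)
    ultimately have "\<forall>\<^sub>F n in sequentially. False"
    proof eventually_elim
      case (elim n)
      have "of_int (w $ a) \<le> (0 :: real)" using np by simp
      then have "L n * of_int (w $ a) \<ge> 0" using elim(2) by (intro mult_nonpos_nonpos) auto
      then show False using elim(1) by simp
    qed
    then show False by simp
  qed
  have "u \<in> cocharacters \<Gamma>" using u by (simp add: limit_weights_def)
  moreover have u_eq: "u = w + idelta \<phi>" by (simp add: w_def)
  ultimately have "w \<in> cocharacters \<Gamma>" using cocharacters_idelta by metis
  moreover have "w $ a \<ge> 0" "w $ a = 0 \<longleftrightarrow> a \<in> S" for a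
    using w_S[of a] w_pos[of a] by (cases "a \<in> S"; simp)+
  ultimately have w: "w \<in> interior_weights S" by (auto simp: interior_weights_def)
  \<comment> \<open>The change of basis that remains when \<open>u\<close> is replaced by
    \<open>w\<close>. On \<open>S\<close> its quotients are the entries of \<open>X n\<close>, so
    relative to \<open>i0\<close> it converges along walks, and the limit \<open>z\<close>
    identifies \<open>v\<close> with \<open>ind S\<close>.\<close>
  define K where "K = (\<lambda>n i. g n i * t n powi \<phi> i)"
  have K_nz: "K n i \<noteq> 0" for n i using t by (simp add: K_def)
  have K: "X n $ a = K n (head \<Gamma> a) / K n (tail \<Gamma> a)" if "a \<in> S" for n a
  proof -
    have "u $ a = \<phi> (head \<Gamma> a) - \<phi> (tail \<Gamma> a)" using w_S[OF that] by (simp add: w_def idelta_def)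
    then show ?thesis using t by (simp add: X_def act_def one_param_def K_def power_int_diff)
  qed
  have "\<exists>z. z \<noteq> 0 \<and> (\<lambda>n. K n i / K n i0) \<longlonglongrightarrow> z" for i
  proof (rule spans_induct[OF S(2), of "\<lambda>i. \<exists>z. z \<noteq> 0 \<and> (\<lambda>n. K n i / K n i0) \<longlonglongrightarrow> z" i0])
    show "\<exists>z. z \<noteq> 0 \<and> (\<lambda>n. K n i0 / K n i0) \<longlonglongrightarrow> z" using K_nz by (intro exI[of _ 1]) simp
    fix a assume a: "a \<in> S"
    then have va: "v $ a \<noteq> 0" by (simp add: S_def supp_def)
    show "\<exists>z. z \<noteq> 0 \<and> (\<lambda>n. K n (head \<Gamma> a) / K n i0) \<longlonglongrightarrow> z"
      if z: "\<exists>z. z \<noteq> 0 \<and> (\<lambda>n. K n (tail \<Gamma> a) / K n i0) \<longlonglongrightarrow> z"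
    proof -
      obtain z where "z \<noteq> 0" "(\<lambda>n. K n (tail \<Gamma> a) / K n i0) \<longlonglongrightarrow> z" using z by blast
      moreover from this(2) have "(\<lambda>n. X n $ a * (K n (tail \<Gamma> a) / K n i0)) \<longlonglongrightarrow> v $ a * z"
        by (intro tendsto_mult X)
      then have "(\<lambda>n. K n (head \<Gamma> a) / K n i0) \<longlonglongrightarrow> v $ a * z" using K_nz by (simp add: K[OF a])
      ultimately show ?thesis using va by (intro exI[of _ "v $ a * z"]) simp
    qed
    show "\<exists>z. z \<noteq> 0 \<and> (\<lambda>n. K n (tail \<Gamma> a) / K n i0) \<longlonglongrightarrow> z"
      if z: "\<exists>z. z \<noteq> 0 \<and> (\<lambda>n. K n (head \<Gamma> a) / K n i0) \<longlonglongrightarrow> z"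
    proof -
      obtain z where "z \<noteq> 0" "(\<lambda>n. K n (head \<Gamma> a) / K n i0) \<longlonglongrightarrow> z" using z by blast
      moreover from this(2) have "(\<lambda>n. (K n (head \<Gamma> a) / K n i0) / X n $ a) \<longlonglongrightarrow> z / v $ a"
        by (intro tendsto_divide X va)
      then have "(\<lambda>n. K n (tail \<Gamma> a) / K n i0) \<longlonglongrightarrow> z / v $ a" using K_nz by (simp add: K[OF a])
      ultimately show ?thesis using va by (intro exI[of _ "z / v $ a"]) simp
    qed
  qed
  then obtain z where z: "\<And>i. z i \<noteq> 0" "\<And>i. (\<lambda>n. K n i / K n i0) \<longlonglongrightarrow> z i" by metis
  have "v $ a = z (head \<Gamma> a) / z (tail \<Gamma> a)" if a: "a \<in> S" for a
  proof (rule LIMSEQ_unique[OF X])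
    have "(\<lambda>n. (K n (head \<Gamma> a) / K n i0) / (K n (tail \<Gamma> a) / K n i0)) \<longlonglongrightarrow> z (head \<Gamma> a) / z (tail \<Gamma> a)"
      by (intro tendsto_divide z)
    then show "(\<lambda>n. X n $ a) \<longlonglongrightarrow> z (head \<Gamma> a) / z (tail \<Gamma> a)" using K_nz by (simp add: K[OF a])
  qed
  then have "v = act z (ind S)" by (auto simp: vec_eq_iff act_def ind_def S_def supp_def)
  then have "y = iso_class \<Gamma> (ind S)" using iso_class_eq_act z(1) v(2) by simp
  then show ?thesis using that S(1) w u_eq by blast
qed

lemma limit_weights_eq:
  assumes "stability_parameter \<theta>" "stable \<theta> S"
  shows "limit_weights \<Gamma> \<theta> (iso_class \<Gamma> (ind S)) = {w + idelta f |w f. w \<in> interior_weights S}"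
proof (intro equalityI subsetI)
  fix u assume u: "u \<in> limit_weights \<Gamma> \<theta> (iso_class \<Gamma> (ind S))"
  obtain S' w f where "iso_class \<Gamma> (ind S) = iso_class \<Gamma> (ind S')" "w \<in> interior_weights S'" "u = w + idelta f"
    using limit_weightsD[OF assms(1) u] by metis
  then show "u \<in> {w + idelta f |w f. w \<in> interior_weights S}" by (auto simp: iso_class_ind_eq)
qed (use limit_weightsI assms in blast)

lemma distinguished_iff:
  assumes "stability_parameter \<theta>"
  shows "y \<in> distinguished \<Gamma> \<theta> \<longleftrightarrow> (\<exists>S. stable \<theta> S \<and> interior_weights S \<noteq> {} \<and> y = iso_class \<Gamma> (ind S))"
proof
  assume "y \<in> distinguished \<Gamma> \<theta>"
  then obtain u where "u \<in> limit_weights \<Gamma> \<theta> y" by (auto simp: distinguished_def)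
  then show "\<exists>S. stable \<theta> S \<and> interior_weights S \<noteq> {} \<and> y = iso_class \<Gamma> (ind S)"
    using limit_weightsD[OF assms] by (metis empty_iff)
next
  assume "\<exists>S. stable \<theta> S \<and> interior_weights S \<noteq> {} \<and> y = iso_class \<Gamma> (ind S)"
  then show "y \<in> distinguished \<Gamma> \<theta>"
    using limit_weights_eq[OF assms] by (fastforce simp: distinguished_def)
qed

end

section \<open>Perfect matchings and the fan\<close>

text \<open>Induction on \<open>I\<close>. A tight proper subset splits the problem into two smaller
  ones; if there is none, any choice at one index leaves Hall's condition valid for the
  others.\<close>

lemma hall_marriage:
  assumes "finite I" "\<And>i. i \<in> I \<Longrightarrow> finite (A i)"
    "\<And>J. J \<subseteq> I \<Longrightarrow> card J \<le> card (\<Union>i\<in>J. A i)"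
  shows "\<exists>f. inj_on f I \<and> (\<forall>i\<in>I. f i \<in> A i)"
  using assms
proof (induction I arbitrary: A rule: finite_psubset_induct)
  case (psubset I)
  note fin = psubset.prems(1) and hall = psubset.prems(2)
  have finU: "finite (\<Union>i\<in>J. A i)" if "J \<subseteq> I" for J
    using that fin finite_subset[OF that psubset.hyps] by auto
  show ?case
  proof (cases "I = {}")
    case False
    show ?thesis
    proof (cases "\<exists>J. J \<noteq> {} \<and> J \<subset> I \<and> card (\<Union>i\<in>J. A i) \<le> card J")
      case True
      then obtain J where J: "J \<noteq> {}" "J \<subset> I" "card (\<Union>i\<in>J. A i) \<le> card J" by blast
      let ?U = "\<Union>i\<in>J. A i"
      have "\<exists>f. inj_on f J \<and> (\<forall>i\<in>J. f i \<in> A i)"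
      proof (rule psubset.IH[OF J(2)])
        show "finite (A i)" if "i \<in> J" for i using fin that J(2) by blast
        show "card L \<le> card (\<Union>i\<in>L. A i)" if "L \<subseteq> J" for L using that J(2) by (intro hall) blast
      qed
      then obtain f1 where f1: "inj_on f1 J" "\<forall>i\<in>J. f1 i \<in> A i" by blast
      have IJ: "I - J \<subset> I" using J by blast
      have rest: "card L \<le> card (\<Union>i\<in>L. A i - ?U)" if L: "L \<subseteq> I - J" for L
      proof -
        have finJ: "finite J" "finite L" using J(2) L psubset.hyps finite_subset by blast+
        have "card J + card L = card (J \<union> L)" using L finJ by (subst card_Un_disjoint) auto
        also have "\<dots> \<le> card (\<Union>i\<in>J \<union> L. A i)" using L J(2) by (intro hall) blast
        also have "(\<Union>i\<in>J \<union> L. A i) = ?U \<union> (\<Union>i\<in>L. A i - ?U)" by blast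
        also have "card \<dots> \<le> card ?U + card (\<Union>i\<in>L. A i - ?U)" by (rule card_Un_le)
        finally show ?thesis using J(3) by linarith
      qed
      have "\<exists>f. inj_on f (I - J) \<and> (\<forall>i\<in>I - J. f i \<in> A i - ?U)"
        by (rule psubset.IH[OF IJ]) (use fin rest in auto)
      then obtain f2 where f2: "inj_on f2 (I - J)" "\<forall>i\<in>I - J. f2 i \<in> A i - ?U" by blast
      define f where "f = (\<lambda>i. if i \<in> J then f1 i else f2 i)"
      have "inj_on f I"
      proof (rule inj_onI)
        fix x y assume xy: "x \<in> I" "y \<in> I" "f x = f y"
        show "x = y"
        proof (cases "x \<in> J"; cases "y \<in> J")
          assume "x \<in> J" "y \<in> J"
          then show ?thesis using xy f1(1) by (simp add: f_def inj_on_eq_iff)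
        next
          assume "x \<in> J" "y \<notin> J"
          then show ?thesis using xy f1(2) f2(2) by (auto simp: f_def)
        next
          assume "x \<notin> J" "y \<in> J"
          then have "f2 x = f1 y" using xy by (simp add: f_def)
          moreover have "f1 y \<in> ?U" using f1(2) \<open>y \<in> J\<close> by blast
          moreover have "f2 x \<notin> ?U" using f2(2) xy(1) \<open>x \<notin> J\<close> by blast
          ultimately show ?thesis by simp
        next
          assume "x \<notin> J" "y \<notin> J"
          then show ?thesis using xy f2(1) by (simp add: f_def inj_on_eq_iff)
        qed
      qed
      moreover have "\<forall>i\<in>I. f i \<in> A i" using f1(2) f2(2) by (auto simp: f_def)
      ultimately show ?thesis by blast
    next
      case slack: False
      obtain i where i: "i \<in> I" using False by blast
      have "card {i} \<le> card (\<Union>j\<in>{i}. A j)" using i by (intro hall) simp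
      then obtain x where x: "x \<in> A i" by fastforce
      have rest: "card J \<le> card (\<Union>j\<in>J. A j - {x})" if J: "J \<subseteq> I - {i}" for J
      proof (cases "J = {}")
        case False
        moreover have "J \<subset> I" using J i by blast
        ultimately have "\<not> card (\<Union>j\<in>J. A j) \<le> card J" using slack by blast
        then have "card J < card (\<Union>j\<in>J. A j)" by simp
        moreover have "(\<Union>j\<in>J. A j - {x}) = (\<Union>j\<in>J. A j) - {x}" by blast
        moreover have "card (\<Union>j\<in>J. A j) - 1 \<le> card ((\<Union>j\<in>J. A j) - {x})" by (simp add: card_Diff_singleton_if)
        ultimately show ?thesis by simp
      qed simp
      have Ii: "I - {i} \<subset> I" using i by blast
      have "\<exists>f. inj_on f (I - {i}) \<and> (\<forall>j\<in>I - {i}. f j \<in> A j - {x})"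
        by (rule psubset.IH[OF Ii]) (use fin rest in auto)
      then obtain f where f: "inj_on f (I - {i})" "\<forall>j\<in>I - {i}. f j \<in> A j - {x}" by blast
      have "inj_on (f(i := x)) I"
      proof (rule inj_onI)
        fix a b assume ab: "a \<in> I" "b \<in> I" "(f(i := x)) a = (f(i := x)) b"
        show "a = b"
        proof (cases "a = i"; cases "b = i")
          assume "a \<noteq> i" "b \<noteq> i"
          then show ?thesis using ab f(1) by (auto simp: inj_on_def)
        next
          assume "a = i" "b \<noteq> i"
          then show ?thesis using ab f(2) by auto
        next
          assume "a \<noteq> i" "b = i"
          then have "f a = x" using ab by simp
          moreover have "f a \<in> A a - {x}" using f(2) ab(1) \<open>a \<noteq> i\<close> by blast
          ultimately show ?thesis by simp
        qed simp
      qed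
      moreover have "\<forall>j\<in>I. (f(i := x)) j \<in> A j" using f(2) x by auto
      ultimately show ?thesis by blast
    qed
  qed simp
qed

lemma convex_cone_closure:
  fixes C :: "'a::euclidean_space set"
  shows "convex_cone C \<Longrightarrow> convex_cone (closure C)"
  unfolding convex_cone_def by (auto intro: convex_closure conic_closure)

context dimer_geometry
begin

definition pmatch :: "'e set \<Rightarrow> bool"
  where "pmatch \<mu> \<longleftrightarrow> (\<forall>c a. card (\<mu> \<inter> cls c a) = 1)"

definition pmi :: "'e set \<Rightarrow> int ^ 'e" where "pmi \<mu> = (\<chi> a. if a \<in> \<mu> then 1 else 0)"

lemma sum_pmi: "(\<Sum>b\<in>A. pmi \<mu> $ b) = int (card (\<mu> \<inter> A))"
  by (simp add: pmi_def sum.If_cases Int_commute)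

lemma pmi_cocharacter: "pmatch \<mu> \<Longrightarrow> pmi \<mu> \<in> cocharacters \<Gamma>"
  by (simp add: cocharacters_iff sum_pmi pmatch_def)

lemma cocharacter_degree:
  assumes "w \<in> cocharacters \<Gamma>"
  shows "(\<Sum>b\<in>cls c a. w $ b) = (\<Sum>b\<in>cls c' a'. w $ b)"
proof -
  have "csum c a (rv w) = csum c' a' (rv w)"
    using weights_degree assms by (simp add: cocharacters_rv)
  then have "real_of_int (\<Sum>b\<in>cls c a. w $ b) = of_int (\<Sum>b\<in>cls c' a'. w $ b)"
    by (simp add: csum_def rv_def)
  then show ?thesis by (simp only: of_int_eq_iff)
qed

lemma cls_disjoint: "X \<in> range (cls c) \<Longrightarrow> Y \<in> range (cls c) \<Longrightarrow> b \<in> X \<Longrightarrow> b \<in> Y \<Longrightarrow> X = Y"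
  using cls_eq by blast

lemma sum_Union_cls:
  assumes "w \<in> cocharacters \<Gamma>" "J \<subseteq> range (cls c)"
  shows "(\<Sum>b\<in>\<Union>J. w $ b) = int (card J) * (\<Sum>b\<in>cls True a. w $ b)"
proof -
  have "(\<Sum>b\<in>\<Union>J. w $ b) = (\<Sum>X\<in>J. \<Sum>b\<in>X. w $ b)"
    proof -
    have dis: "\<forall>X\<in>J. \<forall>Y\<in>J. X \<noteq> Y \<longrightarrow> X \<inter> Y = {}"
    proof (intro ballI impI equals0I)
      fix X Y b assume XY: "X \<in> J" "Y \<in> J" "X \<noteq> Y" "b \<in> X \<inter> Y"
      then have "X = Y" using cls_disjoint[of X c Y b] assms(2) by blast
      then show False using XY by simp
    qed
    then show ?thesis using sum.Union_disjoint[OF _ dis, of "($) w"] by simp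
  qed
  also have "\<dots> = (\<Sum>X\<in>J. \<Sum>b\<in>cls True a. w $ b)"
  proof (rule sum.cong)
    fix X assume "X \<in> J"
    then obtain a' where "X = cls c a'" using assms(2) by blast
    then show "(\<Sum>b\<in>X. w $ b) = (\<Sum>b\<in>cls True a. w $ b)" using cocharacter_degree[OF assms(1)] by simp
  qed simp
  finally show ?thesis by simp
qed

text \<open>All nodes have the same weighted degree \<open>d > 0\<close>, so comparing the weight at
  a set of white nodes with that at its neighbours along positive edges gives Hall's
  condition.\<close>

lemma perfect_matching_exists:
  assumes w: "w \<in> cocharacters \<Gamma>" "\<And>a. w $ a \<ge> 0" and a0: "w $ a0 > 0"
  obtains \<mu> where "pmatch \<mu>" "\<mu> \<subseteq> {a. w $ a > 0}"
proof -
  define d where "d = (\<Sum>b\<in>cls True a0. w $ b)"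
  have "w $ a0 \<le> d" unfolding d_def using w(2) by (intro member_le_sum) auto
  then have d: "d > 0" using a0 by simp
  define W where "W = range (cls True)"
  define A where "A = (\<lambda>X. {cls False b |b. b \<in> X \<and> w $ b > 0})"
  have "\<exists>f. inj_on f W \<and> (\<forall>X\<in>W. f X \<in> A X)"
  proof (rule hall_marriage)
    show "finite W" by (simp add: W_def)
    show "finite (A X)" for X by (simp add: A_def)
    fix J assume J: "J \<subseteq> W"
    let ?Y = "\<Union>X\<in>J. A X"
    have Y: "?Y \<subseteq> range (cls False)" by (auto simp: A_def)
    have "int (card J) * d = (\<Sum>b\<in>\<Union>J. w $ b)"
      using sum_Union_cls[OF w(1), of J True a0] J by (simp add: W_def d_def)
    also have "\<dots> = (\<Sum>b\<in>\<Union>J \<inter> {b. w $ b > 0}. w $ b)"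
      by (rule sum.mono_neutral_right) (use w(2) in \<open>auto simp: less_le\<close>)
    also have "\<dots> \<le> (\<Sum>b\<in>\<Union>?Y. w $ b)"
    proof (rule sum_mono2)
      show "\<Union>J \<inter> {b. w $ b > 0} \<subseteq> \<Union>?Y"
      proof
        fix b assume b: "b \<in> \<Union>J \<inter> {b. w $ b > 0}"
        then obtain X where "X \<in> J" "b \<in> X" by blast
        then have "cls False b \<in> ?Y" using b unfolding A_def by blast
        then show "b \<in> \<Union>?Y" using cls_refl by blast
      qed
    qed (use w(2) in auto)
    also have "\<dots> = int (card ?Y) * d"
      using sum_Union_cls[OF w(1) Y, of a0] by (simp add: d_def)
    finally show "card J \<le> card ?Y" using d by simp
  qed
  then obtain f where f: "inj_on f W" "\<And>X. X \<in> W \<Longrightarrow> f X \<in> A X" by blast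
  \<comment> \<open>The total weight can be counted at the white nodes or at the black ones.\<close>
  have cardW: "card W = card (range (cls False))"
  proof -
    have "int (card W) * d = (\<Sum>b\<in>\<Union>W. w $ b)" "int (card (range (cls False))) * d = (\<Sum>b\<in>\<Union>(range (cls False)). w $ b)"
      using sum_Union_cls[OF w(1), of W True a0] sum_Union_cls[OF w(1), of "range (cls False)" False a0]
      by (simp_all add: W_def d_def)
    moreover have "\<Union>W = UNIV" "\<Union>(range (cls False)) = UNIV" unfolding W_def using cls_refl by blast+
    ultimately have "int (card W) * d = int (card (range (cls False))) * d" by simp
    then show ?thesis using d by simp
  qed
  have "f ` W \<subseteq> range (cls False)" using f(2) unfolding A_def by fast
  then have fW: "f ` W = range (cls False)"
    using cardW card_image[OF f(1)] by (intro card_subset_eq) auto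
  have "\<exists>b. b \<in> X \<and> w $ b > 0 \<and> f X = cls False b" if "X \<in> W" for X
    using f(2)[OF that] by (auto simp: A_def)
  then obtain b where b: "\<And>X. X \<in> W \<Longrightarrow> b X \<in> X \<and> w $ b X > 0 \<and> f X = cls False (b X)" by metis
  define \<mu> where "\<mu> = b ` W"
  have "\<exists>x. \<mu> \<inter> cls c a = {x}" for c a
  proof (cases c)
    case True
    let ?X = "cls True a"
    have X: "?X \<in> W" by (simp add: W_def)
    have "\<mu> \<inter> ?X = {b ?X}"
    proof (intro equalityI subsetI)
      fix x assume "x \<in> \<mu> \<inter> ?X"
      then obtain Y where Y: "Y \<in> W" "x = b Y" "x \<in> ?X" by (auto simp: \<mu>_def)
      then have "Y = ?X" using b[OF Y(1)] X cls_disjoint[of Y True ?X x] by (simp add: W_def)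
      then show "x \<in> {b ?X}" using Y by simp
    qed (use b[OF X] X in \<open>auto simp: \<mu>_def\<close>)
    then show ?thesis using True by auto
  next
    case False
    have "cls False a \<in> f ` W" unfolding fW by simp
    then obtain X where X: "X \<in> W" "f X = cls False a" by (metis imageE)
    have "\<mu> \<inter> cls False a = {b X}"
    proof (intro equalityI subsetI)
      fix x assume "x \<in> \<mu> \<inter> cls False a"
      then obtain Y where Y: "Y \<in> W" "x = b Y" "x \<in> cls False a" by (auto simp: \<mu>_def)
      then have "f Y = f X" using b[OF Y(1)] cls_eq X(2) by simp
      then have "Y = X" using f(1) X(1) Y(1) by (simp add: inj_on_eq_iff)
      then show "x \<in> {b X}" using Y by simp
    next
      fix x assume "x \<in> {b X}"
      moreover have "b X \<in> cls False (b X)" by simp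
      then have "b X \<in> cls False a" using b[OF X(1)] X(2) by simp
      ultimately show "x \<in> \<mu> \<inter> cls False a" using X(1) by (simp add: \<mu>_def)
    qed
    then show ?thesis using False by auto
  qed
  then have "pmatch \<mu>" unfolding pmatch_def by (metis card_1_singleton_iff One_nat_def)
  moreover have "\<mu> \<subseteq> {a. w $ a > 0}" using b by (auto simp: \<mu>_def)
  ultimately show ?thesis by (rule that)
qed

text \<open>A matching that misses \<open>a0\<close> is subtracted: the weight stays nonnegative and
  positive at \<open>a0\<close>, while its total drops.\<close>

lemma perfect_matching_through:
  assumes "w \<in> cocharacters \<Gamma>" "\<And>a. w $ a \<ge> 0" "w $ a0 > 0"
  shows "\<exists>\<mu>. pmatch \<mu> \<and> a0 \<in> \<mu> \<and> \<mu> \<subseteq> {a. w $ a > 0}"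
  using assms
proof (induction "nat (\<Sum>a\<in>UNIV. w $ a)" arbitrary: w rule: less_induct)
  case less
  note w = less.prems
  obtain \<mu> where P: "pmatch \<mu>" "\<mu> \<subseteq> {a. w $ a > 0}" using perfect_matching_exists[OF w] by blast
  show ?case
  proof (cases "a0 \<in> \<mu>")
    case False
    define w' where "w' = w - pmi \<mu>"
    have sub: "w' $ a \<le> w $ a" "w' $ a \<ge> 0" for a
      using P(2) w(2)[of a] by (auto simp: w'_def pmi_def)
    have "w' \<in> cocharacters \<Gamma>"
      using w(1) pmi_cocharacter[OF P(1)] subspace_diff[OF subspace_weights]
      by (simp add: cocharacters_rv w'_def rv_simps)
    moreover have "w' $ a0 > 0" using w(3) False by (simp add: w'_def pmi_def)
    moreover have "(\<Sum>a\<in>UNIV. w' $ a) < (\<Sum>a\<in>UNIV. w $ a)"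
    proof -
      have "card (\<mu> \<inter> cls True a0) = 1" using P(1) by (simp add: pmatch_def)
      then have "\<mu> \<noteq> {}" by auto
      then have "card \<mu> > 0" by (simp add: card_gt_0_iff)
      then show ?thesis using sum_pmi[of \<mu> UNIV] by (simp add: w'_def sum_subtractf)
    qed
    moreover have "(\<Sum>a\<in>UNIV. w' $ a) \<ge> 0" using sub(2) by (intro sum_nonneg)
    ultimately obtain \<mu>' where "pmatch \<mu>'" "a0 \<in> \<mu>'" "\<mu>' \<subseteq> {a. w' $ a > 0}"
      using less.hyps[of w'] sub(2) by auto
    then show ?thesis using sub(1) by (intro exI[of _ \<mu>']) (auto intro: less_le_trans)
  qed (use P in blast)
qed

text \<open>The sum at a node reduces to the single matched edge there, and this sum is the same at
  all nodes.\<close>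

lemma pmatch_weight:
  assumes "pmatch \<mu>" "x \<in> weights" "x \<in> vanishing (- \<mu>)"
  shows "\<exists>r. x = r *\<^sub>R rv (pmi \<mu>)"
proof -
  fix a0 :: 'e
  have "x $ a = csum True a0 x" if a: "a \<in> \<mu>" for a
  proof -
    obtain b where b: "\<mu> \<inter> cls True a = {b}"
      using assms(1) unfolding pmatch_def by (metis card_1_singletonE)
    moreover have "a \<in> \<mu> \<inter> cls True a" using a by simp
    ultimately have "b = a" by simp
    have "csum True a x = (\<Sum>b\<in>\<mu> \<inter> cls True a. x $ b)"
      unfolding csum_def using assms(3) by (intro sum.mono_neutral_right) (auto simp: vanishing_def)
    also have "\<dots> = x $ a" using b \<open>b = a\<close> by simp
    finally show ?thesis using weights_degree[OF assms(2), of True a True a0] by simp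
  qed
  then have "x = csum True a0 x *\<^sub>R rv (pmi \<mu>)"
    using assms(3) by (auto simp: vec_eq_iff rv_def pmi_def vanishing_def)
  then show ?thesis by blast
qed

lemma interior_weights_pmatch: "pmatch \<mu> \<Longrightarrow> pmi \<mu> \<in> interior_weights (- \<mu>)"
  using pmi_cocharacter by (auto simp: interior_weights_def pmi_def)

section \<open>The fan in terms of arrow weights\<close>

definition nonneg_weights :: "'e set \<Rightarrow> (real ^ 'e) set"
  where "nonneg_weights S = {x \<in> weights \<inter> vanishing S. \<forall>a. x $ a \<ge> 0}"

abbreviation nonneg_cone :: "'e set \<Rightarrow> (real ^ 'e) set"
  where "nonneg_cone S \<equiv> {w + delta f |w f. w \<in> nonneg_weights S}"

abbreviation cone_generators :: "'e set \<Rightarrow> (real ^ 'e) set"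
  where "cone_generators S \<equiv> {rv (w + idelta f) |w f. w \<in> interior_weights S}"

definition cone_of :: "('v \<Rightarrow> rat) \<Rightarrow> 'e set \<Rightarrow> (real ^ 'e) set"
  where "cone_of \<theta> S = cone_at \<Gamma> \<theta> (iso_class \<Gamma> (ind S))"

text \<open>These arrow sets are the supports of the distinguished points and hence index the cones
  of the fan.\<close>

definition admissible :: "('v \<Rightarrow> rat) \<Rightarrow> 'e set \<Rightarrow> bool"
  where "admissible \<theta> S \<longleftrightarrow> stable \<theta> S \<and> interior_weights S \<noteq> {}"

text \<open>A sum of closed sets need not be closed. Here the linear map \<open>p\<close> subtracts
  the coboundary of the sums along walks in \<open>S\<close> and so recovers \<open>w\<close> from
  \<open>w + delta f\<close>; membership becomes a closed condition on \<open>p x\<close>.\<close>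

lemma closed_coboundary_sum:
  assumes "spans S"
  shows "closed (nonneg_cone S)"
proof -
  fix i0 :: 'v
  obtain c :: "'v \<Rightarrow> 'e \<Rightarrow> int" where c: "\<And>i a. a \<notin> S \<Longrightarrow> c i a = 0"
    "\<And>i f. (\<Sum>a\<in>UNIV. of_int (c i a) * (f (head \<Gamma> a) - f (tail \<Gamma> a))) = (f i - f i0 :: real)"
    using path_functional[OF assms] by metis
  define \<phi> where "\<phi> = (\<lambda>(x :: real ^ 'e) i. \<Sum>a\<in>UNIV. of_int (c i a) * x $ a)"
  define p where "p = (\<lambda>x. x - delta (\<phi> x))"
  have p_nth: "p x $ a = x $ a - (\<phi> x (head \<Gamma> a) - \<phi> x (tail \<Gamma> a))" for x a
    by (simp add: p_def delta_def)
  have eq: "nonneg_cone S =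
    weights \<inter> {x. \<forall>a\<in>S. p x $ a = 0} \<inter> {x. \<forall>a. p x $ a \<ge> 0}"
  proof (intro equalityI subsetI)
    fix x assume "x \<in> nonneg_cone S"
    then obtain w f where x: "x = w + delta f" and w: "w \<in> nonneg_weights S" by blast
    have w0: "\<phi> w i = 0" for i
      unfolding \<phi>_def using w c(1)
      by (intro sum.neutral ballI) (auto simp: nonneg_weights_def vanishing_def)
    have "\<phi> x i = \<phi> w i + (f i - f i0)" for i
      unfolding \<phi>_def x c(2)[symmetric] by (simp add: delta_def distrib_left sum.distrib)
    then have "\<phi> x = (\<lambda>i. f i - f i0)" by (simp add: w0 fun_eq_iff)
    then have "p x = w" by (simp add: p_def x delta_simps(3,5))
    moreover have "x \<in> weights" unfolding x
      using w delta_weights subspace_add[OF subspace_weights] by (simp add: nonneg_weights_def)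
    ultimately show "x \<in> weights \<inter> {x. \<forall>a\<in>S. p x $ a = 0} \<inter> {x. \<forall>a. p x $ a \<ge> 0}"
      using w by (simp add: nonneg_weights_def vanishing_def)
  next
    fix x assume x: "x \<in> weights \<inter> {x. \<forall>a\<in>S. p x $ a = 0} \<inter> {x. \<forall>a. p x $ a \<ge> 0}"
    then have "p x \<in> nonneg_weights S"
      unfolding nonneg_weights_def vanishing_def p_def
      using delta_weights subspace_diff[OF subspace_weights] by simp
    moreover have "x = p x + delta (\<phi> x)" by (simp add: p_def)
    ultimately show "x \<in> nonneg_cone S" by blast
  qed
  have cont: "continuous_on UNIV (\<lambda>x. p x $ a)" for a
    unfolding p_nth \<phi>_def by (intro continuous_intros)
  have cl: "closed {x. p x $ a = 0}" "closed {x. p x $ a \<ge> 0}" for a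
    by (rule closed_Collect_eq[OF cont continuous_on_const], rule closed_Collect_le[OF continuous_on_const cont])
  have "closed (weights \<inter> (\<Inter>a\<in>S. {x. p x $ a = 0}) \<inter> (\<Inter>a. {x. p x $ a \<ge> 0}))"
    by (intro closed_Int closed_INT ballI cl closed_subspace[OF subspace_weights])
  moreover have "(\<Inter>a\<in>S. {x. p x $ a = 0}) = {x. \<forall>a\<in>S. p x $ a = 0}" "(\<Inter>a. {x. p x $ a \<ge> 0}) = {x. \<forall>a. p x $ a \<ge> 0}"
    by blast+
  ultimately show ?thesis unfolding eq by simp
qed

lemma convex_cone_nonneg_sum: "convex_cone (nonneg_cone S)"
  unfolding convex_cone_iff
proof (intro conjI ballI allI impI)
  have "0 \<in> nonneg_weights S"
    using subspace_0[OF subspace_weights] by (simp add: nonneg_weights_def vanishing_def)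
  moreover have "(0 :: real ^ 'e) = 0 + delta (\<lambda>i. 0)" by (simp add: delta_simps)
  ultimately show "0 \<in> nonneg_cone S" by blast
next
  fix x y assume "x \<in> nonneg_cone S" "y \<in> nonneg_cone S"
  then obtain w f w' f' where xy: "x = w + delta f" "y = w' + delta f'" "w \<in> nonneg_weights S" "w' \<in> nonneg_weights S"
    by blast
  then have "w + w' \<in> nonneg_weights S"
    using subspace_add[OF subspace_weights] by (simp add: nonneg_weights_def vanishing_def)
  moreover have "x + y = (w + w') + delta (\<lambda>i. f i + f' i)" by (simp add: xy delta_simps)
  ultimately show "x + y \<in> nonneg_cone S" by blast
next
  fix x and r :: real assume "x \<in> nonneg_cone S" and r: "r \<ge> 0"
  then obtain w f where x: "x = w + delta f" "w \<in> nonneg_weights S" by blast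
  then have "r *\<^sub>R w \<in> nonneg_weights S"
    using r subspace_scale[OF subspace_weights] by (simp add: nonneg_weights_def vanishing_def)
  moreover have "r *\<^sub>R x = r *\<^sub>R w + delta (\<lambda>i. r * f i)" by (simp add: x delta_simps scaleR_right_distrib)
  ultimately show "r *\<^sub>R x \<in> nonneg_cone S" by blast
qed

lemma cone_of_eq:
  assumes "stability_parameter \<theta>" "stable \<theta> S"
  shows "cone_of \<theta> S = closure (convex_cone hull cone_generators S)"
proof -
  have "(\<lambda>u. \<chi> a. real_of_int (u $ a)) = rv" by (simp add: rv_def fun_eq_iff)
  moreover have "rv ` limit_weights \<Gamma> \<theta> (iso_class \<Gamma> (ind S)) =
    cone_generators S"
    unfolding limit_weights_eq[OF assms] by blast
  ultimately show ?thesis unfolding cone_of_def cone_at_def by (simp only:)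
qed

lemma cone_of_subset:
  assumes "stability_parameter \<theta>" "stable \<theta> S"
  shows "cone_of \<theta> S \<subseteq> nonneg_cone S"
  unfolding cone_of_eq[OF assms]
proof (intro closure_minimal hull_minimal)
  show "cone_generators S \<subseteq> nonneg_cone S"
  proof
    fix x assume "x \<in> cone_generators S"
    then obtain w f where x: "x = rv w + delta (\<lambda>i. of_int (f i))" and w: "w \<in> interior_weights S"
      by (auto simp: rv_simps)
    have "rv w \<in> nonneg_weights S"
      using w by (auto simp: interior_weights_def nonneg_weights_def vanishing_def cocharacters_rv rv_def)
    then show "x \<in> nonneg_cone S" using x by blast
  qed
  show "convex_cone (nonneg_cone S)" by (rule convex_cone_nonneg_sum)
  show "closed (nonneg_cone S)"
    by (rule closed_coboundary_sum[OF stable_spans[OF assms]])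
qed

lemma convex_cone_cone_of: "convex_cone (cone_of \<theta> S)"
  unfolding cone_of_def cone_at_def
  by (rule convex_cone_closure) (rule convex_cone_convex_cone_hull)

text \<open>A weight on the boundary is approached by adding ever smaller multiples of a fixed
  interior weight \<open>w0\<close>.\<close>

lemma cone_ofI:
  assumes \<theta>: "stability_parameter \<theta>" and S: "admissible \<theta> S"
    and w: "w \<in> cocharacters \<Gamma>" "\<And>a. w $ a \<ge> 0" "\<And>a. a \<in> S \<Longrightarrow> w $ a = 0"
  shows "rv (w + idelta f) \<in> cone_of \<theta> S"
proof -
  obtain w0 where w0: "w0 \<in> interior_weights S" using S by (auto simp: admissible_def)
  define x where "x = (\<lambda>n. rv (w + idelta f) + inverse (real (Suc n)) *\<^sub>R rv w0)"
  have "x n \<in> convex_cone hull cone_generators S" for n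
  proof -
    \<comment> \<open>Multiplying by \<open>Suc n\<close> clears the denominator, which gives an
      integral interior weight.\<close>
    define w' where "w' = (\<chi> a. int (Suc n) * w $ a + w0 $ a)"
    have rw': "rv w' = real (Suc n) *\<^sub>R rv w + rv w0" by (simp add: w'_def rv_def vec_eq_iff algebra_simps)
    have "w' \<in> interior_weights S"
    proof -
      have "rv w' \<in> weights"
        unfolding rw' using w(1) w0 subspace_add[OF subspace_weights] subspace_scale[OF subspace_weights]
        by (simp add: cocharacters_rv interior_weights_def)
      moreover have "w' $ a \<ge> 0" "w' $ a = 0 \<longleftrightarrow> a \<in> S" for a
      proof -
        have nn: "w0 $ a \<ge> 0" "int (Suc n) * w $ a \<ge> 0" using w0 w(2) by (simp_all add: interior_weights_def)
        then show "w' $ a \<ge> 0" by (simp add: w'_def)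
        have "a \<in> S \<longleftrightarrow> w0 $ a = 0" using w0 by (auto simp: interior_weights_def)
        then show "w' $ a = 0 \<longleftrightarrow> a \<in> S" using nn w(3)[of a] by (auto simp: w'_def add_nonneg_eq_0_iff simp del: of_nat_Suc)
      qed
      ultimately show ?thesis by (auto simp: interior_weights_def cocharacters_rv)
    qed
    then have "rv (w' + idelta (\<lambda>i. int (Suc n) * f i)) \<in> convex_cone hull cone_generators S"
      by (intro hull_inc) blast
    then have "inverse (real (Suc n)) *\<^sub>R rv (w' + idelta (\<lambda>i. int (Suc n) * f i)) \<in> convex_cone hull cone_generators S"
      by (rule convex_cone_hull_mul) simp
    moreover have "inverse (real (Suc n)) *\<^sub>R rv (w' + idelta (\<lambda>i. int (Suc n) * f i)) = x n"
    proof -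
      have "real (Suc n) \<noteq> 0" by simp
      then show ?thesis
        unfolding x_def rv_simps rw' by (simp add: vec_eq_iff delta_def field_simps del: of_nat_Suc)
    qed
    ultimately show ?thesis by simp
  qed
  moreover have "x \<longlonglongrightarrow> rv (w + idelta f) + 0 *\<^sub>R rv w0"
    unfolding x_def by (intro tendsto_intros LIMSEQ_inverse_real_of_nat)
  ultimately have "rv (w + idelta f) \<in> closure (convex_cone hull cone_generators S)"
    unfolding closure_sequential by (intro exI[of _ x]) simp
  moreover have "stable \<theta> S" using S by (simp add: admissible_def)
  ultimately show ?thesis unfolding cone_of_eq[OF \<theta> \<open>stable \<theta> S\<close>] by simp
qed

text \<open>For the inclusion of arrow sets, an interior weight of \<open>S\<close> equals a
  nonnegative weight vanishing on \<open>S'\<close> plus \<open>delta f\<close>. Then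
  \<open>f\<close> rises along \<open>S'\<close> and falls along \<open>S\<close>, so it is constant
  by stability and the weight itself vanishes on \<open>S'\<close>.\<close>

lemma cone_of_mono_iff:
  assumes \<theta>: "stability_parameter \<theta>" and S: "admissible \<theta> S" "admissible \<theta> S'"
  shows "cone_of \<theta> S \<subseteq> cone_of \<theta> S' \<longleftrightarrow> S' \<subseteq> S"
proof
  assume sub: "cone_of \<theta> S \<subseteq> cone_of \<theta> S'"
  obtain w where w: "w \<in> interior_weights S" using S(1) by (auto simp: admissible_def)
  then have w': "w \<in> cocharacters \<Gamma>" "\<And>a. w $ a \<ge> 0" "\<And>a. w $ a = 0 \<longleftrightarrow> a \<in> S"
    by (auto simp: interior_weights_def)
  have "rv (w + idelta (\<lambda>i. 0)) \<in> cone_of \<theta> S" using w' by (intro cone_ofI \<theta> S) auto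
  moreover have "w + idelta (\<lambda>i. 0) = w" by (simp add: idelta_def vec_eq_iff)
  ultimately have "rv w \<in> nonneg_cone S'"
    using sub cone_of_subset[OF \<theta>, of S'] S(2) by (auto simp: admissible_def)
  then obtain x f where x: "rv w = x + delta f" "x \<in> nonneg_weights S'" by blast
  have xa: "x $ a = of_int (w $ a) - (f (head \<Gamma> a) - f (tail \<Gamma> a))" for a
    using arg_cong[OF x(1), of "\<lambda>x. x $ a"] by (simp add: rv_def delta_def)
  have x0: "x $ a \<ge> 0" "a \<in> S' \<Longrightarrow> x $ a = 0" for a using x(2) by (auto simp: nonneg_weights_def vanishing_def)
  have st: "stable \<theta> S" "stable \<theta> S'" using S by (simp_all add: admissible_def)
  have f: "f i = f j" for i j
  proof (rule stable_const[OF \<theta> st(2,1)])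
    show "f (tail \<Gamma> a) \<le> f (head \<Gamma> a)" if "a \<in> S'" for a
      using xa[of a] x0(2)[OF that] w'(2)[of a] by (simp add: algebra_simps)
    show "f (head \<Gamma> a) \<le> f (tail \<Gamma> a)" if "a \<in> S" for a
      using xa[of a] x0(1)[of a] w'(3)[of a] that by simp
  qed
  show "S' \<subseteq> S"
  proof
    fix a assume "a \<in> S'"
    then have "of_int (w $ a) = (0 :: real)" using xa[of a] x0(2)[of a] f[of "head \<Gamma> a" "tail \<Gamma> a"] by simp
    then show "a \<in> S" using w'(3) by simp
  qed
next
  assume sub: "S' \<subseteq> S"
  have st: "stable \<theta> S" "stable \<theta> S'" using S by (simp_all add: admissible_def)
  have "cone_generators S \<subseteq> cone_of \<theta> S'"
  proof
    fix x assume "x \<in> cone_generators S"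
    then obtain w f where x: "x = rv (w + idelta f)" "w \<in> interior_weights S" by blast
    show "x \<in> cone_of \<theta> S'"
      unfolding x(1) by (rule cone_ofI[OF \<theta> S(2)]) (use x(2) sub in \<open>auto simp: interior_weights_def\<close>)
  qed
  then have "convex_cone hull cone_generators S \<subseteq> cone_of \<theta> S'"
    by (intro hull_minimal convex_cone_cone_of)
  then show "cone_of \<theta> S \<subseteq> cone_of \<theta> S'"
    unfolding cone_of_eq[OF \<theta> st(1)] by (intro closure_minimal) (simp_all add: cone_of_def cone_at_def)
qed

lemma cone_of_inj:
  "stability_parameter \<theta> \<Longrightarrow> admissible \<theta> S \<Longrightarrow> admissible \<theta> S' \<Longrightarrow> cone_of \<theta> S = cone_of \<theta> S' \<Longrightarrow> S = S'"
  using cone_of_mono_iff by (metis order_refl subset_antisym)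

lemma fan_eq: "stability_parameter \<theta> \<Longrightarrow> fan \<Gamma> \<theta> = cone_of \<theta> ` {S. admissible \<theta> S}"
  proof -
  assume \<theta>: "stability_parameter \<theta>"
  have "distinguished \<Gamma> \<theta> = (\<lambda>S. iso_class \<Gamma> (ind S)) ` {S. admissible \<theta> S}"
    by (rule set_eqI, unfold distinguished_iff[OF \<theta>] image_iff admissible_def mem_Collect_eq) blast
  then show ?thesis by (simp add: fan_def cone_of_def image_image)
qed

lemma span_cone_of:
  assumes "stability_parameter \<theta>" "admissible \<theta> S"
  shows "coboundaries \<Gamma> \<subseteq> span (cone_of \<theta> S)"
    "pmatch \<mu> \<Longrightarrow> \<mu> \<inter> S = {} \<Longrightarrow> rv (pmi \<mu>) \<in> span (cone_of \<theta> S)"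
proof -
  have id: "rv (idelta f) \<in> span (cone_of \<theta> S)" for f
    using cone_ofI[OF assms, of 0 f] by (intro span_base) (simp add: cocharacters_iff)
  have "delta f \<in> span (cone_of \<theta> S)" for f
  proof -
    have "delta f = (\<Sum>i\<in>UNIV. f i *\<^sub>R rv (idelta (\<lambda>j. of_bool (j = i))))"
      by (simp add: vec_eq_iff delta_def rv_def idelta_def right_diff_distrib sum_subtractf)
    then show ?thesis using id by (simp only:) (intro span_sum span_mul)
  qed
  then show "coboundaries \<Gamma> \<subseteq> span (cone_of \<theta> S)" by (auto simp: coboundaries_eq)
  assume P: "pmatch \<mu>" "\<mu> \<inter> S = {}"
  have "rv (pmi \<mu> + idelta (\<lambda>i. 0)) \<in> cone_of \<theta> S"
    using P pmi_cocharacter by (intro cone_ofI assms) (auto simp: pmi_def)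
  moreover have "pmi \<mu> + idelta (\<lambda>i. 0) = pmi \<mu>" by (simp add: idelta_def vec_eq_iff)
  ultimately show "rv (pmi \<mu>) \<in> span (cone_of \<theta> S)" by (simp add: span_base)
qed

lemma dim_cone_of_le:
  assumes "stability_parameter \<theta>" "admissible \<theta> S"
  shows "dim (cone_of \<theta> S) \<le> dim (weights \<inter> vanishing S) + dim (coboundaries \<Gamma>)"
proof -
  have WS: "subspace (weights \<inter> vanishing S)" using subspace_weights subspace_vanishing by (rule subspace_inter)
  have "cone_of \<theta> S \<subseteq> {x + y |x y. x \<in> weights \<inter> vanishing S \<and> y \<in> coboundaries \<Gamma>}"
    using cone_of_subset[OF assms(1), of S] assms(2) unfolding coboundaries_eq nonneg_weights_def admissible_def by blast
  then have "dim (cone_of \<theta> S) \<le> dim {x + y |x y. x \<in> weights \<inter> vanishing S \<and> y \<in> coboundaries \<Gamma>}"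
    by (rule dim_subset)
  then show ?thesis using dim_sums_Int[OF WS subspace_coboundaries] by linarith
qed

text \<open>Weights of matchings avoiding \<open>S\<close> vanish on \<open>S\<close>, so their span
  meets the coboundaries only in 0 and the dimensions add.\<close>

lemma dim_cone_of_ge:
  assumes \<theta>: "stability_parameter \<theta>" and S: "admissible \<theta> S"
    and X: "X \<subseteq> {rv (pmi \<mu>) |\<mu>. pmatch \<mu> \<and> \<mu> \<inter> S = {}}"
  shows "dim X + dim (coboundaries \<Gamma>) \<le> dim (cone_of \<theta> S)"
proof -
  have "X \<subseteq> vanishing S" using X by (force simp: vanishing_def rv_def pmi_def)
  then have "span X \<subseteq> vanishing S" by (intro span_minimal subspace_vanishing)
  then have "span X \<inter> coboundaries \<Gamma> = {0}"
    using vanishing_coboundary[OF stable_spans[OF \<theta>]] S subspace_0[OF subspace_coboundaries] span_0[of X]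
    unfolding admissible_def by blast
  then have "dim {x + y |x y. x \<in> span X \<and> y \<in> coboundaries \<Gamma>} = dim (span X) + dim (coboundaries \<Gamma>)"
    using dim_sums_Int[OF subspace_span subspace_coboundaries, of X] by simp
  moreover have "X \<subseteq> span (cone_of \<theta> S)" using X span_cone_of(2)[OF \<theta> S] by blast
  then have "span X \<subseteq> span (cone_of \<theta> S)" by (intro span_minimal subspace_span)
  then have "{x + y |x y. x \<in> span X \<and> y \<in> coboundaries \<Gamma>} \<subseteq> span (cone_of \<theta> S)"
    using span_cone_of(1)[OF \<theta> S] span_add by blast
  then have "dim {x + y |x y. x \<in> span X \<and> y \<in> coboundaries \<Gamma>} \<le> dim (span (cone_of \<theta> S))" by (rule dim_subset)
  ultimately show ?thesis by simp
qed

lemma pmatch_nonempty: "pmatch \<mu> \<Longrightarrow> \<mu> \<noteq> {}"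
  unfolding pmatch_def by (metis Int_empty_left card.empty zero_neq_one)

lemma pmatch_subset: "pmatch \<mu> \<Longrightarrow> pmatch \<mu>' \<Longrightarrow> \<mu> \<subseteq> \<mu>' \<Longrightarrow> \<mu> = \<mu>'"
proof -
  assume P: "pmatch \<mu>" "pmatch \<mu>'" "\<mu> \<subseteq> \<mu>'"
  have "\<mu> \<inter> cls True a = \<mu>' \<inter> cls True a" for a
    by (rule card_subset_eq) (use P in \<open>auto simp: pmatch_def\<close>)
  then show ?thesis using cls_refl by blast
qed

lemma matching_above:
  assumes "admissible \<theta> S" "a \<notin> S"
  shows "\<exists>\<mu>. pmatch \<mu> \<and> a \<in> \<mu> \<and> \<mu> \<inter> S = {}"
proof -
  obtain w where w: "w \<in> interior_weights S" using assms(1) by (auto simp: admissible_def)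
  then have "\<exists>\<mu>. pmatch \<mu> \<and> a \<in> \<mu> \<and> \<mu> \<subseteq> {a. w $ a > 0}"
    using assms(2) by (intro perfect_matching_through) (auto simp: interior_weights_def less_le)
  moreover have "{a. w $ a > 0} \<inter> S = {}" using w by (auto simp: interior_weights_def)
  ultimately show ?thesis by blast
qed

lemma admissible_pmatch:
  assumes "admissible \<theta> S" "pmatch \<mu>" "\<mu> \<inter> S = {}"
  shows "admissible \<theta> (- \<mu>)"
  using assms interior_weights_pmatch stable_mono[of \<theta> S "- \<mu>"] unfolding admissible_def by blast

text \<open>If \<open>S\<close> is not the complement of one matching, two different matchings avoid
  it and give independent weights, too many for a ray. Conversely the weights supported on one
  matching form a line.\<close>

lemma cones_1_eq:
  assumes \<theta>: "stability_parameter \<theta>"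
  shows "cones \<Gamma> \<theta> 1 = {cone_of \<theta> (- \<mu>) |\<mu>. pmatch \<mu> \<and> admissible \<theta> (- \<mu>)}"
proof (intro equalityI subsetI)
  fix \<rho> assume "\<rho> \<in> cones \<Gamma> \<theta> 1"
  then obtain S where S: "admissible \<theta> S" "\<rho> = cone_of \<theta> S" "dim \<rho> = 1 + dim (coboundaries \<Gamma>)"
    by (auto simp: cones_def fan_eq[OF \<theta>])
  have "S \<noteq> UNIV"
  proof
    assume "S = UNIV"
    then have "weights \<inter> vanishing S \<subseteq> {0}" by (auto simp: vanishing_def vec_eq_iff)
    then have "dim (weights \<inter> vanishing S) = 0" using dim_eq_0 by blast
    then show False using dim_cone_of_le[OF \<theta> S(1)] S(3) unfolding S(2) by linarith
  qed
  then obtain a where "a \<notin> S" by blast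
  then obtain \<mu> where P: "pmatch \<mu>" "\<mu> \<inter> S = {}" using matching_above[OF S(1)] by blast
  have "S = - \<mu>"
  proof (rule ccontr)
    assume "S \<noteq> - \<mu>"
    then obtain b where "b \<notin> S" "b \<notin> \<mu>" using P(2) by blast
    then obtain \<mu>' where P': "pmatch \<mu>'" "b \<in> \<mu>'" "\<mu>' \<inter> S = {}" using matching_above[OF S(1)] by blast
    obtain a' where a': "a' \<in> \<mu>" "a' \<notin> \<mu>'" using pmatch_subset[OF P(1) P'(1)] P'(2) \<open>b \<notin> \<mu>\<close> by blast
    let ?x = "rv (pmi \<mu>)" and ?y = "rv (pmi \<mu>')"
    have "?x \<notin> span {?y}"
    proof
      assume "?x \<in> span {?y}"
      then obtain r where "?x = r *\<^sub>R ?y" by (auto simp: span_singleton)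
      then have "?x $ a' = r * ?y $ a'" by simp
      then show False using a' by (simp add: rv_def pmi_def)
    qed
    moreover have "?y $ b = 1" using P'(2) by (simp add: rv_def pmi_def)
    then have "?y \<noteq> 0" by (metis zero_index zero_neq_one)
    ultimately have "dim {?x, ?y} = 2" by (simp add: dim_insert)
    moreover have "{?x, ?y} \<subseteq> {rv (pmi \<mu>) |\<mu>. pmatch \<mu> \<and> \<mu> \<inter> S = {}}" using P P' by blast
    ultimately have "2 + dim (coboundaries \<Gamma>) \<le> dim (cone_of \<theta> S)"
      using dim_cone_of_ge[OF \<theta> S(1), of "{?x, ?y}"] by (simp only:)
    then show False using S(3) unfolding S(2) by simp
  qed
  then show "\<rho> \<in> {cone_of \<theta> (- \<mu>) |\<mu>. pmatch \<mu> \<and> admissible \<theta> (- \<mu>)}" using P S by blast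
next
  fix \<rho> assume "\<rho> \<in> {cone_of \<theta> (- \<mu>) |\<mu>. pmatch \<mu> \<and> admissible \<theta> (- \<mu>)}"
  then obtain \<mu> where P: "\<rho> = cone_of \<theta> (- \<mu>)" "pmatch \<mu>" "admissible \<theta> (- \<mu>)" by blast
  let ?x = "rv (pmi \<mu>)"
  have "weights \<inter> vanishing (- \<mu>) \<subseteq> span {?x}"
    using pmatch_weight[OF P(2)] by (auto simp: span_singleton)
  then have "dim (weights \<inter> vanishing (- \<mu>)) \<le> dim {?x}" by (metis dim_span dim_subset)
  also have "\<dots> \<le> 1" by (simp add: dim_insert)
  finally have le: "dim \<rho> \<le> 1 + dim (coboundaries \<Gamma>)" using dim_cone_of_le[OF \<theta> P(3)] unfolding P(1) by linarith
  obtain a where "a \<in> \<mu>" using pmatch_nonempty[OF P(2)] by blast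
  then have "?x $ a = 1" by (simp add: rv_def pmi_def)
  then have "?x \<noteq> 0" by (metis zero_index zero_neq_one)
  then have "dim {?x} = 1" by (simp add: dim_insert)
  moreover have "{?x} \<subseteq> {rv (pmi \<mu>') |\<mu>'. pmatch \<mu>' \<and> \<mu>' \<inter> - \<mu> = {}}" using P(2) by blast
  ultimately have "1 + dim (coboundaries \<Gamma>) \<le> dim \<rho>"
    using dim_cone_of_ge[OF \<theta> P(3), of "{?x}"] by (simp only: P(1))
  then have "dim \<rho> = 1 + dim (coboundaries \<Gamma>)" using le by simp
  then show "\<rho> \<in> cones \<Gamma> \<theta> 1" using P by (auto simp: cones_def fan_eq[OF \<theta>])
qed

lemma rays_cone_of:
  assumes \<theta>: "stability_parameter \<theta>" and S: "admissible \<theta> S"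
  shows "rays \<Gamma> \<theta> (cone_of \<theta> S) = {cone_of \<theta> (- \<mu>) |\<mu>. pmatch \<mu> \<and> \<mu> \<inter> S = {}}"
proof (intro equalityI subsetI)
  fix \<rho> assume "\<rho> \<in> rays \<Gamma> \<theta> (cone_of \<theta> S)"
  then obtain \<mu> where P: "\<rho> = cone_of \<theta> (- \<mu>)" "pmatch \<mu>" "admissible \<theta> (- \<mu>)" "cone_of \<theta> (- \<mu>) \<subseteq> cone_of \<theta> S"
    unfolding rays_def cones_1_eq[OF \<theta>] by blast
  then have "S \<subseteq> - \<mu>" using cone_of_mono_iff[OF \<theta> P(3) S] by simp
  then show "\<rho> \<in> {cone_of \<theta> (- \<mu>) |\<mu>. pmatch \<mu> \<and> \<mu> \<inter> S = {}}" using P by blast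
next
  fix \<rho> assume "\<rho> \<in> {cone_of \<theta> (- \<mu>) |\<mu>. pmatch \<mu> \<and> \<mu> \<inter> S = {}}"
  then obtain \<mu> where P: "\<rho> = cone_of \<theta> (- \<mu>)" "pmatch \<mu>" "\<mu> \<inter> S = {}" by blast
  have ad: "admissible \<theta> (- \<mu>)" by (rule admissible_pmatch[OF S P(2,3)])
  then have "cone_of \<theta> (- \<mu>) \<subseteq> cone_of \<theta> S" using cone_of_mono_iff[OF \<theta> ad S] P(3) by blast
  then show "\<rho> \<in> rays \<Gamma> \<theta> (cone_of \<theta> S)" unfolding rays_def cones_1_eq[OF \<theta>] using P ad by blast
qed

text \<open>All representations in the orbit of the ray have support \<open>- \<mu>\<close>, so the
  choice made in \<open>matching\<close> does not matter.\<close>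

lemma matching_cone_of:
  assumes \<theta>: "stability_parameter \<theta>" and P: "pmatch \<mu>" "admissible \<theta> (- \<mu>)"
  shows "matching \<Gamma> \<theta> (cone_of \<theta> (- \<mu>)) = \<mu>"
proof -
  let ?O = "\<Union>(torus_orbit \<Gamma> \<theta> (cone_of \<theta> (- \<mu>)))"
  have supp: "supp v = - \<mu>" if v: "v \<in> ?O" for v
  proof -
    obtain s v' where s: "v \<in> iso_class \<Gamma> (\<chi> a. s $ a * v' $ a)" "s \<in> big_torus \<Gamma>"
      "iso_class \<Gamma> v' \<in> distinguished \<Gamma> \<theta>" "cone_at \<Gamma> \<theta> (iso_class \<Gamma> v') = cone_of \<theta> (- \<mu>)"
      using v by (auto simp: torus_orbit_def)
    obtain S where S: "admissible \<theta> S" "iso_class \<Gamma> v' = iso_class \<Gamma> (ind S)"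
      using s(3) distinguished_iff[OF \<theta>] by (auto simp: admissible_def)
    then have "cone_of \<theta> S = cone_of \<theta> (- \<mu>)" using s(4) by (simp add: cone_of_def)
    then have "S = - \<mu>" by (rule cone_of_inj[OF \<theta> S(1) P(2)])
    moreover have "supp v' = S" using iso_class_eqD[OF S(2)] supp_act by auto
    moreover have "supp v = supp (\<chi> a. s $ a * v' $ a)" using s(1) supp_act by (auto simp: iso_class_act)
    moreover have "supp (\<chi> a. s $ a * v' $ a) = supp v'" using s(2) by (simp add: supp_def big_torus_def)
    ultimately show ?thesis by simp
  qed
  have "ind (- \<mu>) \<in> ?O"
  proof -
    let ?s = "(\<chi> a. 1) :: complex ^ 'e"
    have "?s \<in> big_torus \<Gamma>" by (simp add: big_torus_def is_module_def)
    moreover have "theta_stable \<Gamma> \<theta> (ind (- \<mu>))"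
      using P is_module_ind by (auto simp: theta_stable_iff admissible_def)
    moreover have "iso_class \<Gamma> (ind (- \<mu>)) \<in> distinguished \<Gamma> \<theta>"
      using P(2) unfolding distinguished_iff[OF \<theta>] admissible_def by blast
    moreover have "cone_at \<Gamma> \<theta> (iso_class \<Gamma> (ind (- \<mu>))) = cone_of \<theta> (- \<mu>)" by (simp add: cone_of_def)
    ultimately have "iso_class \<Gamma> (\<chi> a. ?s $ a * ind (- \<mu>) $ a) \<in> torus_orbit \<Gamma> \<theta> (cone_of \<theta> (- \<mu>))"
      unfolding torus_orbit_def by blast
    moreover have "(\<chi> a. ?s $ a * ind (- \<mu>) $ a) = ind (- \<mu>)" by (simp add: vec_eq_iff)
    ultimately show ?thesis using iso_class_self by auto
  qed
  then have "(SOME v. v \<in> ?O) \<in> ?O" by (rule someI[of "\<lambda>v. v \<in> ?O"])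
  then have "supp (SOME v. v \<in> ?O) = - \<mu>" by (rule supp)
  then have "{a. (SOME v. v \<in> ?O) $ a = 0} = \<mu>" unfolding supp_def by blast
  then show ?thesis by (simp add: matching_def)
qed

lemma matchings_of_rays:
  assumes "stability_parameter \<theta>" "admissible \<theta> S"
  shows "matching \<Gamma> \<theta> ` rays \<Gamma> \<theta> (cone_of \<theta> S) = {\<mu>. pmatch \<mu> \<and> \<mu> \<inter> S = {}}"
proof -
  have "matching \<Gamma> \<theta> (cone_of \<theta> (- \<mu>)) = \<mu>" if "pmatch \<mu>" "\<mu> \<inter> S = {}" for \<mu>
    using matching_cone_of[OF assms(1) that(1) admissible_pmatch[OF assms(2) that]] .
  then show ?thesis unfolding rays_cone_of[OF assms] by (auto simp: image_iff)
qed

lemma cone_module_cone_of: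
  assumes "stability_parameter \<theta>" "admissible \<theta> S"
  shows "cone_module \<Gamma> \<theta> (cone_of \<theta> S) = ind S" "cone_arrows \<Gamma> \<theta> (cone_of \<theta> S) = S"
proof -
  have "(\<Union>\<rho>\<in>rays \<Gamma> \<theta> (cone_of \<theta> S). matching \<Gamma> \<theta> \<rho>) = \<Union>{\<mu>. pmatch \<mu> \<and> \<mu> \<inter> S = {}}"
    using matchings_of_rays[OF assms] by simp
  also have "\<dots> = - S" using matching_above[OF assms(2)] by blast
  finally show "cone_module \<Gamma> \<theta> (cone_of \<theta> S) = ind S" by (simp add: cone_module_def ind_def vec_eq_iff)
  then show "cone_arrows \<Gamma> \<theta> (cone_of \<theta> S) = S" using supp_ind[of S] by (simp add: cone_arrows_def supp_def)
qed

lemma theta_stable_ind: "admissible \<theta> S \<Longrightarrow> theta_stable \<Gamma> \<theta> (ind S)"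
  using is_module_ind by (auto simp: theta_stable_iff admissible_def)

lemma cones_3D:
  assumes "stability_parameter \<theta>" "\<sigma> \<in> cones \<Gamma> \<theta> 3"
  obtains S where "admissible \<theta> S" "\<sigma> = cone_of \<theta> S" "dim (weights \<inter> vanishing S) \<ge> 3"
proof -
  obtain S where S: "admissible \<theta> S" "\<sigma> = cone_of \<theta> S" "dim \<sigma> = 3 + dim (coboundaries \<Gamma>)"
    using assms(2) by (auto simp: cones_def fan_eq[OF assms(1)])
  have "dim (weights \<inter> vanishing S) \<ge> 3" using S(3) dim_cone_of_le[OF assms(1) S(1)] unfolding S(2) by linarith
  then show ?thesis using that S by blast
qed


section \<open>Fundamental hexagons\<close>

text \<open>The vertices of a lift form the graph of a function whose differences along
  \<open>S\<close> are the displacements. Two such functions differ by a constant, as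
  \<open>S\<close> connects all vertices, and passing through \<open>i\<close> makes it 0.\<close>

lemma lifted_quiver_vertices:
  assumes S: "spans S" "cone_arrows \<Gamma> \<theta> \<sigma> = S"
    and l: "\<And>a. a \<in> S \<Longrightarrow> dsp a = l (head \<Gamma> a) - l (tail \<Gamma> a)" "l (fst i) = snd i"
  shows "fst (lifted_quiver \<Gamma> \<theta> \<sigma> i) = range (\<lambda>j. (j, l j))"
proof -
  define V where "V = range (\<lambda>j. (j, l j))"
  define A where "A = {x. fst x \<in> S \<and> Hd x \<in> V}"
  have V: "y \<in> V \<longleftrightarrow> snd y = l (fst y)" for y by (auto simp: V_def image_iff prod_eq_iff)
  have inj_A: "x = y" if "x \<in> A" "y \<in> A" "fst x = fst y" for x y
  proof -
    have "snd (Hd x) = snd (Hd y)" using that by (simp add: A_def V)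
    moreover have "snd (Hd x) = snd (Hd (fst x, 0)) + snd x" "snd (Hd y) = snd (Hd (fst x, 0)) + snd y"
      using that(3) by (subst Hd_eq, simp)+
    ultimately show ?thesis using that(3) by (cases x; cases y) simp
  qed
  have "(THE Q. i \<in> fst Q \<and> lifts_subquiver \<Gamma> S Q) = (V, A)"
  proof (rule the_equality)
    have "i \<in> V" by (simp add: V l(2))
    moreover have "Tl x \<in> V" if "x \<in> A" for x
      using that dsp_lift[of x] l(1)[of "fst x"] by (simp add: A_def V algebra_simps)
    moreover have "bij_betw fst V UNIV" unfolding bij_betw_def V_def by (auto simp: inj_on_def image_image)
    moreover have "bij_betw fst A S"
      unfolding bij_betw_def
    proof
      show "inj_on fst A" using inj_A by (rule inj_onI)
      show "fst ` A = S"
      proof (intro equalityI subsetI)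
        fix a assume a: "a \<in> S"
        let ?x = "(a, l (head \<Gamma> a) - snd (Hd (a, 0)))"
        have "snd (Hd ?x) = l (head \<Gamma> a)" by (subst Hd_eq) simp
        then have "?x \<in> A" using a by (simp add: A_def V)
        then show "a \<in> fst ` A" by force
      qed (auto simp: A_def)
    qed
    ultimately show "i \<in> fst (V, A) \<and> lifts_subquiver \<Gamma> S (V, A)"
      by (simp add: lifts_subquiver_def) (simp add: A_def)
  next
    fix Q assume Q: "i \<in> fst Q \<and> lifts_subquiver \<Gamma> S Q"
    obtain V' A' where VA: "Q = (V', A')" by (cases Q)
    then have i: "i \<in> V'" and ends: "\<And>x. x \<in> A' \<Longrightarrow> Hd x \<in> V' \<and> Tl x \<in> V'"
      and bij: "bij_betw fst V' UNIV" "bij_betw fst A' S"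
      using Q by (simp_all add: lifts_subquiver_def)
    define l' where "l' = (\<lambda>j. snd (inv_into V' fst j))"
    have V': "y \<in> V' \<longleftrightarrow> snd y = l' (fst y)" for y
    proof
      assume "y \<in> V'"
      then show "snd y = l' (fst y)" using bij(1) by (simp add: l'_def bij_betw_def)
    next
      assume y: "snd y = l' (fst y)"
      have "fst y \<in> fst ` V'" using bij(1) by (simp add: bij_betw_def)
      then have "inv_into V' fst (fst y) \<in> V'" "fst (inv_into V' fst (fst y)) = fst y"
        by (rule inv_into_into, rule f_inv_into_f)
      moreover from this(2) have "inv_into V' fst (fst y) = y" using y by (simp add: l'_def prod_eqI)
      ultimately show "y \<in> V'" by simp
    qed
    have "dsp a = l' (head \<Gamma> a) - l' (tail \<Gamma> a)" if a: "a \<in> S" for a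
    proof -
      obtain x where x: "x \<in> A'" "fst x = a" using bij(2) a by (auto simp: bij_betw_def)
      then have "snd (Hd x) = l' (head \<Gamma> a)" "snd (Tl x) = l' (tail \<Gamma> a)" using ends[OF x(1)] by (simp_all add: V')
      then show ?thesis using dsp_lift[of x] x(2) by simp
    qed
    then have "l' (head \<Gamma> a) - l' (tail \<Gamma> a) = l (head \<Gamma> a) - l (tail \<Gamma> a)" if "a \<in> S" for a
      using l(1)[OF that] that by simp
    then have step: "l' (head \<Gamma> a) - l (head \<Gamma> a) = l' (tail \<Gamma> a) - l (tail \<Gamma> a)" if "a \<in> S" for a
      using that by (simp add: algebra_simps)
    have diff: "l' j - l j = l' (fst i) - l (fst i)" for j
      by (rule spans_const[OF S(1), of "\<lambda>j. l' j - l j"]) (rule step)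
    have "l' (fst i) = l (fst i)" using i l(2) by (simp add: V')
    then have "l' j = l j" for j using diff[of j] by simp
    then have "l' = l" by (rule ext)
    then have "V' = V" by (intro set_eqI) (simp add: V V')
    have "A' \<subseteq> A" using ends bij(2) unfolding A_def \<open>V' = V\<close> by (auto simp: bij_betw_def)
    moreover have "A \<subseteq> A'"
    proof
      fix x assume x: "x \<in> A"
      then have "fst x \<in> fst ` A'" using bij(2) by (simp add: A_def bij_betw_def)
      then obtain y where "y \<in> A'" "fst x = fst y" by blast
      then have "x = y" using inj_A x \<open>A' \<subseteq> A\<close> by blast
      then show "x \<in> A'" using \<open>y \<in> A'\<close> by simp
    qed
    ultimately show "Q = (V, A)" using VA \<open>V' = V\<close> by auto
  qed
  then show ?thesis by (simp add: lifted_quiver_def S(2) V_def)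
qed

lemma hexagon_region:
  assumes \<theta>: "stability_parameter \<theta>" and S: "admissible \<theta> S" "dim (weights \<inter> vanishing S) \<ge> 3"
  obtains l where "\<And>a. a \<in> S \<Longrightarrow> dsp a = l (head \<Gamma> a) - l (tail \<Gamma> a)"
    "hexagon \<Gamma> \<theta> (cone_of \<theta> S) i = region l UNIV"
proof -
  have sp: "spans S" using S(1) stable_spans[OF \<theta>] by (simp add: admissible_def)
  obtain l where l: "\<And>a. a \<in> S \<Longrightarrow> dsp a = l (head \<Gamma> a) - l (tail \<Gamma> a)" using lift_exists[OF sp S(2)] by metis
  \<comment> \<open>Shifted by a constant so that the lift passes through \<open>i\<close>.\<close>
  define l' where "l' = (\<lambda>j. l j - l (fst i) + snd i)"
  have l': "dsp a = l' (head \<Gamma> a) - l' (tail \<Gamma> a)" if "a \<in> S" for a using l[OF that] by (simp add: l'_def)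
  have "fst (lifted_quiver \<Gamma> \<theta> (cone_of \<theta> S) i) = range (\<lambda>j. (j, l' j))"
    by (rule lifted_quiver_vertices[OF sp cone_module_cone_of(2)[OF \<theta> S(1)] l']) (simp_all add: l'_def)
  then have "hexagon \<Gamma> \<theta> (cone_of \<theta> S) i = region l' UNIV"
    by (simp add: hexagon_def region_def image_image)
  then show ?thesis using that l' by blast
qed

text \<open>Both matchings have sum 1 at every node, so their difference is a cocycle, and cocycles
  are exact on the arrows inside the region.\<close>

lemma matching_difference_exact:
  assumes "pmatch \<mu>" "pmatch \<mu>'"
  obtains g :: "'v \<Rightarrow> real" where "\<And>a. dsp a = l (head \<Gamma> a) - l (tail \<Gamma> a) \<Longrightarrow>
    of_bool (a \<in> \<mu>) - of_bool (a \<in> \<mu>') = g (head \<Gamma> a) - g (tail \<Gamma> a)"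
proof -
  have c: "csum c a (rv (pmi \<nu>)) = 1" if "pmatch \<nu>" for c a \<nu>
  proof -
    have "csum c a (rv (pmi \<nu>)) = of_int (\<Sum>b\<in>cls c a. pmi \<nu> $ b)" by (simp add: csum_def rv_def)
    then show ?thesis using that by (simp add: sum_pmi pmatch_def)
  qed
  have "rv (pmi \<mu>) - rv (pmi \<mu>') \<in> flat" by (simp add: flat_def csum_linear c assms)
  then obtain g where g: "\<And>a. dsp a = l (head \<Gamma> a) - l (tail \<Gamma> a) \<Longrightarrow>
    (rv (pmi \<mu>) - rv (pmi \<mu>')) $ a = g (head \<Gamma> a) - g (tail \<Gamma> a)"
    using flat_exact by blast
  show ?thesis
  proof (rule that[of g])
    fix a assume "dsp a = l (head \<Gamma> a) - l (tail \<Gamma> a)"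
    from g[OF this] show "of_bool (a \<in> \<mu>) - of_bool (a \<in> \<mu>') = g (head \<Gamma> a) - g (tail \<Gamma> a)"
      by (simp add: rv_def pmi_def split: if_splits)
  qed
qed

text \<open>
  An edge outside \<open>S\<close> with both adjacent tiles in the hexagon belongs to every matching that avoids
  \<open>S\<close>: the hexagon may contain such slits.
\<close>

lemma slit_in_all_matchings:
  assumes S: "spans S" "\<And>a. a \<in> S \<Longrightarrow> dsp a = l (head \<Gamma> a) - l (tail \<Gamma> a)"
    and a: "dsp a = l (head \<Gamma> a) - l (tail \<Gamma> a)"
    and \<mu>: "pmatch \<mu>" "\<mu> \<inter> S = {}" "pmatch \<mu>'" "\<mu>' \<inter> S = {}"
  shows "a \<in> \<mu> \<longleftrightarrow> a \<in> \<mu>'"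
proof -
  obtain g :: "'v \<Rightarrow> real" where g: "\<And>a. dsp a = l (head \<Gamma> a) - l (tail \<Gamma> a) \<Longrightarrow>
    of_bool (a \<in> \<mu>) - of_bool (a \<in> \<mu>') = g (head \<Gamma> a) - g (tail \<Gamma> a)"
    using matching_difference_exact[OF \<mu>(1,3)] by blast
  have "g (head \<Gamma> b) = g (tail \<Gamma> b)" if b: "b \<in> S" for b
  proof -
    have "b \<notin> \<mu>" "b \<notin> \<mu>'" using b \<mu>(2,4) by blast+
    then show ?thesis using g[OF S(2)[OF b]] by simp
  qed
  then have "g (head \<Gamma> a) = g (tail \<Gamma> a)" by (rule spans_const[OF S(1)])
  then show ?thesis using g[OF a] by (simp add: of_bool_def split: if_splits)
qed

text \<open>For \<open>a\<close> in \<open>S\<close> but not in \<open>S'\<close>, a matching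
  avoiding \<open>S\<close> minus one through \<open>a\<close> avoiding \<open>S'\<close> has a
  potential on the common region. It rises along \<open>S'\<close> and falls along \<open>S\<close>,
  so stability makes it constant, yet it drops by 1 along \<open>a\<close>.\<close>

lemma arrows_determined_by_lift:
  assumes \<theta>: "stability_parameter \<theta>" and S: "admissible \<theta> S" "admissible \<theta> S'" "S \<noteq> UNIV"
    and l: "\<And>a. a \<in> S \<Longrightarrow> dsp a = l (head \<Gamma> a) - l (tail \<Gamma> a)"
      "\<And>a. a \<in> S' \<Longrightarrow> dsp a = l (head \<Gamma> a) - l (tail \<Gamma> a)"
  shows "S \<subseteq> S'"
proof (rule subsetI, rule ccontr)
  fix a assume a: "a \<in> S" "a \<notin> S'"
  obtain \<mu>' where \<mu>': "pmatch \<mu>'" "a \<in> \<mu>'" "\<mu>' \<inter> S' = {}" using matching_above[OF S(2) a(2)] by blast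
  obtain b where "b \<notin> S" using S(3) by blast
  then obtain \<mu> where \<mu>: "pmatch \<mu>" "\<mu> \<inter> S = {}" using matching_above[OF S(1)] by blast
  obtain g :: "'v \<Rightarrow> real" where g: "\<And>a. dsp a = l (head \<Gamma> a) - l (tail \<Gamma> a) \<Longrightarrow>
    of_bool (a \<in> \<mu>) - of_bool (a \<in> \<mu>') = g (head \<Gamma> a) - g (tail \<Gamma> a)"
    using matching_difference_exact[OF \<mu>(1) \<mu>'(1)] by blast
  have st: "stable \<theta> S'" "stable \<theta> S" using S by (simp_all add: admissible_def)
  have "g i = g j" for i j
  proof (rule stable_const[OF \<theta> st])
    show "g (tail \<Gamma> d) \<le> g (head \<Gamma> d)" if d: "d \<in> S'" for d
    proof -
      have "d \<notin> \<mu>'" using d \<mu>'(3) by blast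
      then show ?thesis using g[OF l(2)[OF d]] by (simp add: of_bool_def split: if_splits)
    qed
    show "g (head \<Gamma> d) \<le> g (tail \<Gamma> d)" if d: "d \<in> S" for d
    proof -
      have "d \<notin> \<mu>" using d \<mu>(2) by blast
      then show ?thesis using g[OF l(1)[OF d]] by (simp add: of_bool_def split: if_splits)
    qed
  qed
  then have "g (head \<Gamma> a) = g (tail \<Gamma> a)" by blast
  moreover have "a \<notin> \<mu>" using a(1) \<mu>(2) by blast
  ultimately show False using g[OF l(1)[OF a(1)]] \<mu>'(2) by simp
qed

section \<open>Assembling the rearrangement\<close>

lemma vanishing_dim_neq_UNIV: "dim (weights \<inter> vanishing S) \<ge> 3 \<Longrightarrow> S \<noteq> UNIV"
proof
  assume d: "dim (weights \<inter> vanishing S) \<ge> 3" and "S = UNIV"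
  then have "weights \<inter> vanishing S \<subseteq> {0}" by (auto simp: vanishing_def vec_eq_iff)
  then have "dim (weights \<inter> vanishing S) = 0" by (simp only: dim_eq_0)
  then show False using d by linarith
qed

lemma region_eqD: "region l UNIV = region l' UNIV \<Longrightarrow> l = l'"
proof
  fix j assume eq: "region l UNIV = region l' UNIV"
  have "interior (T (j, l j)) \<inter> region l UNIV \<noteq> {}" unfolding tile_in_region by simp
  then show "l j = l' j" unfolding eq tile_in_region by simp
qed

lemma translate_region:
  assumes "\<And>j. j \<in> C \<Longrightarrow> l' j = k + l j"
  shows "translate k (region l C) = region l' C"
proof -
  have "translate k (T (j, l j)) = T (j, l' j)" if "j \<in> C" for j
    using assms[OF that] by (simp add: T_Pair translate_add)
  then show ?thesis unfolding region_def translate_Union image_image by simp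
qed

lemma torus_proj_region: "torus_proj ` region l C = (\<Union>j\<in>C. torus_proj ` tile \<Gamma> j)"
  unfolding region_def by (simp add: image_UN T_Pair torus_proj_translate)

lemma torus_proj_region_subset:
  assumes "torus_proj ` region l C \<subseteq> torus_proj ` region l C'" shows "C \<subseteq> C'"
proof
  fix i assume i: "i \<in> C"
  obtain p where p: "p \<in> interior (T (i, l i))" using interior_T_nonempty by blast
  then have "p \<in> region l C" using i interior_subset unfolding region_def by blast
  then obtain q where q: "q \<in> region l C'" "torus_proj p = torus_proj q" using assms by blast
  then obtain j where j: "j \<in> C'" "q \<in> T (j, l j)" by (auto simp: region_def)
  obtain k where "p = shift k + q" using q(2) torus_proj_eq_iff by metis
  then have "p \<in> T (mv k (j, l j))" using j(2) by (simp add: tile_lift_mv mem_translate)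
  then have "mv k (j, l j) = (i, l i)" using interior_in_tile[OF p] by blast
  then show "i \<in> C'" using j(1) by (simp add: mv_def)
qed

lemma interior_region_disjoint: "C \<inter> C' = {} \<Longrightarrow> interior (region l C) \<inter> interior (region l C') = {}"
proof (rule ccontr)
  assume C: "C \<inter> C' = {}" and "interior (region l C) \<inter> interior (region l C') \<noteq> {}"
  then obtain z where z: "z \<in> interior (region l C)" "z \<in> interior (region l C')" by blast
  obtain y where "z \<in> T y" using T_cover by blast
  then have "fst y \<in> C" "fst y \<in> C'" using z tile_meets_interior_region by blast+
  then show False using C by blast
qed

lemma jigsaw_transformation:
  fixes pm :: "nat \<Rightarrow> 'e set"
  assumes \<theta>: "stability_parameter \<theta>"
    and \<sigma>: "\<sigma>p \<in> cones \<Gamma> \<theta> 3" "\<sigma>m \<in> cones \<Gamma> \<theta> 3"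
    and pmp: "matching \<Gamma> \<theta> ` rays \<Gamma> \<theta> \<sigma>p = {pm 0, pm 1, pm 2}"
    and pmm: "matching \<Gamma> \<theta> ` rays \<Gamma> \<theta> \<sigma>m = {pm 1, pm 2, pm 3}"
    and E: "E = sym_diff_edges (pm 1) (pm 3) \<inter> sym_diff_edges (pm 2) (pm 3)"
    and pieces: "pieces = cut_pieces \<Gamma> E (hexagon \<Gamma> \<theta> \<sigma>p i)"
  shows "\<Union>pieces = hexagon \<Gamma> \<theta> \<sigma>p i"
    "bij_betw (\<lambda>P. torus_proj ` P) pieces (jigsaw_pieces \<Gamma> (\<Union>k\<le>3. pm k))"
    "P \<in> pieces \<Longrightarrow> inj_on torus_proj (interior P)"
    "rearranges_to pieces (hexagon \<Gamma> \<theta> \<sigma>m i')"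
    "theta_stable \<Gamma> \<theta> (cone_module \<Gamma> \<theta> \<sigma>m)"
    "\<sigma> \<in> cones \<Gamma> \<theta> 3 \<Longrightarrow> hexagon \<Gamma> \<theta> \<sigma> i'' = hexagon \<Gamma> \<theta> \<sigma>m i' \<Longrightarrow> cone_module \<Gamma> \<theta> \<sigma> = cone_module \<Gamma> \<theta> \<sigma>m"
proof -
  obtain Sp where Sp: "admissible \<theta> Sp" "\<sigma>p = cone_of \<theta> Sp" "dim (weights \<inter> vanishing Sp) \<ge> 3"
    using cones_3D[OF \<theta> \<sigma>(1)] by metis
  obtain Sm where Sm: "admissible \<theta> Sm" "\<sigma>m = cone_of \<theta> Sm" "dim (weights \<inter> vanishing Sm) \<ge> 3"
    using cones_3D[OF \<theta> \<sigma>(2)] by metis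
  obtain lp where lp: "\<And>a. a \<in> Sp \<Longrightarrow> dsp a = lp (head \<Gamma> a) - lp (tail \<Gamma> a)"
    and Hp: "hexagon \<Gamma> \<theta> \<sigma>p i = region lp UNIV"
    using hexagon_region[OF \<theta> Sp(1,3), of i] unfolding Sp(2) by metis
  obtain lm where lm: "\<And>a. a \<in> Sm \<Longrightarrow> dsp a = lm (head \<Gamma> a) - lm (tail \<Gamma> a)"
    and Hm: "hexagon \<Gamma> \<theta> \<sigma>m i' = region lm UNIV"
    using hexagon_region[OF \<theta> Sm(1,3), of i'] unfolding Sm(2) by metis
  have mp: "{pm 0, pm 1, pm 2} = {\<mu>. pmatch \<mu> \<and> \<mu> \<inter> Sp = {}}"
    using pmp matchings_of_rays[OF \<theta> Sp(1)] unfolding Sp(2) by simp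
  have mm: "{pm 1, pm 2, pm 3} = {\<mu>. pmatch \<mu> \<and> \<mu> \<inter> Sm = {}}"
    using pmm matchings_of_rays[OF \<theta> Sm(1)] unfolding Sm(2) by simp
  have pm: "pmatch (pm 0)" "pmatch (pm 1)" "pmatch (pm 2)" "pmatch (pm 3)" using mp mm by blast+
  have dis: "pm 0 \<inter> Sp = {}" "pm 1 \<inter> Sp = {}" "pm 2 \<inter> Sp = {}" using mp by blast+
  have "- Sp = \<Union>{pm 0, pm 1, pm 2}" unfolding mp using matching_above[OF Sp(1)] by blast
  then have Sp_eq: "a \<in> Sp \<longleftrightarrow> a \<notin> pm 0 \<and> a \<notin> pm 1 \<and> a \<notin> pm 2" for a by blast
  have "- Sm = \<Union>{pm 1, pm 2, pm 3}" unfolding mm using matching_above[OF Sm(1)] by blast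
  then have Sm_eq: "a \<in> Sm \<longleftrightarrow> a \<notin> pm 1 \<and> a \<notin> pm 2 \<and> a \<notin> pm 3" for a by blast
  have E_eq: "a \<in> E \<longleftrightarrow> (a \<in> pm 1 \<longleftrightarrow> a \<notin> pm 3) \<and> (a \<in> pm 2 \<longleftrightarrow> a \<notin> pm 3)" for a
    unfolding E sym_diff_edges_def by blast
  \<comment> \<open>The arrows common to both cones are those in none of the four matchings, so one
    relation \<open>R\<close> describes the pieces in the hexagon and on the torus.\<close>
  define S where "S = Sp \<inter> Sm"
  define X where "X = pm 0 \<inter> pm 1 \<inter> pm 2 \<inter> pm 3"
  define R where "R = equivclp (adjacent S)"
  have R: "equivp R" unfolding R_def by simp
  have le3: "{..3} = {0, 1, 2, 3 :: nat}" by auto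
  have S_compl: "- (\<Union>k\<le>3. pm k) = S" unfolding le3 S_def by (auto simp: Sp_eq Sm_eq)
  have spans_p: "spans Sp" using Sp(1) stable_spans[OF \<theta>] by (simp add: admissible_def)
  have "cut_pieces \<Gamma> E (region lp UNIV) = range (\<lambda>i. region lp {j. equivclp (adjacent S) i j})"
  proof (rule cut_pieces_eq[where X = X])
    show "dsp a = lp (head \<Gamma> a) - lp (tail \<Gamma> a)" if "a \<in> S" for a using lp that by (simp add: S_def)
    show "S \<inter> E = {}" by (auto simp: S_def Sp_eq Sm_eq E_eq)
    \<comment> \<open>Inside the hexagon the first three matchings agree at \<open>a\<close>. If
      they contain it, the fourth decides between \<open>X\<close> and \<open>E\<close>; if not, it
      decides between \<open>E\<close> and \<open>S\<close>.\<close>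
    show "a \<in> S \<or> a \<in> E \<or> a \<in> X" if a: "dsp a = lp (head \<Gamma> a) - lp (tail \<Gamma> a)" for a
    proof -
      have "a \<in> pm 0 \<longleftrightarrow> a \<in> pm 1" "a \<in> pm 0 \<longleftrightarrow> a \<in> pm 2"
        by (rule slit_in_all_matchings[OF spans_p lp a pm(1) dis(1) pm(2) dis(2)],
            assumption, rule slit_in_all_matchings[OF spans_p lp a pm(1) dis(1) pm(3) dis(3)], assumption)
      then show ?thesis by (auto simp: S_def X_def Sp_eq Sm_eq E_eq)
    qed
    \<comment> \<open>A perfect matching has one edge at each node, so the other edges at the ends
      of a slit lie in none of the four matchings.\<close>
    show "b \<in> S" if ab: "a \<in> X" "b \<in> cls c a" "b \<noteq> a" for a b c
    proof -
      have "b \<notin> \<mu>" if \<mu>: "pmatch \<mu>" "a \<in> \<mu>" for \<mu>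
      proof
        assume "b \<in> \<mu>"
        then have "{a, b} \<subseteq> \<mu> \<inter> cls c a" using \<mu> ab by simp
        then have "card {a, b} \<le> card (\<mu> \<inter> cls c a)" by (intro card_mono) auto
        then show False using \<mu>(1) ab(3) by (simp add: pmatch_def)
      qed
      then show ?thesis using ab(1) pm by (simp add: S_def Sp_eq Sm_eq X_def)
    qed
  qed
  then have pieces_eq: "pieces = range (\<lambda>i. region lp {j. R i j})" by (simp add: pieces Hp R_def)
  have jig: "jigsaw_pieces \<Gamma> (\<Union>k\<le>3. pm k) = range (\<lambda>i. torus_proj ` region lp {j. R i j})"
    unfolding torus_proj_region R_def S_compl[symmetric]
  proof (rule jigsaw_pieces_eq)
    fix c a
    have "pm 0 \<inter> cls c a \<noteq> {}" using pm(1) unfolding pmatch_def by (metis card.empty zero_neq_one)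
    then show "cls c a \<inter> (\<Union>k\<le>3. pm k) \<noteq> {}" unfolding le3 by blast
  qed
  have R_classes: "{j. R i j} = {j. R i' j} \<or> {j. R i j} \<inter> {j. R i' j} = {}" for i i'
    using equivp_symp[OF R] equivp_transp[OF R] by blast
  show "\<Union>pieces = hexagon \<Gamma> \<theta> \<sigma>p i"
    unfolding pieces_eq Hp region_def using equivp_reflp[OF R] by blast
  show "bij_betw (\<lambda>P. torus_proj ` P) pieces (jigsaw_pieces \<Gamma> (\<Union>k\<le>3. pm k))"
    unfolding bij_betw_def jig pieces_eq
  proof
    show "inj_on (\<lambda>P. torus_proj ` P) (range (\<lambda>i. region lp {j. R i j}))"
    proof (rule inj_onI)
      fix P P' assume "P \<in> range (\<lambda>i. region lp {j. R i j})" "P' \<in> range (\<lambda>i. region lp {j. R i j})"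
        and eq: "torus_proj ` P = torus_proj ` P'"
      then obtain k k' where P: "P = region lp {j. R k j}" "P' = region lp {j. R k' j}" by blast
      have "{j. R k j} = {j. R k' j}"
        using torus_proj_region_subset[of lp] eq unfolding P by (metis subset_antisym order_refl)
      then show "P = P'" by (simp add: P)
    qed
  qed (simp add: image_image)
  show "inj_on torus_proj (interior P)" if "P \<in> pieces"
    using that inj_on_interior_region unfolding pieces_eq by blast
  \<comment> \<open>Along a common arrow both lifts change by its displacement, so their difference
    is constant on each class of \<open>R\<close>.\<close>
  have shift_const: "lm j - lp j = lm k - lp k" if "R k j" for j k
    using that unfolding R_def
  proof (induction rule: equivclp_induct)
    case (step y z)
    have "lm (head \<Gamma> a) - lp (head \<Gamma> a) = lm (tail \<Gamma> a) - lp (tail \<Gamma> a)" if "a \<in> S" for a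
    proof -
      have "lm (head \<Gamma> a) - lm (tail \<Gamma> a) = lp (head \<Gamma> a) - lp (tail \<Gamma> a)"
        using lp[of a] lm[of a] that by (simp add: S_def)
      then show ?thesis by (simp add: algebra_simps)
    qed
    then have "lm z - lp z = lm y - lp y" using step.hyps(2) by (auto simp: adjacent_def)
    then show ?case using step.IH by simp
  qed simp
  show "rearranges_to pieces (hexagon \<Gamma> \<theta> \<sigma>m i')"
  proof -
    \<comment> \<open>The translations are indexed by pieces as plain sets, so a representative tile
      is chosen for each; by \<open>shift_const\<close> the resulting vector does not depend on
      it.\<close>
    define c where "c = (\<lambda>P. SOME k. P = region lp {j. R k j})"
    define m where "m = (\<lambda>P. lm (c P) - lp (c P))"
    have c: "P = region lp {j. R (c P) j}" if "P \<in> pieces" for P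
    proof -
      have "\<exists>k. P = region lp {j. R k j}" using that unfolding pieces_eq by blast
      then show ?thesis unfolding c_def by (rule someI_ex)
    qed
    have tr: "translate (m P) P = region lm {j. R (c P) j}" if "P \<in> pieces" for P
    proof -
      have "translate (m P) (region lp {j. R (c P) j}) = region lm {j. R (c P) j}"
        proof (rule translate_region)
        fix j assume "j \<in> {j. R (c P) j}"
        then have "lm j - lp j = m P" using shift_const[of "c P" j] by (simp add: m_def)
        then show "lm j = m P + lp j" by (metis diff_add_cancel)
      qed
      then show ?thesis using c[OF that] by simp
    qed
    have cover: "\<exists>P\<in>pieces. R (c P) j" for j
    proof -
      have P: "region lp {k. R j k} \<in> pieces" unfolding pieces_eq by blast
      have "torus_proj ` region lp {k. R j k} \<subseteq> torus_proj ` region lp {k. R (c (region lp {k. R j k})) k}"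
        using c[OF P] by simp
      then have "{k. R j k} \<subseteq> {k. R (c (region lp {k. R j k})) k}" by (rule torus_proj_region_subset)
      then have "R (c (region lp {k. R j k})) j" using equivp_reflp[OF R] by blast
      then show ?thesis using P by blast
    qed
    have "(\<Union>P\<in>pieces. translate (m P) P) = region lm UNIV"
    proof -
      have "(\<Union>P\<in>pieces. translate (m P) P) = (\<Union>P\<in>pieces. region lm {j. R (c P) j})" using tr by simp
      also have "\<dots> = region lm UNIV" unfolding region_def using cover by blast
      finally show ?thesis .
    qed
    moreover have "pairwise (\<lambda>P P'. interior (translate (m P) P) \<inter> interior (translate (m P') P') = {}) pieces"
    proof (rule pairwiseI)
      fix P P' assume P: "P \<in> pieces" "P' \<in> pieces" "P \<noteq> P'"
      then have "{j. R (c P) j} \<noteq> {j. R (c P') j}" using c by metis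
      then have "{j. R (c P) j} \<inter> {j. R (c P') j} = {}" using R_classes by blast
      then show "interior (translate (m P) P) \<inter> interior (translate (m P') P') = {}"
        unfolding tr[OF P(1)] tr[OF P(2)] by (rule interior_region_disjoint)
    qed
    ultimately show ?thesis unfolding rearranges_to_def Hm by blast
  qed
  show "theta_stable \<Gamma> \<theta> (cone_module \<Gamma> \<theta> \<sigma>m)"
    unfolding Sm(2) cone_module_cone_of(1)[OF \<theta> Sm(1)] by (rule theta_stable_ind[OF Sm(1)])
  show "cone_module \<Gamma> \<theta> \<sigma> = cone_module \<Gamma> \<theta> \<sigma>m"
    if \<sigma>3: "\<sigma> \<in> cones \<Gamma> \<theta> 3" and eq: "hexagon \<Gamma> \<theta> \<sigma> i'' = hexagon \<Gamma> \<theta> \<sigma>m i'"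
  proof -
    obtain S' where S': "admissible \<theta> S'" "\<sigma> = cone_of \<theta> S'" "dim (weights \<inter> vanishing S') \<ge> 3"
      using cones_3D[OF \<theta> \<sigma>3] by metis
    obtain l where l: "\<And>a. a \<in> S' \<Longrightarrow> dsp a = l (head \<Gamma> a) - l (tail \<Gamma> a)"
      and H: "hexagon \<Gamma> \<theta> \<sigma> i'' = region l UNIV"
      using hexagon_region[OF \<theta> S'(1,3), of i''] unfolding S'(2) by metis
    have "l = lm" using eq unfolding H Hm by (rule region_eqD)
    then have "S' = Sm"
      using arrows_determined_by_lift[OF \<theta> S'(1) Sm(1) vanishing_dim_neq_UNIV[OF S'(3)], of lm]
        arrows_determined_by_lift[OF \<theta> Sm(1) S'(1) vanishing_dim_neq_UNIV[OF Sm(3)], of lm] l lm by blast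
    then show ?thesis by (simp add: S'(2) Sm(2))
  qed
qed

end

theorem theorem3p12:
  fixes \<Gamma> :: "('v::finite, 'e::finite) dimer" and \<theta> :: "'v \<Rightarrow> rat"
    and \<sigma>p \<sigma>m \<rho>0 \<rho>1 \<rho>2 \<rho>3 :: "(real ^ 'e) set"
    and pm :: "nat \<Rightarrow> 'e set" and c_minus :: "'e set"
  assumes "dimer_model \<Gamma>" and "consistent \<Gamma>"
    and "stability_parameter \<theta>" and "generic \<Gamma> \<theta>"
    and "\<sigma>p \<in> cones \<Gamma> \<theta> 3" and "\<sigma>m \<in> cones \<Gamma> \<theta> 3" and "\<sigma>p \<noteq> \<sigma>m"
    and "\<sigma>p \<inter> \<sigma>m \<in> cones \<Gamma> \<theta> 2"
    and "rays \<Gamma> \<theta> \<sigma>p = {\<rho>0, \<rho>1, \<rho>2}" and "rays \<Gamma> \<theta> \<sigma>m = {\<rho>1, \<rho>2, \<rho>3}"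
    and "pm 0 = matching \<Gamma> \<theta> \<rho>0" and "pm 1 = matching \<Gamma> \<theta> \<rho>1"
    and "pm 2 = matching \<Gamma> \<theta> \<rho>2" and "pm 3 = matching \<Gamma> \<theta> \<rho>3"
    and "c_minus = sym_diff_edges (pm 1) (pm 3) \<inter> sym_diff_edges (pm 2) (pm 3)"
  shows "\<forall>i i' :: 'v lifted.
    let Hp = hexagon \<Gamma> \<theta> \<sigma>p i;
        Hm = hexagon \<Gamma> \<theta> \<sigma>m i';
        pieces = cut_pieces \<Gamma> c_minus Hp
    in \<Union>pieces = Hp \<and>
       bij_betw (\<lambda>P. torus_proj ` P) pieces (jigsaw_pieces \<Gamma> (\<Union>k\<le>3. pm k)) \<and>
       (\<forall>P\<in>pieces. inj_on torus_proj (interior P)) \<and>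
       rearranges_to pieces Hm \<and>
       theta_stable \<Gamma> \<theta> (cone_module \<Gamma> \<theta> \<sigma>m) \<and>
       (\<forall>\<sigma>\<in>cones \<Gamma> \<theta> 3. \<forall>i''. hexagon \<Gamma> \<theta> \<sigma> i'' = Hm \<longrightarrow>
          cone_module \<Gamma> \<theta> \<sigma> = cone_module \<Gamma> \<theta> \<sigma>m)"
proof -
  interpret dimer_geometry \<Gamma> by unfold_locales (rule assms(1))
  have p: "matching \<Gamma> \<theta> ` rays \<Gamma> \<theta> \<sigma>p = {pm 0, pm 1, pm 2}"
    and m: "matching \<Gamma> \<theta> ` rays \<Gamma> \<theta> \<sigma>m = {pm 1, pm 2, pm 3}"
    by (simp_all only: assms(9-14) image_insert image_empty)
  note J = jigsaw_transformation[OF assms(3,5,6) p m assms(15) refl]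
  show ?thesis
    unfolding Let_def
    by (intro allI conjI ballI impI) (rule J(1), rule J(2), rule J(3), assumption, rule J(4), rule J(5), rule J(6))
qed

end
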